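(* Let $K$ be any field and let $E$ be any finite directed graph. Let $d$ be a simple closed path in $E$ and let $T=V_{[q]}$ be a Chen simple left $L_K(E)$-module. (1) If $T\neq V_{[d^\infty]}$, then $\dim_K\operatorname{Ext}^1_{L_K(E)}(V_{[d^\infty]},T)=|L_{(d,q)}|$. (2) On the other hand, $\dim_K\operatorname{Ext}^1_{L_K(E)}(V_{[d^\infty]},V_{[d^\infty]})=|L_{(d,d^\infty)}|+1$.
   Context: A directed graph $E=(E^0,E^1,s,r)$ consists of a set $E^0$ of vertices, a set $E^1$ of edges, and maps $s,r:E^1\to E^0$ (source and range); $E$ is finite if $E^0$ and $E^1$ are finite. A sink is a vertex $w$ with $s^{-1}(w)=\emptyset$. A path of length $n\ge 1$ is a sequence $\alpha=e_1\cdots e_n$ of edges with $r(e_i)=s(e_{i+1})$; $s(\alpha)=s(e_1)$, $r(\alpha)=r(e_n)$; vertices are the paths of length $0$. A path $c$ of length $\ge1$ is closed if $r(c)=s(c)$; a closed path $c$ is simple if $c\ne\beta^m$ for every closed path $\beta$ and integer $m\ge 2$. The Leavitt path algebra $L_K(E)$ is the $K$-algebra generated by $\{v: v\in E^0\}\cup\{e,e^*: e\in E^1\}$ with relations: (V) $vu=\delta_{v,u}v$ for $v,u\in E^0$; (E1) $s(e)e=er(e)=e$; (E2) $r(e)e^*=e^*s(e)=e^*$ for $e\in E^1$; (CK1) $e^*e'=\delta_{e,e'}r(e)$ for $e,e'\in E^1$; (CK2) $v=\sum_{e\in s^{-1}(v)}ee^*$ for every $v\in E^0$ with $0<|s^{-1}(v)|<\infty$.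 Since $L_K(E)$ is a $K$-algebra, $\operatorname{Ext}^1$ groups are $K$-vector spaces. An infinite path is a sequence $p=e_1e_2e_3\cdots$ of edges with $r(e_i)=s(e_{i+1})$ for all $i$; $s(p)=s(e_1)$, $\tau_{>n}(p)=e_{n+1}e_{n+2}\cdots$. For a closed path $c$, $c^\infty=ccc\cdots$. $E^\infty$ denotes the set of infinite paths. Infinite paths $p,q$ are tail equivalent ($p\sim q$) if $\tau_{>m}(p)=\tau_{>n}(q)$ for some $m,n\ge0$; $[p]$ is the class of $p$. For an infinite path $p$, $V_{[p]}$ is the $K$-vector space with basis $[p]$ and left $L_K(E)$-action determined, for $q=f_1f_2\cdots\in[p]$, $v\in E^0$, $e\in E^1$, by: $v\cdot q=q$ if $v=s(f_1)$ and $0$ otherwise; $e\cdot q=eq$ if $r(e)=s(f_1)$ and $0$ otherwise; $e^*\cdot q=\tau_{>1}(q)$ if $e=f_1$ and $0$ otherwise. For a sink $w$, by convention $w^i=w$ for all $i$, and $w=w^\infty$ is also regarded as an element of $E^\infty$; the elements tail equivalent to $w^\infty$ are the finite paths $\alpha$ (written $\alpha w^\infty=\alpha$) with $r(\alpha)=w$, and $V_{[w^\infty]}$ denotes the left ideal $L_K(E)w$, which has these paths as $K$-basis. A Chen simple module is any $V_{[q]}$ with $q\in E^\infty$ in this extended sense. For $d$ a simple closed path, $p\in E^\infty$ is divisible by $d$ if $p=dp'$ for some $p'\in E^\infty$. For $q\in E^\infty$, $$L_{(d,q)}=\{p\in E^\infty: p\sim q,\ s(p)=s(d),\ p\text{ is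 not divisible by }d\}\subseteq V_{[q]}.$$ This set depends only on $[q]$. *)

theory Defs
  imports
    "HOL-Algebra.QuotRing"
    "HOL-Library.Stream"
    "Graph_Theory.Arc_Walk"
    "Jordan_Normal_Form.VS_Connect"
begin

unbundle cardinal_syntax

section \<open>Left modules over noncommutative rings\<close>

text \<open>
  The library locale \<^locale>\<open>Module.module\<close> requires a commutative ring, so left modules over an
  arbitrary unital ring are axiomatised here, on the same record type. A \<open>K\<close>-algebra is an
  element of the record type \<open>('k, 'a) module\<close> whose ring fields are all meaningful; for plain
  modules the fields \<^const>\<open>monoid.mult\<close> and \<^const>\<open>one\<close> carry no information.
\<close>

locale left_module = R?: ring R + M?: abelian_group M
  for R :: "('a, 'r) ring_scheme" (structure) and M :: "('a, 'm, 'x) module_scheme" (structure) +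
  assumes smult_closed:
      "\<lbrakk>a \<in> carrier R; x \<in> carrier M\<rbrakk> \<Longrightarrow> a \<odot>\<^bsub>M\<^esub> x \<in> carrier M"
    and smult_l_distr:
      "\<lbrakk>a \<in> carrier R; b \<in> carrier R; x \<in> carrier M\<rbrakk> \<Longrightarrow>
        (a \<oplus>\<^bsub>R\<^esub> b) \<odot>\<^bsub>M\<^esub> x = a \<odot>\<^bsub>M\<^esub> x \<oplus>\<^bsub>M\<^esub> b \<odot>\<^bsub>M\<^esub> x"
    and smult_r_distr:
      "\<lbrakk>a \<in> carrier R; x \<in> carrier M; y \<in> carrier M\<rbrakk> \<Longrightarrow>
        a \<odot>\<^bsub>M\<^esub> (x \<oplus>\<^bsub>M\<^esub> y) = a \<odot>\<^bsub>M\<^esub> x \<oplus>\<^bsub>M\<^esub> a \<odot>\<^bsub>M\<^esub> y"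
    and smult_assoc1:
      "\<lbrakk>a \<in> carrier R; b \<in> carrier R; x \<in> carrier M\<rbrakk> \<Longrightarrow>
        (a \<otimes>\<^bsub>R\<^esub> b) \<odot>\<^bsub>M\<^esub> x = a \<odot>\<^bsub>M\<^esub> (b \<odot>\<^bsub>M\<^esub> x)"
    and smult_one:
      "x \<in> carrier M \<Longrightarrow> \<one>\<^bsub>R\<^esub> \<odot>\<^bsub>M\<^esub> x = x"

definition module_hom ::
    "('a, 'r) ring_scheme \<Rightarrow> ('a, 'm) module \<Rightarrow> ('a, 'n) module \<Rightarrow> ('m \<Rightarrow> 'n) set" where
  "module_hom R M N =
     {f \<in> carrier M \<rightarrow>\<^sub>E carrier N.
        (\<forall>x \<in> carrier M. \<forall>y \<in> carrier M. f (x \<oplus>\<^bsub>M\<^esub> y) = f x \<oplus>\<^bsub>N\<^esub> f y) \<and>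
        (\<forall>a \<in> carrier R. \<forall>x \<in> carrier M. f (a \<odot>\<^bsub>M\<^esub> x) = a \<odot>\<^bsub>N\<^esub> f x)}"

definition left_ideal :: "('a, 'r) ring_scheme \<Rightarrow> 'a \<Rightarrow> ('a, 'a) module" where
  "left_ideal R x =
     \<lparr>carrier = (\<lambda>a. a \<otimes>\<^bsub>R\<^esub> x) ` carrier R, mult = undefined, one = undefined,
      zero = \<zero>\<^bsub>R\<^esub>, add = add R, smult = mult R\<rparr>"

text \<open>
  For a \<open>K\<close>-algebra \<open>A\<close>, the \<open>K\<close>-vector space of \<open>A\<close>-linear maps; a scalar \<open>k\<close> acts on an
  \<open>A\<close>-module through the central element \<open>k 1\<^sub>A\<close>.
\<close>

definition Hom_space ::
    "('k, 'a) module \<Rightarrow> ('a, 'm) module \<Rightarrow> ('a, 'n) module \<Rightarrow> ('k, 'm \<Rightarrow> 'n) module" where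
  "Hom_space A M N =
     \<lparr>carrier = module_hom A M N, mult = undefined, one = undefined,
      zero = (\<lambda>x \<in> carrier M. \<zero>\<^bsub>N\<^esub>),
      add = (\<lambda>f g. \<lambda>x \<in> carrier M. f x \<oplus>\<^bsub>N\<^esub> g x),
      smult = (\<lambda>k f. \<lambda>x \<in> carrier M. (k \<odot>\<^bsub>A\<^esub> \<one>\<^bsub>A\<^esub>) \<odot>\<^bsub>N\<^esub> f x)\<rparr>"

text \<open>
  Quotient of a module by a submodule, or of an algebra by a two-sided ideal: the library's
  coset construction, with the induced scalar multiplication added.
\<close>

definition quotient_module :: "('a, 'm) module \<Rightarrow> 'm set \<Rightarrow> ('a, 'm set) module" where
  "quotient_module M N = ring.extend (M Quot N)
     (module.fields (\<lambda>a X. \<Union>x \<in> X. N +>\<^bsub>M\<^esub> (a \<odot>\<^bsub>M\<^esub> x)))"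

definition free_module :: "('a, 'r) ring_scheme \<Rightarrow> 's set \<Rightarrow> ('a, 's \<Rightarrow> 'a) module" where
  "free_module R S =
     \<lparr>carrier = {f \<in> S \<rightarrow>\<^sub>E carrier R. finite {s \<in> S. f s \<noteq> \<zero>\<^bsub>R\<^esub>}},
      mult = undefined, one = undefined,
      zero = (\<lambda>s \<in> S. \<zero>\<^bsub>R\<^esub>),
      add = (\<lambda>f g. \<lambda>s \<in> S. f s \<oplus>\<^bsub>R\<^esub> g s),
      smult = (\<lambda>a f. \<lambda>s \<in> S. a \<otimes>\<^bsub>R\<^esub> f s)\<rparr>"

text \<open>
  \<open>Ext\<^sup>1\<close> is computed from the canonical free presentation
  \<open>0 \<rightarrow> syzygy A M \<rightarrow> free_module A (carrier M) \<rightarrow> M \<rightarrow> 0\<close>, in which the basis element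
  indexed by \<open>m \<in> M\<close> is sent to \<open>m\<close>. As free modules are projective, \<open>Ext\<^sup>1(M, N)\<close> is the
  cokernel of the restriction map \<open>Hom (free_module A (carrier M), N) \<rightarrow> Hom (syzygy A M, N)\<close>.
\<close>

definition augmentation :: "('a, 'r) ring_scheme \<Rightarrow> ('a, 'm) module \<Rightarrow> ('m \<Rightarrow> 'a) \<Rightarrow> 'm" where
  "augmentation R M f = (\<Oplus>\<^bsub>M\<^esub> m \<in> {m \<in> carrier M. f m \<noteq> \<zero>\<^bsub>R\<^esub>}. f m \<odot>\<^bsub>M\<^esub> m)"

definition syzygy :: "('a, 'r) ring_scheme \<Rightarrow> ('a, 'm) module \<Rightarrow> ('a, 'm \<Rightarrow> 'a) module" where
  "syzygy R M = (free_module R (carrier M))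
     \<lparr>carrier := {f \<in> carrier (free_module R (carrier M)). augmentation R M f = \<zero>\<^bsub>M\<^esub>}\<rparr>"

definition Ext1 ::
    "('k, 'a) module \<Rightarrow> ('a, 'm) module \<Rightarrow> ('a, 'n) module \<Rightarrow> ('k, (('m \<Rightarrow> 'a) \<Rightarrow> 'n) set) module" where
  "Ext1 A M N = quotient_module (Hom_space A (syzygy A M) N)
     ((\<lambda>g. restrict g (carrier (syzygy A M))) ` module_hom A (free_module A (carrier M)) N)"

text \<open>
  The dimension as a cardinal: the library's \<^const>\<open>vectorspace.dim\<close> is a natural number and
  only meaningful for finite-dimensional spaces.
\<close>

definition has_dimension :: "('k::field, 'm) module \<Rightarrow> ('c \<times> 'c) set \<Rightarrow> bool" where
  "has_dimension V r \<longleftrightarrow>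
     vectorspace class_ring V \<and> (\<exists>B. vectorspace.basis class_ring V B \<and> |B| =o r)"


section \<open>Leavitt path algebras\<close>

text \<open>
  The free unital \<open>K\<close>-algebra on a set \<open>X\<close>: finitely supported functions on the words over \<open>X\<close>,
  with the product extending concatenation of words.
\<close>

definition free_algebra :: "'k::field itself \<Rightarrow> 'x set \<Rightarrow> ('k, 'x list \<Rightarrow> 'k) module" where
  "free_algebra K X =
     \<lparr>carrier = {f. finite {w. f w \<noteq> 0} \<and> {w. f w \<noteq> 0} \<subseteq> lists X},
      mult = (\<lambda>f g w. \<Sum>i\<le>length w. f (take i w) * g (drop i w)),
      one = (\<lambda>w. of_bool (w = [])),
      zero = (\<lambda>_. 0),
      add = (\<lambda>f g w. f w + g w),
      smult = (\<lambda>k f w. k * f w)\<rparr>"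

definition word_elt :: "'x list \<Rightarrow> 'x list \<Rightarrow> 'k::field" where
  "word_elt u = (\<lambda>w. of_bool (w = u))"

datatype ('v, 'e) lpa_gen = Vertex 'v | Edge 'e | Ghost 'e

definition lpa_gens :: "('v, 'e) pre_digraph \<Rightarrow> ('v, 'e) lpa_gen set" where
  "lpa_gens E = Vertex ` verts E \<union> Edge ` arcs E \<union> Ghost ` arcs E"

text \<open>
  \<open>lpa_rel E a b\<close> stands for the relation \<open>a = b\<close>. The relation \<open>unit\<close> is there because the
  algebra presented by the remaining relations has no identity a priori: for a finite graph the
  sum of all vertices is its identity, and identifying that sum with the empty word makes the
  presentation by a free unital algebra agree with the one by a free nonunital algebra.
\<close>

inductive lpa_rel ::
    "('v, 'e) pre_digraph \<Rightarrow> (('v, 'e) lpa_gen list \<Rightarrow> 'k::field) \<Rightarrow> (('v, 'e) lpa_gen list \<Rightarrow> 'k) \<Rightarrow> bool"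
  for E where
  V: "\<lbrakk>v \<in> verts E; u \<in> verts E\<rbrakk> \<Longrightarrow>
        lpa_rel E (word_elt [Vertex v, Vertex u]) (if v = u then word_elt [Vertex v] else (\<lambda>_. 0))"
| E1_source: "e \<in> arcs E \<Longrightarrow> lpa_rel E (word_elt [Vertex (tail E e), Edge e]) (word_elt [Edge e])"
| E1_range: "e \<in> arcs E \<Longrightarrow> lpa_rel E (word_elt [Edge e, Vertex (head E e)]) (word_elt [Edge e])"
| E2_range: "e \<in> arcs E \<Longrightarrow> lpa_rel E (word_elt [Vertex (head E e), Ghost e]) (word_elt [Ghost e])"
| E2_source: "e \<in> arcs E \<Longrightarrow> lpa_rel E (word_elt [Ghost e, Vertex (tail E e)]) (word_elt [Ghost e])"
| CK1: "\<lbrakk>e \<in> arcs E; e' \<in> arcs E\<rbrakk> \<Longrightarrow>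
        lpa_rel E (word_elt [Ghost e, Edge e']) (if e = e' then word_elt [Vertex (head E e)] else (\<lambda>_. 0))"
| CK2: "\<lbrakk>v \<in> verts E; out_arcs E v \<noteq> {}; finite (out_arcs E v)\<rbrakk> \<Longrightarrow>
        lpa_rel E (word_elt [Vertex v]) (\<lambda>w. \<Sum>e \<in> out_arcs E v. word_elt [Edge e, Ghost e] w)"
| unit: "lpa_rel E (\<lambda>w. \<Sum>v \<in> verts E. word_elt [Vertex v] w) (word_elt [])"

definition lpa_ideal ::
    "'k::field itself \<Rightarrow> ('v, 'e) pre_digraph \<Rightarrow> (('v, 'e) lpa_gen list \<Rightarrow> 'k) set" where
  "lpa_ideal K E =
     Idl\<^bsub>free_algebra K (lpa_gens E)\<^esub> {a \<ominus>\<^bsub>free_algebra K (lpa_gens E)\<^esub> b | a b. lpa_rel E a b}"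

definition lpa ::
    "'k::field itself \<Rightarrow> ('v, 'e) pre_digraph \<Rightarrow> ('k, (('v, 'e) lpa_gen list \<Rightarrow> 'k) set) module" where
  "lpa K E = quotient_module (free_algebra K (lpa_gens E)) (lpa_ideal K E)"


section \<open>Infinite paths, closed paths and tail equivalence\<close>

text \<open>
  \<open>SinkPath \<alpha> w\<close> is the path \<open>\<alpha> w\<^sup>\<infinity>\<close>, i.e. the finite path \<open>\<alpha>\<close> ending at the sink \<open>w\<close>; the sink is
  recorded because \<open>\<alpha>\<close> may be empty.
\<close>

datatype ('v, 'e) bpath = InfPath "'e stream" | SinkPath "'e list" 'v

definition bpaths :: "('v, 'e) pre_digraph \<Rightarrow> ('v, 'e) bpath set" where
  "bpaths E =
     {InfPath p | p. \<forall>n. p !! n \<in> arcs E \<and> head E (p !! n) = tail E (p !! Suc n)} \<union>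
     {SinkPath \<alpha> w | \<alpha> w. out_arcs E w = {} \<and> (\<exists>u. pre_digraph.awalk E u \<alpha> w)}"

fun bsource :: "('v, 'e) pre_digraph \<Rightarrow> ('v, 'e) bpath \<Rightarrow> 'v" where
  "bsource E (InfPath p) = tail E (shd p)"
| "bsource E (SinkPath [] w) = w"
| "bsource E (SinkPath (e # \<alpha>) w) = tail E e"

fun bappend :: "'e list \<Rightarrow> ('v, 'e) bpath \<Rightarrow> ('v, 'e) bpath" where
  "bappend \<beta> (InfPath p) = InfPath (\<beta> @- p)"
| "bappend \<beta> (SinkPath \<alpha> w) = SinkPath (\<beta> @ \<alpha>) w"

fun btail :: "('v, 'e) bpath \<Rightarrow> ('v, 'e) bpath" where
  "btail (InfPath p) = InfPath (stl p)"
| "btail (SinkPath \<alpha> w) = SinkPath (tl \<alpha>) w"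

definition tail_equiv :: "('v, 'e) bpath \<Rightarrow> ('v, 'e) bpath \<Rightarrow> bool" where
  "tail_equiv p q \<longleftrightarrow> (\<exists>m n. (btail ^^ m) p = (btail ^^ n) q)"

definition tail_class :: "('v, 'e) pre_digraph \<Rightarrow> ('v, 'e) bpath \<Rightarrow> ('v, 'e) bpath set" where
  "tail_class E q = {p \<in> bpaths E. tail_equiv p q}"

definition simple_closed_path :: "('v, 'e) pre_digraph \<Rightarrow> 'e list \<Rightarrow> bool" where
  "simple_closed_path E c \<longleftrightarrow> wf_digraph.closed_w E c \<and>
     \<not> (\<exists>\<beta> m. wf_digraph.closed_w E \<beta> \<and> m \<ge> 2 \<and> c = concat (replicate m \<beta>))"

definition divisible :: "('v, 'e) pre_digraph \<Rightarrow> 'e list \<Rightarrow> ('v, 'e) bpath \<Rightarrow> bool" where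
  "divisible E d p \<longleftrightarrow> (\<exists>p' \<in> bpaths E. p = bappend d p')"

definition nondivisible_paths ::
    "('v, 'e) pre_digraph \<Rightarrow> 'e list \<Rightarrow> ('v, 'e) bpath \<Rightarrow> ('v, 'e) bpath set" where
  "nondivisible_paths E d q =
     {p \<in> bpaths E. tail_equiv p q \<and> bsource E p = tail E (hd d) \<and> \<not> divisible E d p}"


section \<open>Chen modules\<close>

text \<open>The action of a generator maps a basis path to a basis path or, for \<^const>\<open>None\<close>, to zero.\<close>

fun gen_act :: "('v, 'e) pre_digraph \<Rightarrow> ('v, 'e) lpa_gen \<Rightarrow> ('v, 'e) bpath \<Rightarrow> ('v, 'e) bpath option" where
  "gen_act E (Vertex v) p = (if v = bsource E p then Some p else None)"
| "gen_act E (Edge e) p = (if head E e = bsource E p then Some (bappend [e] p) else None)"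
| "gen_act E (Ghost e) p = (if p = bappend [e] (btail p) then Some (btail p) else None)"

definition word_act ::
    "('v, 'e) pre_digraph \<Rightarrow> ('v, 'e) lpa_gen list \<Rightarrow> ('v, 'e) bpath \<Rightarrow> ('v, 'e) bpath option" where
  "word_act E w p = foldr (\<lambda>g r. Option.bind r (gen_act E g)) w (Some p)"

definition free_act ::
    "('v, 'e) pre_digraph \<Rightarrow> (('v, 'e) lpa_gen list \<Rightarrow> 'k::field) \<Rightarrow>
      (('v, 'e) bpath \<Rightarrow> 'k) \<Rightarrow> ('v, 'e) bpath \<Rightarrow> 'k" where
  "free_act E a f = (\<lambda>p'. \<Sum>w | a w \<noteq> 0. \<Sum>p | f p \<noteq> 0.
     if word_act E w p = Some p' then a w * f p else 0)"

text \<open>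
  \<open>V\<^bsub>[q]\<^esub>\<close> consists of the finitely supported functions on the class \<open>[q]\<close>. An element of the
  Leavitt path algebra is a coset and acts through any of its representatives; independence of
  the choice is \<open>chen_smult\<close> below. For a sink \<open>w\<close> this is the left ideal \<open>L\<^sub>K(E) w\<close>, written
  in the basis of paths ending at \<open>w\<close>, see \<open>chen_module_sink\<close> below.
\<close>

definition chen_module ::
    "'k::field itself \<Rightarrow> ('v, 'e) pre_digraph \<Rightarrow> ('v, 'e) bpath \<Rightarrow>
      ((('v, 'e) lpa_gen list \<Rightarrow> 'k) set, ('v, 'e) bpath \<Rightarrow> 'k) module" where
  "chen_module K E q =
     \<lparr>carrier = {f. finite {p. f p \<noteq> 0} \<and> {p. f p \<noteq> 0} \<subseteq> tail_class E q},
      mult = undefined, one = undefined,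
      zero = (\<lambda>_. 0),
      add = (\<lambda>f g p. f p + g p),
      smult = (\<lambda>X f. free_act E (SOME a. a \<in> X) f)\<rparr>"


section \<open>Well-definedness of the Chen modules\<close>

lemma free_algebra_simps [simp]:
  "carrier (free_algebra K X) = {f. finite {w. f w \<noteq> 0} \<and> {w. f w \<noteq> 0} \<subseteq> lists X}"
  "f \<otimes>\<^bsub>free_algebra K X\<^esub> g = (\<lambda>w. \<Sum>i\<le>length w. f (take i w) * g (drop i w))"
  "\<one>\<^bsub>free_algebra K X\<^esub> = word_elt []"
  "\<zero>\<^bsub>free_algebra K X\<^esub> = (\<lambda>_. 0)"
  "f \<oplus>\<^bsub>free_algebra K X\<^esub> g = (\<lambda>w. f w + g w)"
  "k \<odot>\<^bsub>free_algebra K X\<^esub> f = (\<lambda>w. k * f w)"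
  by (simp_all add: free_algebra_def word_elt_def)

lemma conv_sum:
  fixes f g :: "'x list \<Rightarrow> 'k::field"
  assumes "finite A" "finite B" "{u. f u \<noteq> 0} \<subseteq> A" "{v. g v \<noteq> 0} \<subseteq> B"
  shows "(\<Sum>i\<le>length w. f (take i w) * g (drop i w)) =
         (\<Sum>u\<in>A. \<Sum>v\<in>B. if u @ v = w then f u * g v else 0)"
proof -
  define S where "S = (\<lambda>i. (take i w, drop i w)) ` {..length w}"
  have S: "S = {(u, v). u @ v = w}"
  proof (rule equalityI; rule subsetI)
    fix x assume "x \<in> {(u, v). u @ v = w}"
    then obtain u v where x: "x = (u, v)" "w = u @ v" by auto
    show "x \<in> S" unfolding S_def
      by (rule image_eqI[of _ _ "length u"]) (simp_all add: x)
  qed (auto simp: S_def)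
  have inj: "inj_on (\<lambda>i. (take i w, drop i w)) {..length w}"
    by (rule inj_onI) (metis Pair_inject atMost_iff length_take min.absorb2)
  have "(\<Sum>i\<le>length w. f (take i w) * g (drop i w)) = (\<Sum>(u, v)\<in>S. f u * g v)"
    unfolding S_def by (subst sum.reindex[OF inj]) simp
  also have "\<dots> = (\<Sum>(u, v)\<in>S \<inter> A \<times> B. f u * g v)"
    using assms by (intro sum.mono_neutral_right) (auto simp: S_def)
  also have "\<dots> = (\<Sum>(u, v)\<in>A \<times> B. if u @ v = w then f u * g v else 0)"
    using assms by (intro sum.mono_neutral_cong_left) (auto simp: S split: if_splits)
  also have "\<dots> = (\<Sum>u\<in>A. \<Sum>v\<in>B. if u @ v = w then f u * g v else 0)"
    by (simp add: sum.cartesian_product)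
  finally show ?thesis .
qed

lemma conv_support:
  fixes f g :: "'x list \<Rightarrow> 'k::field"
  shows "{w. (\<Sum>i\<le>length w. f (take i w) * g (drop i w)) \<noteq> 0}
    \<subseteq> (\<lambda>(u, v). u @ v) ` ({u. f u \<noteq> 0} \<times> {v. g v \<noteq> 0})"
proof
  fix w
  assume "w \<in> {w. (\<Sum>i\<le>length w. f (take i w) * g (drop i w)) \<noteq> 0}"
  then have "(\<Sum>i\<le>length w. f (take i w) * g (drop i w)) \<noteq> 0" by simp
  then obtain i where i: "f (take i w) * g (drop i w) \<noteq> 0"
    by (rule sum.not_neutral_contains_not_neutral) blast
  show "w \<in> (\<lambda>(u, v). u @ v) ` ({u. f u \<noteq> 0} \<times> {v. g v \<noteq> 0})"
    by (rule image_eqI[of _ _ "(take i w, drop i w)"]) (use i in simp_all)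
qed

lemma conv_sum_against:
  fixes f g h :: "'x list \<Rightarrow> 'k::field"
  assumes "finite A" "finite B" "{u. f u \<noteq> 0} \<subseteq> A" "{v. g v \<noteq> 0} \<subseteq> B"
    and "finite C" "(\<lambda>(u, v). u @ v) ` (A \<times> B) \<subseteq> C"
  shows "(\<Sum>w\<in>C. (\<Sum>i\<le>length w. f (take i w) * g (drop i w)) * h w) =
         (\<Sum>u\<in>A. \<Sum>v\<in>B. f u * g v * h (u @ v))"
proof -
  have "(\<Sum>w\<in>C. (\<Sum>i\<le>length w. f (take i w) * g (drop i w)) * h w) =
        (\<Sum>w\<in>C. \<Sum>u\<in>A. \<Sum>v\<in>B. if u @ v = w then f u * g v * h w else 0)"
    unfolding conv_sum[OF assms(1-4)] by (simp add: sum_distrib_right if_distrib[of "\<lambda>x. x * _"] cong: if_cong)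
  also have "\<dots> = (\<Sum>u\<in>A. \<Sum>v\<in>B. \<Sum>w\<in>C. if u @ v = w then f u * g v * h w else 0)"
    by (subst sum.swap, rule sum.cong[OF refl], subst sum.swap, rule refl)
  also have "\<dots> = (\<Sum>u\<in>A. \<Sum>v\<in>B. f u * g v * h (u @ v))"
    using assms(5,6) by (intro sum.cong refl) (auto simp: sum.delta')
  finally show ?thesis .
qed

lemma free_algebra_closedI:
  assumes "finite S" "{w. f w \<noteq> 0} \<subseteq> S" "S \<subseteq> lists X"
  shows "f \<in> carrier (free_algebra K X)"
  unfolding free_algebra_simps mem_Collect_eq
  by (rule conjI, rule finite_subset[OF assms(2,1)], rule order.trans[OF assms(2,3)])

lemma free_algebra_closedD:
  assumes "f \<in> carrier (free_algebra K X)"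
  shows "finite {w. f w \<noteq> 0}" "{w. f w \<noteq> 0} \<subseteq> lists X"
  using assms unfolding free_algebra_simps mem_Collect_eq by (rule conjunct1, rule conjunct2)

lemma append_lists: "S \<subseteq> lists X \<Longrightarrow> T \<subseteq> lists X \<Longrightarrow> (\<lambda>(u, v). u @ v) ` (S \<times> T) \<subseteq> lists X"
  by (rule image_subsetI) (auto simp: lists_eq_set subset_iff)

lemma free_algebra_mult_closed:
  assumes "f \<in> carrier (free_algebra K X)" "g \<in> carrier (free_algebra K X)"
  shows "f \<otimes>\<^bsub>free_algebra K X\<^esub> g \<in> carrier (free_algebra K X)"
  unfolding free_algebra_simps(2)
  by (rule free_algebra_closedI[OF _ conv_support])
    (intro finite_imageI finite_cartesian_product append_lists free_algebra_closedD[OF assms(1)]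
      free_algebra_closedD[OF assms(2)])+

lemma free_algebra_add_closed:
  assumes "f \<in> carrier (free_algebra K X)" "g \<in> carrier (free_algebra K X)"
  shows "f \<oplus>\<^bsub>free_algebra K X\<^esub> g \<in> carrier (free_algebra K X)"
proof (rule free_algebra_closedI)
  show "finite ({w. f w \<noteq> 0} \<union> {w. g w \<noteq> 0})"
    by (intro finite_UnI free_algebra_closedD[OF assms(1)] free_algebra_closedD[OF assms(2)])
  show "{w. f w \<noteq> 0} \<union> {w. g w \<noteq> 0} \<subseteq> lists X"
    by (intro Un_least free_algebra_closedD[OF assms(1)] free_algebra_closedD[OF assms(2)])
qed auto

lemma free_algebra_assoc:
  assumes f: "f \<in> carrier (free_algebra K X)" and g: "g \<in> carrier (free_algebra K X)"
    and h: "h \<in> carrier (free_algebra K X)"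
  shows "(f \<otimes>\<^bsub>free_algebra K X\<^esub> g) \<otimes>\<^bsub>free_algebra K X\<^esub> h =
    f \<otimes>\<^bsub>free_algebra K X\<^esub> (g \<otimes>\<^bsub>free_algebra K X\<^esub> h)"
proof
  fix x
  let ?F = "{u. f u \<noteq> 0}" and ?G = "{u. g u \<noteq> 0}" and ?H = "{u. h u \<noteq> 0}"
  have fin: "finite ?F" "finite ?G" "finite ?H" using f g h by auto
  let ?fg = "\<lambda>w. \<Sum>i\<le>length w. f (take i w) * g (drop i w)"
  let ?gh = "\<lambda>w. \<Sum>i\<le>length w. g (take i w) * h (drop i w)"
  let ?A = "(\<lambda>(u, v). u @ v) ` (?F \<times> ?G)" and ?B = "(\<lambda>(u, v). u @ v) ` (?G \<times> ?H)"
  have "((f \<otimes>\<^bsub>free_algebra K X\<^esub> g) \<otimes>\<^bsub>free_algebra K X\<^esub> h) x =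
      (\<Sum>w\<in>?A. \<Sum>z\<in>?H. if w @ z = x then ?fg w * h z else 0)"
    using fin conv_support[of f g]
    by (simp only: free_algebra_simps) (rule conv_sum, auto)
  also have "\<dots> = (\<Sum>w\<in>?A. ?fg w * (\<Sum>z\<in>?H. if w @ z = x then h z else 0))"
    by (simp add: sum_distrib_left if_distrib cong: if_cong)
  also have "\<dots> = (\<Sum>u\<in>?F. \<Sum>v\<in>?G. f u * g v * (\<Sum>z\<in>?H. if (u @ v) @ z = x then h z else 0))"
    using fin by (intro conv_sum_against) auto
  also have "\<dots> = (\<Sum>u\<in>?F. f u * (\<Sum>v\<in>?G. \<Sum>z\<in>?H. g v * h z * of_bool (u @ v @ z = x)))"
    by (simp add: sum_distrib_left mult.assoc if_distrib of_bool_def cong: if_cong)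
  also have "\<dots> = (\<Sum>u\<in>?F. f u * (\<Sum>w\<in>?B. ?gh w * of_bool (u @ w = x)))"
    using fin by (subst conv_sum_against[where A = ?G and B = ?H and C = ?B]) auto
  also have "\<dots> = (\<Sum>u\<in>?F. \<Sum>w\<in>?B. if u @ w = x then f u * ?gh w else 0)"
    by (simp add: sum_distrib_left if_distrib of_bool_def cong: if_cong)
  also have "\<dots> = (f \<otimes>\<^bsub>free_algebra K X\<^esub> (g \<otimes>\<^bsub>free_algebra K X\<^esub> h)) x"
    using fin conv_support[of g h]
    by (simp only: free_algebra_simps) (rule conv_sum[symmetric], auto)
  finally show "((f \<otimes>\<^bsub>free_algebra K X\<^esub> g) \<otimes>\<^bsub>free_algebra K X\<^esub> h) x =
    (f \<otimes>\<^bsub>free_algebra K X\<^esub> (g \<otimes>\<^bsub>free_algebra K X\<^esub> h)) x" .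
qed

lemma word_elt_closed: "w \<in> lists X \<Longrightarrow> word_elt w \<in> carrier (free_algebra K X)"
  by (auto simp: word_elt_def)

lemma free_algebra_one:
  assumes "f \<in> carrier (free_algebra K X)"
  shows "word_elt [] \<otimes>\<^bsub>free_algebra K X\<^esub> f = f" "f \<otimes>\<^bsub>free_algebra K X\<^esub> word_elt [] = f"
proof -
  have "(\<Sum>i\<le>length w. word_elt [] (take i w) * f (drop i w)) = f w" for w
  proof -
    have "(\<Sum>i\<le>length w. word_elt [] (take i w) * f (drop i w)) =
        (\<Sum>i\<le>length w. if i = 0 then f w else 0)"
      by (rule sum.cong) (auto simp: word_elt_def)
    then show ?thesis by simp
  qed
  then show "word_elt [] \<otimes>\<^bsub>free_algebra K X\<^esub> f = f" by simp
  have "(\<Sum>i\<le>length w. f (take i w) * word_elt [] (drop i w)) = f w" for w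
  proof -
    have "(\<Sum>i\<le>length w. f (take i w) * word_elt [] (drop i w)) =
        (\<Sum>i\<le>length w. if i = length w then f w else 0)"
      by (rule sum.cong) (auto simp: word_elt_def)
    then show ?thesis by simp
  qed
  then show "f \<otimes>\<^bsub>free_algebra K X\<^esub> word_elt [] = f" by simp
qed

lemma ring_free_algebra: "ring (free_algebra K X)" (is "ring ?F")
proof (rule ringI)
  show "abelian_group ?F"
  proof (rule abelian_groupI)
    fix f assume f: "f \<in> carrier ?F"
    then show "\<exists>g \<in> carrier ?F. g \<oplus>\<^bsub>?F\<^esub> f = \<zero>\<^bsub>?F\<^esub>"
      by (intro bexI[of _ "\<lambda>w. - f w"]) auto
  next
    fix f g assume "f \<in> carrier ?F" "g \<in> carrier ?F"
    then show "f \<oplus>\<^bsub>?F\<^esub> g \<in> carrier ?F" by (rule free_algebra_add_closed)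
  qed (auto simp: algebra_simps)
  show "Group.monoid ?F"
    using free_algebra_mult_closed free_algebra_assoc free_algebra_one
      word_elt_closed[of "[]" X]
    by (intro monoidI) (auto simp del: free_algebra_simps(1,2,4-6))
qed (auto simp: algebra_simps sum.distrib)

lemma word_elt_mult:
  fixes K :: "'k::field itself"
  shows "word_elt u \<otimes>\<^bsub>free_algebra K X\<^esub> word_elt v = word_elt (u @ v)"
proof -
  have "(\<Sum>i\<le>length w. word_elt u (take i w) * word_elt v (drop i w)) = (word_elt (u @ v) w :: 'k)" for w
    by (subst conv_sum[where A = "{u}" and B = "{v}"]) (auto simp: word_elt_def)
  then show ?thesis by (simp add: fun_eq_iff)
qed

lemma quotient_module_simps:
  "carrier (quotient_module M N) = a_rcosets\<^bsub>M\<^esub> N"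
  "X \<otimes>\<^bsub>quotient_module M N\<^esub> Y = rcoset_mult M N X Y"
  "\<one>\<^bsub>quotient_module M N\<^esub> = N +>\<^bsub>M\<^esub> \<one>\<^bsub>M\<^esub>"
  "\<zero>\<^bsub>quotient_module M N\<^esub> = N"
  "X \<oplus>\<^bsub>quotient_module M N\<^esub> Y = X <+>\<^bsub>M\<^esub> Y"
  "a \<odot>\<^bsub>quotient_module M N\<^esub> X = (\<Union>x \<in> X. N +>\<^bsub>M\<^esub> (a \<odot>\<^bsub>M\<^esub> x))"
  by (simp_all add: quotient_module_def FactRing_def ring.defs module.defs)

lemma ring_quotient_module: "ring (quotient_module M N) \<longleftrightarrow> ring (M Quot N)"
  by (simp add: ring_def abelian_group_def abelian_monoid_def abelian_group_axioms_def
      ring_axioms_def Group.monoid_def Group.comm_monoid_def comm_monoid_axioms_def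
      comm_group_def group_def group_axioms_def Units_def quotient_module_simps FactRing_def)

lemma word_act_Nil [simp]: "word_act E [] p = Some p"
  by (simp add: word_act_def)

lemma word_act_Cons [simp]: "word_act E (g # w) p = Option.bind (word_act E w p) (gen_act E g)"
  by (simp add: word_act_def)

lemma word_act_append: "word_act E (u @ v) p = Option.bind (word_act E v p) (word_act E u)"
proof (induction u)
  case Nil
  show ?case by (cases "word_act E v p") auto
next
  case (Cons g u)
  then show ?case by (cases "word_act E v p") auto
qed

text \<open>The coefficient of \<open>p'\<close> in \<open>a \<cdot> p\<close>.\<close>

definition basis_act :: "('v, 'e) pre_digraph \<Rightarrow> (('v, 'e) lpa_gen list \<Rightarrow> 'k::field) \<Rightarrow>
    ('v, 'e) bpath \<Rightarrow> ('v, 'e) bpath \<Rightarrow> 'k" where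
  "basis_act E a p p' = (\<Sum>w | a w \<noteq> 0. a w * of_bool (word_act E w p = Some p'))"

lemma basis_act_superset:
  assumes "finite W" "{w. a w \<noteq> 0} \<subseteq> W"
  shows "basis_act E a p p' = (\<Sum>w\<in>W. a w * of_bool (word_act E w p = Some p'))"
  unfolding basis_act_def using assms by (intro sum.mono_neutral_left) auto

lemma basis_act_word_elt: "basis_act E (word_elt w) p p' = of_bool (word_act E w p = Some p')"
  by (subst basis_act_superset[where W = "{w}"]) (auto simp: word_elt_def)

lemma basis_act_zero: "basis_act E (\<lambda>_. 0) p p' = 0"
  by (simp add: basis_act_def)

lemma basis_act_add:
  assumes "finite {w. a w \<noteq> 0}" "finite {w. b w \<noteq> 0}"
  shows "basis_act E (\<lambda>w. a w + b w) p p' = basis_act E a p p' + basis_act E b p p'"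
proof -
  let ?W = "{w. a w \<noteq> 0} \<union> {w. b w \<noteq> 0}"
  have "basis_act E (\<lambda>w. a w + b w) p p' = (\<Sum>w\<in>?W. (a w + b w) * of_bool (word_act E w p = Some p'))"
    using assms by (intro basis_act_superset) auto
  moreover have "basis_act E a p p' = (\<Sum>w\<in>?W. a w * of_bool (word_act E w p = Some p'))"
    using assms by (intro basis_act_superset) auto
  moreover have "basis_act E b p p' = (\<Sum>w\<in>?W. b w * of_bool (word_act E w p = Some p'))"
    using assms by (intro basis_act_superset) auto
  ultimately show ?thesis by (simp add: distrib_right sum.distrib)
qed

lemma basis_act_sum_words:
  fixes E :: "('v, 'e) pre_digraph"
  defines "B \<equiv> basis_act E :: (('v, 'e) lpa_gen list \<Rightarrow> 'k::field) \<Rightarrow> _"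
  assumes "finite S" "inj_on g S"
  shows "B (\<lambda>w. \<Sum>s\<in>S. word_elt (g s) w) p p' =
    (\<Sum>s\<in>S. of_bool (word_act E (g s) p = Some p'))"
proof -
  have "B (\<lambda>w. \<Sum>s\<in>S. word_elt (g s) w) p p' =
      (\<Sum>w\<in>g ` S. (\<Sum>s\<in>S. word_elt (g s) w) * of_bool (word_act E w p = Some p'))"
  unfolding B_def
  proof (intro basis_act_superset)
    show "{w. (\<Sum>s\<in>S. word_elt (g s) w :: 'k) \<noteq> 0} \<subseteq> g ` S"
    proof
      fix w assume "w \<in> {w. (\<Sum>s\<in>S. word_elt (g s) w :: 'k) \<noteq> 0}"
      then obtain s where "s \<in> S" "word_elt (g s) w \<noteq> (0 :: 'k)"
        by (metis (mono_tags, lifting) mem_Collect_eq sum.neutral)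
      then show "w \<in> g ` S" by (auto simp: word_elt_def)
    qed
  qed (use assms in auto)
  also have "\<dots> = (\<Sum>t\<in>S. (\<Sum>s\<in>S. word_elt (g s) (g t)) * of_bool (word_act E (g t) p = Some p'))"
    using assms by (subst sum.reindex) auto
  also have "\<dots> = (\<Sum>t\<in>S. of_bool (word_act E (g t) p = Some p'))"
  proof (intro sum.cong refl)
    fix t assume t: "t \<in> S"
    have "(\<Sum>s\<in>S. word_elt (g s) (g t)) = (\<Sum>s\<in>S. if t = s then 1 else (0 :: 'k))"
      using assms t by (intro sum.cong refl) (auto simp: word_elt_def inj_on_eq_iff)
    then show "(\<Sum>s\<in>S. word_elt (g s) (g t)) * of_bool (word_act E (g t) p = Some p') =
        (of_bool (word_act E (g t) p = Some p') :: 'k)"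
      using t assms(2) by simp
  qed
  finally show ?thesis .
qed

lemma free_act_superset:
  assumes "finite P" "{p. f p \<noteq> 0} \<subseteq> P"
  shows "free_act E a f p' = (\<Sum>p\<in>P. f p * basis_act E a p p')"
proof -
  have "free_act E a f p' =
      (\<Sum>p | f p \<noteq> 0. \<Sum>w | a w \<noteq> 0. if word_act E w p = Some p' then a w * f p else 0)"
    unfolding free_act_def by (rule sum.swap)
  also have "\<dots> = (\<Sum>p | f p \<noteq> 0. f p * basis_act E a p p')"
    unfolding basis_act_def by (intro sum.cong refl) (auto simp: sum_distrib_left intro!: sum.cong)
  also have "\<dots> = (\<Sum>p\<in>P. f p * basis_act E a p p')"
    using assms by (intro sum.mono_neutral_left) auto
  finally show ?thesis .
qed

lemma free_act_cong:
  assumes "finite {p. f p \<noteq> 0}"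
    and "\<And>p p'. f p \<noteq> 0 \<Longrightarrow> basis_act E a p p' = basis_act E b p p'"
  shows "free_act E a f = free_act E b f"
  using assms by (auto simp: fun_eq_iff free_act_superset[OF assms(1) order.refl] intro!: sum.cong)

lemma free_act_zero_left: "free_act E (\<lambda>_. 0) f = (\<lambda>_. 0)"
  by (simp add: free_act_def)

lemma free_act_add_left:
  assumes "finite {w. a w \<noteq> 0}" "finite {w. b w \<noteq> 0}" "finite {p. f p \<noteq> 0}"
  shows "free_act E (\<lambda>w. a w + b w) f = (\<lambda>p. free_act E a f p + free_act E b f p)"
  by (simp add: fun_eq_iff free_act_superset[OF assms(3) order.refl] basis_act_add[OF assms(1,2)]
      distrib_left sum.distrib)

lemma free_act_add_right:
  assumes "finite {p. f p \<noteq> 0}" "finite {p. g p \<noteq> 0}"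
  shows "free_act E a (\<lambda>p. f p + g p) = (\<lambda>p. free_act E a f p + free_act E a g p)"
proof
  fix p'
  let ?P = "{p. f p \<noteq> 0} \<union> {p. g p \<noteq> 0}"
  have "finite ?P" using assms by simp
  then have "free_act E a (\<lambda>p. f p + g p) p' = (\<Sum>p\<in>?P. (f p + g p) * basis_act E a p p')"
    "free_act E a f p' = (\<Sum>p\<in>?P. f p * basis_act E a p p')"
    "free_act E a g p' = (\<Sum>p\<in>?P. g p * basis_act E a p p')"
    by (auto intro!: free_act_superset)
  then show "free_act E a (\<lambda>p. f p + g p) p' = free_act E a f p' + free_act E a g p'"
    by (simp add: distrib_right sum.distrib)
qed

lemma free_act_one: 
  assumes "finite {p. f p \<noteq> 0}"
  shows "free_act E (word_elt []) f = f"
proof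
  fix p'
  have "free_act E (word_elt []) f p' = (\<Sum>p | f p \<noteq> 0. if p = p' then f p else 0)"
    by (auto simp: free_act_superset[OF assms order.refl] basis_act_word_elt intro!: sum.cong)
  then show "free_act E (word_elt []) f p' = f p'"
    using assms by (simp add: sum.delta')
qed

lemma free_act_support:
  "{p'. free_act E a f p' \<noteq> 0} \<subseteq>
     (\<lambda>(w, p). the (word_act E w p)) ` {(w, p). a w \<noteq> 0 \<and> f p \<noteq> 0 \<and> word_act E w p \<noteq> None}"
proof
  fix p' assume "p' \<in> {p'. free_act E a f p' \<noteq> 0}"
  then have "(\<Sum>w | a w \<noteq> 0. \<Sum>p | f p \<noteq> 0. if word_act E w p = Some p' then a w * f p else 0) \<noteq> 0"
    by (simp add: free_act_def)
  then obtain w where w: "a w \<noteq> 0"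
    "(\<Sum>p | f p \<noteq> 0. if word_act E w p = Some p' then a w * f p else 0) \<noteq> 0"
    by (rule sum.not_neutral_contains_not_neutral) blast
  from w(2) obtain p where "f p \<noteq> 0" "(if word_act E w p = Some p' then a w * f p else 0) \<noteq> 0"
    by (rule sum.not_neutral_contains_not_neutral) blast
  with w(1) show "p' \<in> (\<lambda>(w, p). the (word_act E w p)) `
      {(w, p). a w \<noteq> 0 \<and> f p \<noteq> 0 \<and> word_act E w p \<noteq> None}"
    by (intro image_eqI[of _ _ "(w, p)"]) (auto split: if_splits)
qed

lemma free_act_finite_support:
  assumes "finite {w. a w \<noteq> 0}" "finite {p. f p \<noteq> 0}"
  shows "finite {p'. free_act E a f p' \<noteq> 0}"
proof (rule finite_subset[OF free_act_support finite_imageI])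
  show "finite {(w, p). a w \<noteq> 0 \<and> f p \<noteq> 0 \<and> word_act E w p \<noteq> None}"
    by (rule finite_subset[OF _ finite_cartesian_product[OF assms]]) auto
qed

lemma basis_act_mult:
  fixes a b :: "('v, 'e) lpa_gen list \<Rightarrow> 'k::field"
  assumes "finite {w. a w \<noteq> 0}" "finite {w. b w \<noteq> 0}" "finite R"
    and R: "\<And>v r. b v \<noteq> 0 \<Longrightarrow> word_act E v p = Some r \<Longrightarrow> r \<in> R"
  shows "basis_act E (\<lambda>w. \<Sum>i\<le>length w. a (take i w) * b (drop i w)) p p' =
    (\<Sum>r\<in>R. basis_act E b p r * basis_act E a r p')"
proof -
  let ?A = "{w. a w \<noteq> 0}" and ?B = "{w. b w \<noteq> 0}"
  let ?C = "(\<lambda>(u, v). u @ v) ` (?A \<times> ?B)"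
  have bind: "of_bool (Option.bind (word_act E v p) (word_act E u) = Some p') =
      (\<Sum>r\<in>R. of_bool (word_act E v p = Some r) * of_bool (word_act E u r = Some p') :: 'k)"
    if "b v \<noteq> 0" for u v
  proof (cases "word_act E v p")
    case (Some r)
    then have "r \<in> R" using that R by blast
    have "(\<Sum>r'\<in>R. of_bool (word_act E v p = Some r') * of_bool (word_act E u r' = Some p')) =
        (\<Sum>r'\<in>R. if r = r' then of_bool (word_act E u r = Some p') else 0 :: 'k)"
      using Some by (intro sum.cong) auto
    then show ?thesis using Some \<open>r \<in> R\<close> \<open>finite R\<close> by (simp add: sum.delta)
  qed auto
  have "basis_act E (\<lambda>w. \<Sum>i\<le>length w. a (take i w) * b (drop i w)) p p' =
      (\<Sum>w\<in>?C. (\<Sum>i\<le>length w. a (take i w) * b (drop i w)) * of_bool (word_act E w p = Some p'))"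
    using assms conv_support[of a b] by (intro basis_act_superset) auto
  also have "\<dots> = (\<Sum>u\<in>?A. \<Sum>v\<in>?B. a u * b v * of_bool (word_act E (u @ v) p = Some p'))"
    using assms by (intro conv_sum_against) auto
  also have "\<dots> = (\<Sum>u\<in>?A. \<Sum>v\<in>?B. \<Sum>r\<in>R. (b v * of_bool (word_act E v p = Some r)) *
      (a u * of_bool (word_act E u r = Some p')))"
    by (intro sum.cong refl) (simp add: word_act_append bind sum_distrib_left mult_ac)
  also have "\<dots> = (\<Sum>r\<in>R. \<Sum>v\<in>?B. \<Sum>u\<in>?A. (b v * of_bool (word_act E v p = Some r)) *
      (a u * of_bool (word_act E u r = Some p')))"
    by (subst sum.swap, subst (2) sum.swap, subst sum.swap) (rule refl)
  also have "\<dots> = (\<Sum>r\<in>R. basis_act E b p r * basis_act E a r p')"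
    by (simp add: basis_act_def sum_product)
  finally show ?thesis .
qed

lemma free_act_mult:
  assumes a: "finite {w. a w \<noteq> 0}" and b: "finite {w. b w \<noteq> 0}" and f: "finite {p. f p \<noteq> 0}"
  shows "free_act E (\<lambda>w. \<Sum>i\<le>length w. a (take i w) * b (drop i w)) f = free_act E a (free_act E b f)"
proof
  fix p'
  let ?R = "(\<lambda>(w, p). the (word_act E w p)) ` ({w. b w \<noteq> 0} \<times> {p. f p \<noteq> 0})"
  have R: "finite ?R" by (intro finite_imageI finite_cartesian_product b f)
  have "{r. free_act E b f r \<noteq> 0} \<subseteq> ?R"
    by (rule order.trans[OF free_act_support image_mono]) auto
  then have "free_act E a (free_act E b f) p' = (\<Sum>r\<in>?R. free_act E b f r * basis_act E a r p')"
    using R by (intro free_act_superset)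
  also have "\<dots> = (\<Sum>r\<in>?R. \<Sum>p | f p \<noteq> 0. f p * (basis_act E b p r * basis_act E a r p'))"
    by (simp add: free_act_superset[OF f order.refl] sum_distrib_right mult.assoc)
  also have "\<dots> = (\<Sum>p | f p \<noteq> 0. f p * (\<Sum>r\<in>?R. basis_act E b p r * basis_act E a r p'))"
    by (subst sum.swap) (simp add: sum_distrib_left)
  also have "\<dots> = (\<Sum>p | f p \<noteq> 0.
      f p * basis_act E (\<lambda>w. \<Sum>i\<le>length w. a (take i w) * b (drop i w)) p p')"
  proof (intro sum.cong refl arg_cong2[where f = "(*)"])
    fix p assume p: "p \<in> {p. f p \<noteq> 0}"
    show "(\<Sum>r\<in>?R. basis_act E b p r * basis_act E a r p') =
        basis_act E (\<lambda>w. \<Sum>i\<le>length w. a (take i w) * b (drop i w)) p p'"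
    proof (rule basis_act_mult[OF a b R, symmetric])
      fix v r assume "b v \<noteq> 0" "word_act E v p = Some r"
      then show "r \<in> ?R" using p by (intro image_eqI[of _ _ "(v, p)"]) auto
    qed
  qed
  also have "\<dots> = free_act E (\<lambda>w. \<Sum>i\<le>length w. a (take i w) * b (drop i w)) f p'"
    by (simp add: free_act_superset[OF f order.refl])
  finally show "free_act E (\<lambda>w. \<Sum>i\<le>length w. a (take i w) * b (drop i w)) f p' =
    free_act E a (free_act E b f) p'" ..
qed

lemma lpa_gens_iff:
  "Vertex v \<in> lpa_gens E \<longleftrightarrow> v \<in> verts E" "Edge e \<in> lpa_gens E \<longleftrightarrow> e \<in> arcs E"
  "Ghost e \<in> lpa_gens E \<longleftrightarrow> e \<in> arcs E"
  by (auto simp: lpa_gens_def)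

lemma sum_words_closed:
  assumes "finite S" "\<And>s. s \<in> S \<Longrightarrow> set (g s) \<subseteq> X"
  shows "(\<lambda>w. \<Sum>s\<in>S. word_elt (g s) w) \<in> carrier (free_algebra K X)"
  using assms
proof (induction S)
  case empty
  show ?case by simp
next
  case (insert s S)
  then have "word_elt (g s) \<oplus>\<^bsub>free_algebra K X\<^esub> (\<lambda>w. \<Sum>s\<in>S. word_elt (g s) w)
      \<in> carrier (free_algebra K X)"
    by (intro free_algebra_add_closed word_elt_closed) (auto simp: subset_iff)
  then show ?case using insert by simp
qed

lemma (in fin_digraph) lpa_rel_closed:
  fixes a b :: "('a, 'b) lpa_gen list \<Rightarrow> 'k::field"
  assumes "lpa_rel G a b"
  shows "a \<in> carrier (free_algebra K (lpa_gens G)) \<and> b \<in> carrier (free_algebra K (lpa_gens G))"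
proof -
  interpret F: ring "free_algebra K (lpa_gens G)" by (rule ring_free_algebra)
  have word: "word_elt w \<in> carrier (free_algebra K (lpa_gens G))" if "set w \<subseteq> lpa_gens G" for w
    using that by (intro word_elt_closed) auto
  have zero: "(\<lambda>_. 0) \<in> carrier (free_algebra K (lpa_gens G))" by simp
  note sum = sum_words_closed[of _ _ "lpa_gens G" K]
  show ?thesis
    using assms
  proof cases
    case CK2
    have "out_arcs G v \<subseteq> arcs G" for v by auto
    then show ?thesis unfolding CK2 using CK2
      by (intro conjI word sum) (auto simp: lpa_gens_def)
  next
    case unit
    then show ?thesis unfolding unit by (intro conjI word sum) (auto simp: lpa_gens_def)
  qed (auto intro!: word zero simp: lpa_gens_iff simp del: free_algebra_simps(1))
qed

context fin_digraph
begin

context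
  fixes K :: "'k::field itself"
begin

abbreviation (input) "F \<equiv> free_algebra K (lpa_gens G)"
abbreviation (input) "I \<equiv> lpa_ideal K G"
abbreviation (input) "L \<equiv> lpa K G"
abbreviation (input) "cls a \<equiv> I +>\<^bsub>F\<^esub> a"

lemma lpa_rel_diff_closed: "{a \<ominus>\<^bsub>F\<^esub> b | a b. lpa_rel G a b} \<subseteq> carrier F"
proof -
  interpret F: ring F by (rule ring_free_algebra)
  show ?thesis using lpa_rel_closed[of _ _ K] by (auto simp del: free_algebra_simps intro!: F.minus_closed)
qed

lemma ideal_lpa_ideal: "ideal I F"
  unfolding lpa_ideal_def by (rule ring.genideal_ideal[OF ring_free_algebra lpa_rel_diff_closed])

lemma ring_lpa: "ring L"
  unfolding lpa_def ring_quotient_module by (rule ideal.quotient_is_ring[OF ideal_lpa_ideal])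

lemma lpa_simps:
  "carrier L = a_rcosets\<^bsub>F\<^esub> I"
  "a \<in> carrier F \<Longrightarrow> b \<in> carrier F \<Longrightarrow> cls a \<otimes>\<^bsub>L\<^esub> cls b = cls (a \<otimes>\<^bsub>F\<^esub> b)"
  "a \<in> carrier F \<Longrightarrow> b \<in> carrier F \<Longrightarrow> cls a \<oplus>\<^bsub>L\<^esub> cls b = cls (a \<oplus>\<^bsub>F\<^esub> b)"
  "\<one>\<^bsub>L\<^esub> = cls \<one>\<^bsub>F\<^esub>" "\<zero>\<^bsub>L\<^esub> = I"
  by (simp_all only: lpa_def quotient_module_simps ideal.rcoset_mult_add[OF ideal_lpa_ideal]
      abelian_subgroup.a_rcos_sum[OF abelian_subgroupI3[OF ideal.axioms(1)[OF ideal_lpa_ideal]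
      ring.is_abelian_group[OF ring_free_algebra]]])

lemma cls_closed: "a \<in> carrier F \<Longrightarrow> cls a \<in> carrier L"
  unfolding lpa_simps A_RCOSETS_def' by blast

lemma lpa_cases:
  assumes "X \<in> carrier L" obtains a where "a \<in> carrier F" "X = cls a"
  using assms unfolding lpa_simps A_RCOSETS_def' by blast

lemma cls_eqI: assumes "lpa_rel G a b" shows "cls a = cls b"
proof -
  interpret F: ring F by (rule ring_free_algebra)
  interpret I: ideal I F by (rule ideal_lpa_ideal)
  have ab: "a \<in> carrier F" "b \<in> carrier F" using lpa_rel_closed[OF assms] by blast+
  have "a \<ominus>\<^bsub>F\<^esub> b \<in> I"
    unfolding lpa_ideal_def
    by (rule subsetD[OF F.genideal_self[OF lpa_rel_diff_closed]]) (use assms in blast)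
  then show ?thesis
    using ab by (metis F.quotient_eq_iff_same_a_r_cos ideal_lpa_ideal)
qed

lemma bappend_closed:
  assumes "e \<in> arcs G" "p \<in> bpaths G" "head G e = bsource G p"
  shows "bappend [e] p \<in> bpaths G"
proof (cases p)
  case (InfPath s)
  have "(e ## s) !! n \<in> arcs G \<and> head G ((e ## s) !! n) = tail G ((e ## s) !! Suc n)" for n
    using assms InfPath by (cases n) (auto simp: bpaths_def)
  then show ?thesis using InfPath by (auto simp: bpaths_def)
next
  case (SinkPath \<alpha> w)
  then obtain u where u: "out_arcs G w = {}" "awalk u \<alpha> w"
    using assms by (auto simp: bpaths_def)
  have "u = bsource G p" using u SinkPath by (cases \<alpha>) (auto simp: awalk_def)
  then have "awalk (tail G e) (e # \<alpha>) w"
    using u assms by (auto simp: awalk_def)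
  then show ?thesis using u SinkPath by (auto simp: bpaths_def)
qed

lemma btail_closed:
  assumes "p \<in> bpaths G" shows "btail p \<in> bpaths G"
proof (cases p)
  case (InfPath s)
  then show ?thesis using assms by (auto simp: bpaths_def simp flip: snth.simps(2))
next
  case (SinkPath \<alpha> w)
  then obtain u where u: "out_arcs G w = {}" "awalk u \<alpha> w"
    using assms by (auto simp: bpaths_def)
  then have "\<exists>u'. awalk u' (tl \<alpha>) w"
    by (cases \<alpha>) (auto simp: awalk_def intro!: exI[of _ "head G _"])
  then show ?thesis using u SinkPath by (auto simp: bpaths_def)
qed

lemma btail_bappend: "btail (bappend [e] p) = p"
  by (cases p) auto

lemma bsource_bappend: "bsource G (bappend [e] p) = tail G e"
  by (cases p) auto

lemma bsource_closed: assumes "p \<in> bpaths G" shows "bsource G p \<in> verts G"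
proof (cases p)
  case (InfPath s)
  then have "shd s \<in> arcs G" using assms by (auto simp: bpaths_def dest: spec[of _ 0])
  then show ?thesis using InfPath by auto
next
  case (SinkPath \<alpha> w)
  then obtain u where "awalk u \<alpha> w" using assms by (auto simp: bpaths_def)
  then show ?thesis using SinkPath by (cases \<alpha>) (auto simp: awalk_def)
qed

lemma bpaths_edge_source:
  assumes "bappend [e] p \<in> bpaths G" shows "e \<in> arcs G" "head G e = bsource G p"
proof -
  have "e \<in> arcs G \<and> head G e = bsource G p"
  proof (cases p)
    case (InfPath s)
    then have "(e ## s) !! n \<in> arcs G \<and> head G ((e ## s) !! n) = tail G ((e ## s) !! Suc n)" for n
      using assms by (auto simp: bpaths_def)
    from this[of 0] show ?thesis using InfPath by simp
  next
    case (SinkPath \<alpha> w)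
    then show ?thesis using assms by (cases \<alpha>) (auto simp: bpaths_def awalk_def)
  qed
  then show "e \<in> arcs G" "head G e = bsource G p" by auto
qed

lemma bpaths_first_edge:
  assumes "p \<in> bpaths G" "out_arcs G (bsource G p) \<noteq> {}"
  obtains e where "p = bappend [e] (btail p)" "e \<in> out_arcs G (bsource G p)"
proof -
  have "\<exists>e. p = bappend [e] (btail p)"
  proof (cases p)
    case (InfPath s)
    then show ?thesis by (auto intro: exI[of _ "shd s"])
  next
    case (SinkPath \<alpha> w)
    then show ?thesis using assms by (cases \<alpha>) (auto simp: bpaths_def)
  qed
  then obtain e where e: "p = bappend [e] (btail p)" by blast
  then have "e \<in> arcs G" "bsource G p = tail G e"
    using bpaths_edge_source[of e "btail p"] assms bsource_bappend[of e "btail p"] by auto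
  then show thesis using that e by auto
qed

lemma tail_equiv_btail: "tail_equiv (btail p) q \<longleftrightarrow> tail_equiv p q"
proof
  assume "tail_equiv (btail p) q"
  then obtain m n where "(btail ^^ m) (btail p) = (btail ^^ n) q" by (auto simp: tail_equiv_def)
  then have "(btail ^^ Suc m) p = (btail ^^ n) q" by (simp add: funpow_swap1)
  then show "tail_equiv p q" unfolding tail_equiv_def by blast
next
  assume "tail_equiv p q"
  then obtain m n where "(btail ^^ m) p = (btail ^^ n) q" by (auto simp: tail_equiv_def)
  then have "btail ((btail ^^ m) p) = btail ((btail ^^ n) q)" by (rule arg_cong)
  then have "(btail ^^ m) (btail p) = (btail ^^ Suc n) q" by (simp add: funpow_swap1)
  then show "tail_equiv (btail p) q" unfolding tail_equiv_def by blast
qed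

lemma tail_class_subset: "tail_class G q \<subseteq> bpaths G"
  by (auto simp: tail_class_def)

lemma gen_act_closed:
  assumes "g \<in> lpa_gens G" "p \<in> tail_class G q" "gen_act G g p = Some p'"
  shows "p' \<in> tail_class G q"
proof (cases g)
  case (Edge e)
  then have "p' = bappend [e] p" "e \<in> arcs G" "head G e = bsource G p"
    using assms by (auto simp: lpa_gens_def split: if_splits)
  then show ?thesis
    using assms bappend_closed[of e p] tail_equiv_btail[of p' q]
    by (auto simp: tail_class_def btail_bappend)
next
  case (Ghost e)
  then have "p' = btail p" using assms by (auto split: if_splits)
  then show ?thesis using assms by (simp add: tail_class_def btail_closed tail_equiv_btail)
qed (use assms in \<open>auto split: if_splits\<close>)

lemma word_act_closed:
  assumes "w \<in> lists (lpa_gens G)" "p \<in> tail_class G q" "word_act G w p = Some p'"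
  shows "p' \<in> tail_class G q"
  using assms
proof (induction w arbitrary: p')
  case (Cons g w)
  then show ?case by (cases "word_act G w p") (auto intro: gen_act_closed)
qed simp

lemma chen_simps:
  "carrier (chen_module K G q) = {f. finite {p. f p \<noteq> 0} \<and> {p. f p \<noteq> 0} \<subseteq> tail_class G q}"
  "\<zero>\<^bsub>chen_module K G q\<^esub> = (\<lambda>_. 0)"
  "f \<oplus>\<^bsub>chen_module K G q\<^esub> g = (\<lambda>p. f p + g p)"
  "X \<odot>\<^bsub>chen_module K G q\<^esub> f = free_act G (SOME a. a \<in> X) f"
  by (simp_all add: chen_module_def)

lemma free_act_closed:
  assumes "a \<in> carrier F" "f \<in> carrier (chen_module K G q)"
  shows "free_act G a f \<in> carrier (chen_module K G q)"
proof -
  have "{p'. free_act G a f p' \<noteq> 0} \<subseteq> tail_class G q"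
  proof
    fix p' assume "p' \<in> {p'. free_act G a f p' \<noteq> 0}"
    then obtain w p where "a w \<noteq> 0" "f p \<noteq> 0" "word_act G w p = Some p'"
      using free_act_support[of G a f] by fastforce
    moreover from this have "w \<in> lists (lpa_gens G)" "p \<in> tail_class G q"
      using assms by (auto simp: chen_simps)
    ultimately show "p' \<in> tail_class G q" using word_act_closed by blast
  qed
  then show ?thesis
    using assms free_act_finite_support[of a f G] by (simp add: chen_simps)
qed

lemma abelian_group_chen: "abelian_group (chen_module K G q)" (is "abelian_group ?V")
proof (rule abelian_groupI)
  fix f g assume fg: "f \<in> carrier ?V" "g \<in> carrier ?V"
  have "{p. f p + g p \<noteq> 0} \<subseteq> {p. f p \<noteq> 0} \<union> {p. g p \<noteq> 0}" (is "?A \<subseteq> ?B") by auto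
  moreover have "finite ?B" "?B \<subseteq> tail_class G q" using fg by (auto simp: chen_simps)
  ultimately have "finite ?A" "?A \<subseteq> tail_class G q" by (auto intro: finite_subset)
  then show "f \<oplus>\<^bsub>?V\<^esub> g \<in> carrier ?V" by (simp add: chen_simps)
next
  fix f assume "f \<in> carrier ?V"
  then show "\<exists>g \<in> carrier ?V. g \<oplus>\<^bsub>?V\<^esub> f = \<zero>\<^bsub>?V\<^esub>"
    by (intro bexI[of _ "\<lambda>p. - f p"]) (auto simp: chen_simps)
qed (auto simp: chen_simps add_ac)

lemma basis_act_lpa_rel:
  fixes a b :: "('a, 'b) lpa_gen list \<Rightarrow> 'k"
  assumes "lpa_rel G a b" "p \<in> bpaths G"
  shows "basis_act G a p p' = basis_act G b p p'"
  using assms(1)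
proof cases
  case (V v u)
  then show ?thesis by (auto simp: basis_act_word_elt basis_act_zero)
next
  case (E1_source e)
  then show ?thesis by (auto simp: basis_act_word_elt bsource_bappend)
next
  case (E1_range e)
  then show ?thesis by (auto simp: basis_act_word_elt)
next
  case (E2_range e)
  then show ?thesis
    using bpaths_edge_source[of e "btail p"] assms(2) by (auto simp: basis_act_word_elt)
next
  case (E2_source e)
  then show ?thesis
    using bsource_bappend[of e "btail p"] by (auto simp: basis_act_word_elt)
next
  case (CK1 e e')
  have *: "bappend [e'] p = bappend [e] p \<longleftrightarrow> e = e'" by (cases p) auto
  from CK1 show ?thesis
    by (auto simp: basis_act_word_elt basis_act_zero btail_bappend *)
next
  case (CK2 v)
  have inj: "inj_on (\<lambda>e. [Edge e, Ghost e]) (out_arcs G v)" by (auto intro: inj_onI)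
  have act: "word_act G [Edge e, Ghost e] p = (if p = bappend [e] (btail p) then Some p else None)" for e
    using bpaths_edge_source[of e "btail p"] assms(2) by auto
  have "(\<Sum>e\<in>out_arcs G v. of_bool (word_act G [Edge e, Ghost e] p = Some p')) =
      (of_bool (v = bsource G p \<and> p = p') :: 'k)"
  proof (cases "v = bsource G p")
    case True
    obtain e where e: "p = bappend [e] (btail p)" "e \<in> out_arcs G v"
      using bpaths_first_edge assms(2) CK2 True by metis
    have uniq: "p = bappend [e'] (btail p) \<longleftrightarrow> e' = e" for e'
      using e(1) by (cases "btail p") (metis bpath.inject bappend.simps list.inject append_Cons shift.simps(2) stream.inject)+
    have "(\<Sum>e'\<in>out_arcs G v. of_bool (word_act G [Edge e', Ghost e'] p = Some p')) =
        (\<Sum>e'\<in>out_arcs G v. if e' = e then of_bool (p = p') else (0 :: 'k))"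
      unfolding act uniq by (rule sum.cong) auto
    then show ?thesis using True e(2) CK2 by simp
  next
    case False
    then have "p \<noteq> bappend [e] (btail p)" if "e \<in> out_arcs G v" for e
      using that bsource_bappend[of e "btail p"] by auto
    then show ?thesis using False unfolding act by auto
  qed
  then show ?thesis
    unfolding CK2 basis_act_sum_words[OF CK2(5) inj] basis_act_word_elt by auto
next
  case unit
  have inj: "inj_on (\<lambda>v. [Vertex v]) (verts G)" by (auto intro: inj_onI)
  have "(\<Sum>v\<in>verts G. of_bool (word_act G [Vertex v] p = Some p')) =
      (\<Sum>v\<in>verts G. if v = bsource G p then of_bool (p = p') else (0 :: 'k))"
    by (rule sum.cong) auto
  also have "\<dots> = of_bool (p = p')" using bsource_closed[OF assms(2)] by simp
  finally show ?thesis
    unfolding unit basis_act_sum_words[OF finite_verts inj] basis_act_word_elt by auto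
qed

lemma lpa_ideal_annihilates:
  assumes "a \<in> I" "f \<in> carrier (chen_module K G q)"
  shows "free_act G a f = (\<lambda>_. 0)"
proof -
  interpret F: ring F by (rule ring_free_algebra)
  let ?V = "chen_module K G q"
  define J where "J = {a \<in> carrier F. \<forall>f \<in> carrier ?V. free_act G a f = (\<lambda>_. 0)}"
  have fin_V: "finite {p. g p \<noteq> 0}" if "g \<in> carrier ?V" for g
    using that by (simp add: chen_simps)
  note fin_F = free_algebra_closedD(1)
  have zero: "(\<lambda>_. 0) \<in> carrier ?V" by (simp add: chen_simps)
  have neg: "(\<lambda>w. - a w) \<in> carrier F" "\<ominus>\<^bsub>F\<^esub> a = (\<lambda>w. - a w)" if a: "a \<in> carrier F" for a
  proof -
    show *: "(\<lambda>w. - a w) \<in> carrier F" using a by simp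
    show "\<ominus>\<^bsub>F\<^esub> a = (\<lambda>w. - a w)"
      using F.minus_equality[OF _ a *] by simp
  qed
  have act_neg: "free_act G (\<lambda>w. - a w) g = (\<lambda>p. - free_act G a g p)"
    for a :: "('a, 'b) lpa_gen list \<Rightarrow> 'k" and g
    unfolding free_act_def by (auto simp: fun_eq_iff sum_negf[symmetric] intro!: sum.cong)
  have J: "ideal J F"
  proof (rule idealI)
    show "ring F" by (rule F.ring_axioms)
    show "subgroup J (add_monoid F)"
    proof (rule group.subgroupI)
      show "Group.group (add_monoid F)" by (rule F.add.is_group)
      show "J \<subseteq> carrier (add_monoid F)" by (auto simp: J_def)
      show "J \<noteq> {}" using F.zero_closed by (auto simp: J_def free_act_zero_left intro: exI[of _ "\<lambda>_. 0"])
    next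
      fix a assume "a \<in> J"
      then have a: "a \<in> carrier F" "\<forall>f \<in> carrier ?V. free_act G a f = (\<lambda>_. 0)"
        by (simp_all add: J_def del: free_algebra_simps)
      have "\<ominus>\<^bsub>F\<^esub> a \<in> J"
        using a(2) neg[OF a(1)] by (simp add: J_def act_neg del: free_algebra_simps)
      then show "inv\<^bsub>add_monoid F\<^esub> a \<in> J" by (simp add: a_inv_def)
    next
      fix a b assume "a \<in> J" "b \<in> J"
      then have ab: "a \<in> carrier F" "b \<in> carrier F"
        "\<forall>f \<in> carrier ?V. free_act G a f = (\<lambda>_. 0)" "\<forall>f \<in> carrier ?V. free_act G b f = (\<lambda>_. 0)"
        by (simp_all add: J_def del: free_algebra_simps)
      have "free_act G (\<lambda>w. a w + b w) f = (\<lambda>_. 0)" if f: "f \<in> carrier ?V" for f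
        using ab f by (simp add: free_act_add_left[OF fin_F[OF ab(1)] fin_F[OF ab(2)] fin_V[OF f]])
      then have "a \<oplus>\<^bsub>F\<^esub> b \<in> J"
        using F.a_closed[OF ab(1,2)] by (simp add: J_def free_algebra_simps(5) del: free_algebra_simps(1))
      then show "a \<otimes>\<^bsub>add_monoid F\<^esub> b \<in> J" by (simp del: free_algebra_simps)
    qed
  next
    fix a x assume "a \<in> J" and x: "x \<in> carrier F"
    then have a: "a \<in> carrier F" "\<And>f. f \<in> carrier ?V \<Longrightarrow> free_act G a f = (\<lambda>_. 0)"
      by (simp_all add: J_def del: free_algebra_simps)
    have "free_act G (x \<otimes>\<^bsub>F\<^esub> a) f = (\<lambda>_. 0)" if f: "f \<in> carrier ?V" for f
      unfolding free_algebra_simps(2) free_act_mult[OF fin_F[OF x] fin_F[OF a(1)] fin_V[OF f]]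
        a(2)[OF f] by (simp add: free_act_def)
    then show "x \<otimes>\<^bsub>F\<^esub> a \<in> J"
      using F.m_closed[OF x a(1)] by (simp add: J_def del: free_algebra_simps)
    have "free_act G (a \<otimes>\<^bsub>F\<^esub> x) f = (\<lambda>_. 0)" if f: "f \<in> carrier ?V" for f
      unfolding free_algebra_simps(2) free_act_mult[OF fin_F[OF a(1)] fin_F[OF x] fin_V[OF f]]
      by (rule a(2)[OF free_act_closed[OF x f]])
    then show "a \<otimes>\<^bsub>F\<^esub> x \<in> J"
      using F.m_closed[OF a(1) x] by (simp add: J_def del: free_algebra_simps)
  qed
  have "{a \<ominus>\<^bsub>F\<^esub> b | a b. lpa_rel G a b} \<subseteq> J"
  proof
    fix c assume "c \<in> {a \<ominus>\<^bsub>F\<^esub> b | a b. lpa_rel G a b}"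
    then obtain a b where c: "c = a \<ominus>\<^bsub>F\<^esub> b" and rel: "lpa_rel G a b" by blast
    have ab: "a \<in> carrier F" "b \<in> carrier F" using lpa_rel_closed[OF rel] by blast+
    have "free_act G c f = (\<lambda>_. 0)" if f: "f \<in> carrier ?V" for f
    proof -
      have "free_act G a f = free_act G b f"
        using f by (intro free_act_cong fin_V basis_act_lpa_rel[OF rel])
          (auto simp: chen_simps tail_class_def)
      moreover have "free_act G c f = (\<lambda>p. free_act G a f p + - free_act G b f p)"
        unfolding c a_minus_def neg(2)[OF ab(2)] free_algebra_simps(5)
          free_act_add_left[OF fin_F[OF ab(1)] fin_F[OF neg(1)[OF ab(2)]] fin_V[OF f]] act_neg ..
      ultimately show ?thesis by simp
    qed
    moreover have "c \<in> carrier F" unfolding c by (rule F.minus_closed[OF ab])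
    ultimately show "c \<in> J" by (simp add: J_def del: free_algebra_simps)
  qed
  then have "I \<subseteq> J" unfolding lpa_ideal_def by (rule F.genideal_minimal[OF J])
  then show ?thesis using assms by (auto simp: J_def simp del: free_algebra_simps)
qed

lemma cls_mem_act:
  assumes a: "a \<in> carrier F" and b: "b \<in> cls a" and f: "f \<in> carrier (chen_module K G q)"
  shows "free_act G b f = free_act G a f"
proof -
  interpret I: ideal I F by (rule ideal_lpa_ideal)
  obtain i where i: "i \<in> I" "b = i \<oplus>\<^bsub>F\<^esub> a" using b by (auto simp: a_r_coset_def' simp del: free_algebra_simps)
  have "i \<in> carrier F" using i(1) by (rule I.a_Hcarr)
  then show ?thesis
    unfolding i(2) free_algebra_simps(5)
    using free_act_add_left[OF free_algebra_closedD(1) free_algebra_closedD(1)[OF a], of i K "lpa_gens G" f G]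
      lpa_ideal_annihilates[OF i(1) f] f by (simp add: chen_simps)
qed

lemma chen_smult_cls:
  assumes a: "a \<in> carrier F" and f: "f \<in> carrier (chen_module K G q)"
  shows "cls a \<odot>\<^bsub>chen_module K G q\<^esub> f = free_act G a f"
proof -
  interpret I: ideal I F by (rule ideal_lpa_ideal)
  have "a \<in> cls a" by (rule I.a_rcos_self[OF a])
  then have "(SOME b. b \<in> cls a) \<in> cls a" by (rule someI[of "\<lambda>b. b \<in> cls a"])
  then show ?thesis unfolding chen_simps by (rule cls_mem_act[OF a _ f])
qed

theorem chen_smult:
  assumes "X \<in> carrier L" "a \<in> X" "f \<in> carrier (chen_module K G q)"
  shows "X \<odot>\<^bsub>chen_module K G q\<^esub> f = free_act G a f"
  using assms(1) by (rule lpa_cases) (metis assms(2,3) chen_smult_cls cls_mem_act)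

theorem left_module_chen: "left_module L (chen_module K G q)" (is "left_module L ?V")
proof -
  interpret F: ring F by (rule ring_free_algebra)
  have fin_V: "finite {p. g p \<noteq> 0}" if "g \<in> carrier ?V" for g
    using that by (simp add: chen_simps)
  note fin_F = free_algebra_closedD(1)
  show ?thesis
  proof (intro left_module.intro left_module_axioms.intro ring_lpa abelian_group_chen)
    fix X f assume X: "X \<in> carrier L" and f: "f \<in> carrier ?V"
    obtain a where a: "a \<in> carrier F" "X = cls a" using X by (rule lpa_cases)
    show "X \<odot>\<^bsub>?V\<^esub> f \<in> carrier ?V"
      unfolding a(2) chen_smult_cls[OF a(1) f] by (rule free_act_closed[OF a(1) f])
    fix Y assume Y: "Y \<in> carrier L"
    obtain b where b: "b \<in> carrier F" "Y = cls b" using Y by (rule lpa_cases)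
    show "(X \<oplus>\<^bsub>L\<^esub> Y) \<odot>\<^bsub>?V\<^esub> f = X \<odot>\<^bsub>?V\<^esub> f \<oplus>\<^bsub>?V\<^esub> Y \<odot>\<^bsub>?V\<^esub> f"
      unfolding a(2) b(2) lpa_simps(3)[OF a(1) b(1)] chen_smult_cls[OF F.a_closed[OF a(1) b(1)] f]
        chen_smult_cls[OF a(1) f] chen_smult_cls[OF b(1) f]
      unfolding chen_simps(3) free_algebra_simps(5)
      by (rule free_act_add_left[OF fin_F[OF a(1)] fin_F[OF b(1)] fin_V[OF f]])
    show "(X \<otimes>\<^bsub>L\<^esub> Y) \<odot>\<^bsub>?V\<^esub> f = X \<odot>\<^bsub>?V\<^esub> (Y \<odot>\<^bsub>?V\<^esub> f)"
      unfolding a(2) b(2) lpa_simps(2)[OF a(1) b(1)] chen_smult_cls[OF F.m_closed[OF a(1) b(1)] f]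
        chen_smult_cls[OF b(1) f] chen_smult_cls[OF a(1) free_act_closed[OF b(1) f]]
      unfolding free_algebra_simps(2)
      by (rule free_act_mult[OF fin_F[OF a(1)] fin_F[OF b(1)] fin_V[OF f]])
  next
    fix X f g assume X: "X \<in> carrier L" and f: "f \<in> carrier ?V" and g: "g \<in> carrier ?V"
    obtain a where a: "a \<in> carrier F" "X = cls a" using X by (rule lpa_cases)
    show "X \<odot>\<^bsub>?V\<^esub> (f \<oplus>\<^bsub>?V\<^esub> g) = X \<odot>\<^bsub>?V\<^esub> f \<oplus>\<^bsub>?V\<^esub> X \<odot>\<^bsub>?V\<^esub> g"
      unfolding a(2) chen_smult_cls[OF a(1) f] chen_smult_cls[OF a(1) g]
        chen_smult_cls[OF a(1) abelian_monoid.a_closed[OF abelian_group.axioms(1)[OF abelian_group_chen] f g]]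
      unfolding chen_simps(3)
      by (rule free_act_add_right[OF fin_V[OF f] fin_V[OF g]])
  next
    fix f assume f: "f \<in> carrier ?V"
    show "\<one>\<^bsub>L\<^esub> \<odot>\<^bsub>?V\<^esub> f = f"
      unfolding lpa_simps(4) chen_smult_cls[OF F.one_closed f] unfolding free_algebra_simps(3)
      by (rule free_act_one[OF fin_V[OF f]])
  qed
qed


lemma free_algebra_induct [consumes 1, case_names zero word add]:
  assumes "a \<in> carrier F"
    and zero: "P (\<lambda>_. 0)"
    and word: "\<And>k u. set u \<subseteq> lpa_gens G \<Longrightarrow> P (\<lambda>w. k * word_elt u w)"
    and add: "\<And>a b. a \<in> carrier F \<Longrightarrow> b \<in> carrier F \<Longrightarrow> P a \<Longrightarrow> P b \<Longrightarrow> P (\<lambda>w. a w + b w)"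
  shows "P a"
proof -
  have "finite {w. a w \<noteq> 0}" by (rule free_algebra_closedD(1)[OF assms(1)])
  then show ?thesis using assms(1)
  proof (induction "{w. a w \<noteq> 0}" arbitrary: a rule: finite_induct)
    case empty
    then have "a = (\<lambda>_. 0)" by auto
    then show ?case using zero by simp
  next
    case (insert u S)
    define b where "b = (\<lambda>w. if w = u then 0 else a w)"
    have u: "u \<in> lists (lpa_gens G)" using insert.hyps(4) free_algebra_closedD(2)[OF insert.prems] by blast
    then have set: "set u \<subseteq> lpa_gens G" by auto
    have S: "S = {w. b w \<noteq> 0}" using insert.hyps(2,4) unfolding b_def by auto
    have b: "b \<in> carrier F"
      by (rule free_algebra_closedI[OF insert.hyps(1)])
        (use S insert.hyps(4) free_algebra_closedD(2)[OF insert.prems] in blast)+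
    have k: "(\<lambda>w. a u * word_elt u w) \<in> carrier F"
      by (rule free_algebra_closedI[of "{u}"]) (use u in \<open>auto simp: word_elt_def\<close>)
    have "a = (\<lambda>w. a u * word_elt u w + b w)" by (auto simp: b_def word_elt_def)
    then show ?case using add[OF k b word[OF set] insert.hyps(3)[OF S b]] by simp
  qed
qed

definition sink_word :: "'a \<Rightarrow> ('a, 'b) bpath \<Rightarrow> ('a, 'b) lpa_gen list" where
  "sink_word w p = (case p of SinkPath \<alpha> _ \<Rightarrow> map Edge \<alpha> @ [Vertex w] | _ \<Rightarrow> [])"

definition sink_path :: "'a \<Rightarrow> ('a, 'b) lpa_gen list \<Rightarrow> ('a, 'b) bpath" where
  "sink_path w u = SinkPath (map (\<lambda>g. case g of Edge e \<Rightarrow> e | _ \<Rightarrow> undefined) (butlast u)) w"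

definition sink_elt :: "'a \<Rightarrow> (('a, 'b) bpath \<Rightarrow> 'k) \<Rightarrow> ('a, 'b) lpa_gen list \<Rightarrow> 'k" where
  "sink_elt w f u = (if sink_word w (sink_path w u) = u then f (sink_path w u) else 0)"

lemma sink_path_word: "sink_path w (sink_word w (SinkPath \<alpha> w)) = SinkPath \<alpha> w"
  by (simp add: sink_path_def sink_word_def comp_def)

lemma tail_class_sink:
  assumes "p \<in> tail_class G (SinkPath [] w)"
  obtains \<alpha> u where "p = SinkPath \<alpha> w" "awalk u \<alpha> w" "w \<in> verts G"
proof -
  have *: "(btail ^^ n) (SinkPath [] w) = SinkPath [] w" for n :: nat
    by (induction n) auto
  have inf: "\<exists>s'. (btail ^^ n) (InfPath s) = (InfPath s' :: ('a, 'b) bpath)" for n and s :: "'b stream"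
    by (induction n) auto
  have sink: "(btail ^^ n) (SinkPath \<alpha> w') = SinkPath (drop n \<alpha>) w'" for n \<alpha> and w' :: 'a
    by (induction n) (auto simp: drop_Suc tl_drop)
  from assms obtain m where m: "(btail ^^ m) p = SinkPath [] w" "p \<in> bpaths G"
    by (auto simp: tail_class_def tail_equiv_def *)
  have "\<exists>\<alpha>. p = SinkPath \<alpha> w"
  proof (cases p)
    case (InfPath t)
    then show ?thesis using inf[of m t] m(1) by auto
  next
    case (SinkPath \<beta> w')
    then show ?thesis using sink[of m \<beta> w'] m(1) by auto
  qed
  then obtain \<alpha> where p: "p = SinkPath \<alpha> w" by blast
  then obtain u where u: "awalk u \<alpha> w" using m(2) by (auto simp: bpaths_def)
  then have "w \<in> verts G" by (rule awalk_last_in_verts)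
  then show thesis using that p u by blast
qed

lemma word_act_sink_word:
  assumes "awalk u \<alpha> w"
  shows "word_act G (sink_word w (SinkPath \<alpha> w)) (SinkPath [] w) = Some (SinkPath \<alpha> w)"
  using assms
proof (induction \<alpha> arbitrary: u)
  case Nil
  show ?case by (simp add: sink_word_def)
next
  case (Cons e \<alpha>)
  then have "awalk (head G e) \<alpha> w" by (auto simp: awalk_def)
  with Cons.IH have "word_act G (sink_word w (SinkPath \<alpha> w)) (SinkPath [] w) = Some (SinkPath \<alpha> w)"
    by blast
  moreover have "head G e = bsource G (SinkPath \<alpha> w)"
    using Cons.prems by (cases \<alpha>) (auto simp: awalk_def)
  ultimately show ?case by (simp add: sink_word_def)
qed

abbreviation (input) "wcls u \<equiv> cls (word_elt u :: ('a, 'b) lpa_gen list \<Rightarrow> 'k)"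

lemma wcls_append:
  assumes "set u \<subseteq> lpa_gens G" "set v \<subseteq> lpa_gens G"
  shows "wcls (u @ v) = wcls u \<otimes>\<^bsub>L\<^esub> wcls v"
proof -
  have "word_elt u \<in> carrier F" "word_elt v \<in> carrier F" 
    by (rule word_elt_closed; use assms in auto)+
  then show ?thesis using lpa_simps(2) word_elt_mult by metis
qed

lemma wcls_closed: "set u \<subseteq> lpa_gens G \<Longrightarrow> wcls u \<in> carrier L"
  by (rule cls_closed, rule word_elt_closed) auto

lemma cls_zero: "cls (\<lambda>_. 0) = I"
  using ideal.axioms(1)[OF ideal_lpa_ideal] abelian_group.a_coset_add_zero[OF ring.is_abelian_group[OF ring_free_algebra[of K "lpa_gens G"]], of I]
    additive_subgroup.a_subset[OF ideal.axioms(1)[OF ideal_lpa_ideal]] by simp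

lemma wcls_cong:
  assumes "wcls u = wcls u'" "set u \<subseteq> lpa_gens G" "set u' \<subseteq> lpa_gens G"
    "set v \<subseteq> lpa_gens G" "set v' \<subseteq> lpa_gens G"
  shows "wcls (v @ u @ v') = wcls (v @ u' @ v')"
  using assms by (simp add: wcls_append)

lemma wcls_zero:
  assumes "wcls u = I" "set u \<subseteq> lpa_gens G" "set v \<subseteq> lpa_gens G" "set v' \<subseteq> lpa_gens G"
  shows "wcls (v @ u @ v') = I"
proof -
  interpret L: ring L by (rule ring_lpa)
  have "wcls (v @ u @ v') = wcls v \<otimes>\<^bsub>L\<^esub> (\<zero>\<^bsub>L\<^esub> \<otimes>\<^bsub>L\<^esub> wcls v')"
    using assms by (simp add: wcls_append lpa_simps(5))
  also have "\<dots> = \<zero>\<^bsub>L\<^esub>" using assms(3,4) by (simp only: L.l_null L.r_null wcls_closed)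
  also have "\<dots> = I" by (rule lpa_simps(5))
  finally show ?thesis .
qed

lemma wcls_gen_act:
  assumes g: "g \<in> lpa_gens G" and p: "awalk u \<alpha> w" and sink: "out_arcs G w = {}"
  shows "wcls (g # sink_word w (SinkPath \<alpha> w)) =
    (case gen_act G g (SinkPath \<alpha> w) of None \<Rightarrow> I | Some p' \<Rightarrow> wcls (sink_word w p'))"
proof -
  have w: "Vertex w \<in> lpa_gens G" using awalk_last_in_verts[OF p] by (simp add: lpa_gens_iff)
  have gens: "set (sink_word w (SinkPath \<alpha> w)) \<subseteq> lpa_gens G" if "awalk u \<alpha> w" for u \<alpha>
    using that w by (auto simp: sink_word_def lpa_gens_iff awalk_def)
  have V: "wcls [Vertex v, Vertex v'] = (if v = v' then wcls [Vertex v] else I)"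
    if "v \<in> verts G" "v' \<in> verts G" for v v'
    using cls_eqI[OF lpa_rel.V[OF that]] cls_zero by auto
  note E1s = cls_eqI[OF lpa_rel.E1_source] and E1r = cls_eqI[OF lpa_rel.E1_range]
    and E2s = cls_eqI[OF lpa_rel.E2_source]
  have vertex: "wcls (Vertex v # sink_word w (SinkPath \<alpha> w)) =
      (if v = bsource G (SinkPath \<alpha> w) then wcls (sink_word w (SinkPath \<alpha> w)) else I)"
    if v: "v \<in> verts G" and p: "awalk u \<alpha> w" for v u \<alpha>
  proof (cases \<alpha>)
    case Nil
    then show ?thesis using V[OF v, of w] awalk_last_in_verts[OF p] by (simp add: sink_word_def)
  next
    case (Cons e \<beta>)
    then have e: "e \<in> arcs G" "set (map Edge \<beta> @ [Vertex w]) \<subseteq> lpa_gens G"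
      using p w by (auto simp: awalk_def lpa_gens_iff)
    let ?r = "map Edge \<beta> @ [Vertex w]"
    have "wcls (Vertex v # Edge e # ?r) = wcls ([Vertex v] @ [Vertex (tail G e), Edge e] @ ?r)"
      using wcls_cong[OF E1s[OF e(1)], of "[Vertex v]" ?r] v e by (simp add: lpa_gens_iff)
    also have "\<dots> = wcls ([] @ [Vertex v, Vertex (tail G e)] @ (Edge e # ?r))" by simp
    also have "\<dots> = (if v = tail G e then wcls (Edge e # ?r) else I)"
    proof (cases "v = tail G e")
      case True
      have "wcls ([] @ [Vertex v, Vertex (tail G e)] @ (Edge e # ?r)) =
          wcls ([] @ [Vertex (tail G e)] @ (Edge e # ?r))"
        using V[OF v, of "tail G e"] True e v by (intro wcls_cong) (auto simp: lpa_gens_iff)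
      also have "\<dots> = wcls ([] @ [Vertex (tail G e), Edge e] @ ?r)" by simp
      also have "\<dots> = wcls ([] @ [Edge e] @ ?r)"
        using E1s[OF e(1)] e by (intro wcls_cong) (auto simp: lpa_gens_iff)
      finally show ?thesis using True by simp
    next
      case False
      then have "wcls ([] @ [Vertex v, Vertex (tail G e)] @ (Edge e # ?r)) = I"
        using V[OF v, of "tail G e"] e v by (intro wcls_zero) (auto simp: lpa_gens_iff)
      then show ?thesis using False by simp
    qed
    finally show ?thesis using Cons by (simp add: sink_word_def)
  qed
  show ?thesis
  proof (cases g)
    case (Vertex v)
    then show ?thesis using vertex[OF _ p, of v] g by (simp add: lpa_gens_iff)
  next
    case (Edge e)
    then have e: "e \<in> arcs G" using g by (simp add: lpa_gens_iff)
    let ?r = "sink_word w (SinkPath \<alpha> w)"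
    show ?thesis
    proof (cases "head G e = bsource G (SinkPath \<alpha> w)")
      case True
      then show ?thesis using Edge by (simp add: sink_word_def)
    next
      case False
      then have "wcls (Vertex (head G e) # ?r) = I" using vertex[OF _ p] e by simp
      then have "wcls ([Edge e] @ (Vertex (head G e) # ?r) @ []) = I"
        using gens[OF p] e by (intro wcls_zero) (auto simp: lpa_gens_iff)
      moreover have "wcls ([] @ [Edge e, Vertex (head G e)] @ ?r) = wcls ([] @ [Edge e] @ ?r)"
        using E1r[OF e] gens[OF p] e by (intro wcls_cong) (auto simp: lpa_gens_iff)
      ultimately show ?thesis using False Edge by simp
    qed
  next
    case (Ghost e)
    then have e: "e \<in> arcs G" using g by (simp add: lpa_gens_iff)
    show ?thesis
    proof (cases \<alpha>)
      case Nil
      then have "tail G e \<noteq> w" using sink e by auto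
      then have "wcls (Vertex (tail G e) # sink_word w (SinkPath \<alpha> w)) = I"
        using vertex[OF _ p] e Nil by simp
      then have "wcls ([Ghost e] @ (Vertex (tail G e) # sink_word w (SinkPath \<alpha> w)) @ []) = I"
        using gens[OF p] e by (intro wcls_zero) (auto simp: lpa_gens_iff)
      moreover have "wcls ([] @ [Ghost e, Vertex (tail G e)] @ sink_word w (SinkPath \<alpha> w)) =
          wcls ([] @ [Ghost e] @ sink_word w (SinkPath \<alpha> w))"
        using E2s[OF e] gens[OF p] e by (intro wcls_cong) (auto simp: lpa_gens_iff)
      ultimately show ?thesis using Ghost Nil by simp
    next
      case (Cons e' \<beta>)
      then have e': "e' \<in> arcs G" "awalk (head G e') \<beta> w" using p by (auto simp: awalk_def)
      have src: "bsource G (SinkPath \<beta> w) = head G e'" using e'(2) by (cases \<beta>) (auto simp: awalk_def)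
      let ?r = "sink_word w (SinkPath \<beta> w)"
      have word: "sink_word w (SinkPath \<alpha> w) = Edge e' # ?r" using Cons by (simp add: sink_word_def)
      have CK1: "wcls [Ghost e, Edge e'] = (if e = e' then wcls [Vertex (head G e)] else I)"
        using cls_eqI[OF lpa_rel.CK1[OF e e'(1)]] cls_zero by auto
      have act: "gen_act G g (SinkPath \<alpha> w) = (if e = e' then Some (SinkPath \<beta> w) else None)"
        using Cons Ghost by auto
      show ?thesis
      proof (cases "e = e'")
        case True
        have "wcls ([] @ [Ghost e, Edge e'] @ ?r) = wcls ([] @ [Vertex (head G e)] @ ?r)"
          using CK1 True gens[OF e'(2)] e e' by (intro wcls_cong) (auto simp: lpa_gens_iff)
        also have "\<dots> = wcls ?r" using vertex[OF _ e'(2), of "head G e"] src True e by simp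
        finally show ?thesis unfolding word act using True Ghost by simp
      next
        case False
        have "wcls ([] @ [Ghost e, Edge e'] @ ?r) = I"
          using CK1 False gens[OF e'(2)] e e' by (intro wcls_zero) (auto simp: lpa_gens_iff)
        then show ?thesis unfolding word act using False Ghost by simp
      qed
    qed
  qed
qed


lemma sink_word_closed:
  assumes "p \<in> tail_class G (SinkPath [] w)"
  shows "set (sink_word w p) \<subseteq> lpa_gens G"
  using assms by (rule tail_class_sink) (auto simp: sink_word_def lpa_gens_iff awalk_def)

lemma sink_path_class:
  assumes "p \<in> tail_class G (SinkPath [] w)"
  shows "sink_path w (sink_word w p) = p"
  using assms by (rule tail_class_sink) (simp only: sink_path_word)

lemma sink_elt_support:
  assumes "{p. f p \<noteq> 0} \<subseteq> tail_class G (SinkPath [] w)"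
  shows "{u. sink_elt w f u \<noteq> 0} \<subseteq> sink_word w ` {p. f p \<noteq> 0}"
proof
  fix u assume "u \<in> {u. sink_elt w f u \<noteq> 0}"
  then have "sink_word w (sink_path w u) = u" "f (sink_path w u) \<noteq> 0"
    by (simp_all add: sink_elt_def split: if_splits)
  then show "u \<in> sink_word w ` {p. f p \<noteq> 0}" by (intro image_eqI[of _ _ "sink_path w u"]) simp_all
qed

lemma sink_elt_closed:
  assumes "f \<in> carrier (chen_module K G (SinkPath [] w))"
  shows "sink_elt w f \<in> carrier F"
proof (rule free_algebra_closedI)
  have f: "finite {p. f p \<noteq> 0}" "{p. f p \<noteq> 0} \<subseteq> tail_class G (SinkPath [] w)"
    using assms by (simp_all add: chen_simps)
  show "finite (sink_word w ` {p. f p \<noteq> 0})" using f by simp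
  show "{u. sink_elt w f u \<noteq> 0} \<subseteq> sink_word w ` {p. f p \<noteq> 0}" by (rule sink_elt_support[OF f(2)])
  show "sink_word w ` {p. f p \<noteq> 0} \<subseteq> lists (lpa_gens G)" using f(2) sink_word_closed by blast
qed

definition sink_gen :: "'a \<Rightarrow> ('a, 'b) bpath \<Rightarrow> 'k" where
  "sink_gen w = (\<lambda>p. of_bool (p = SinkPath [] w))"

lemma sink_gen_closed:
  assumes "w \<in> verts G" "out_arcs G w = {}"
  shows "sink_gen w \<in> carrier (chen_module K G (SinkPath [] w))"
proof -
  have "awalk w [] w" using assms(1) by (simp add: awalk_def)
  then have "SinkPath [] w \<in> tail_class G (SinkPath [] w)"
    using assms(2) by (auto simp: tail_class_def bpaths_def tail_equiv_def)
  then show ?thesis by (simp add: chen_simps sink_gen_def)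
qed

lemma free_act_sink_gen: "free_act G a (sink_gen w) p' = basis_act G a (SinkPath [] w) p'"
  by (subst free_act_superset[of "{SinkPath [] w}"]) (auto simp: sink_gen_def)

lemma free_act_sink_elt:
  assumes f: "f \<in> carrier (chen_module K G (SinkPath [] w))"
  shows "free_act G (sink_elt w f) (sink_gen w) = f"
proof
  fix p'
  have fin: "finite {p. f p \<noteq> 0}" and sub: "{p. f p \<noteq> 0} \<subseteq> tail_class G (SinkPath [] w)"
    using f by (simp_all add: chen_simps)
  have path: "sink_path w (sink_word w p) = p" if "f p \<noteq> 0" for p
    using sink_path_class subsetD[OF sub] that by blast
  have act: "word_act G (sink_word w p) (SinkPath [] w) = Some p" if "f p \<noteq> 0" for p
  proof -
    have "p \<in> tail_class G (SinkPath [] w)" using subsetD[OF sub] that by blast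
    then obtain \<alpha> u where "p = SinkPath \<alpha> w" "awalk u \<alpha> w" by (rule tail_class_sink)
    then show ?thesis using word_act_sink_word by blast
  qed
  have inj: "inj_on (sink_word w) {p. f p \<noteq> 0}"
    by (rule inj_on_inverseI[of _ "sink_path w"]) (use path in simp)
  have "free_act G (sink_elt w f) (sink_gen w) p' =
      (\<Sum>u\<in>sink_word w ` {p. f p \<noteq> 0}. sink_elt w f u * of_bool (word_act G u (SinkPath [] w) = Some p'))"
    unfolding free_act_sink_gen by (rule basis_act_superset[OF finite_imageI[OF fin] sink_elt_support[OF sub]])
  also have "\<dots> = (\<Sum>p | f p \<noteq> 0. if p = p' then f p else 0)"
    unfolding sum.reindex[OF inj] by (rule sum.cong) (auto simp: sink_elt_def path act)
  also have "\<dots> = f p'" using fin by (simp add: sum.delta')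
  finally show "free_act G (sink_elt w f) (sink_gen w) p' = f p'" .
qed

lemma wcls_word_act:
  assumes w: "w \<in> verts G" "out_arcs G w = {}" and u: "set u \<subseteq> lpa_gens G"
  shows "wcls (u @ [Vertex w]) =
    (case word_act G u (SinkPath [] w) of None \<Rightarrow> I | Some p' \<Rightarrow> wcls (sink_word w p'))"
  using u
proof (induction u)
  case Nil
  show ?case by (simp add: sink_word_def)
next
  case (Cons g u)
  have gens: "set u \<subseteq> lpa_gens G" "g \<in> lpa_gens G" "Vertex w \<in> lpa_gens G"
    using Cons.prems w by (auto simp: lpa_gens_iff)
  show ?case
  proof (cases "word_act G u (SinkPath [] w)")
    case None
    then have "wcls (u @ [Vertex w]) = I" using Cons.IH gens by simp
    then have "wcls ([g] @ (u @ [Vertex w]) @ []) = I" using gens by (intro wcls_zero) auto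
    then show ?thesis using None by simp
  next
    case (Some p)
    have "SinkPath [] w \<in> tail_class G (SinkPath [] w)"
      using sink_gen_closed[OF w] by (auto simp: chen_simps sink_gen_def)
    then have p: "p \<in> tail_class G (SinkPath [] w)"
      using word_act_closed[OF _ _ Some] gens by auto
    then obtain \<alpha> u' where \<alpha>: "p = SinkPath \<alpha> w" "awalk u' \<alpha> w" by (rule tail_class_sink)
    have "wcls ([g] @ (u @ [Vertex w]) @ []) = wcls ([g] @ sink_word w p @ [])"
      using Cons.IH gens Some sink_word_closed[OF p] by (intro wcls_cong) auto
    also have "\<dots> = (case gen_act G g p of None \<Rightarrow> I | Some p' \<Rightarrow> wcls (sink_word w p'))"
      using wcls_gen_act[OF gens(2) \<alpha>(2) w(2)] by (simp add: \<alpha>(1))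
    finally show ?thesis using Some by simp
  qed
qed

lemma cls_mult_sink:
  assumes w: "w \<in> verts G" "out_arcs G w = {}" and a: "a \<in> carrier F"
  shows "cls a \<otimes>\<^bsub>L\<^esub> wcls [Vertex w] = cls (sink_elt w (free_act G a (sink_gen w)))"
  using a
proof (induction rule: free_algebra_induct)
  interpret F: ring F by (rule ring_free_algebra)
  interpret L: ring L by (rule ring_lpa)
  have wc: "wcls [Vertex w] \<in> carrier L" using w by (intro wcls_closed) (simp add: lpa_gens_iff)
  note \<delta> = sink_gen_closed[OF w]
  have elt_zero: "sink_elt w (\<lambda>_. 0) = (\<lambda>_. 0)" by (simp add: sink_elt_def fun_eq_iff)
  {
    case zero
    show ?case unfolding free_act_zero_left elt_zero cls_zero
      using L.l_null[OF wc] by (simp add: lpa_simps(5))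
  next
    case (word k u)
    define c where "c = (\<lambda>x. k * word_elt ([] :: ('a, 'b) lpa_gen list) x)"
    have c: "c \<in> carrier F"
      unfolding c_def by (rule free_algebra_closedI[of "{[]}"]) (auto simp: word_elt_def)
    have cm: "c \<otimes>\<^bsub>F\<^esub> word_elt v = (\<lambda>x. k * word_elt v x)" if "set v \<subseteq> lpa_gens G" for v
    proof -
      have "c \<otimes>\<^bsub>F\<^esub> word_elt v = (\<lambda>x. k * (word_elt [] \<otimes>\<^bsub>F\<^esub> word_elt v) x)"
        by (simp add: c_def sum_distrib_left mult.assoc)
      then show ?thesis unfolding word_elt_mult by simp
    qed
    have word_closed: "word_elt v \<in> carrier F" if "set v \<subseteq> lpa_gens G" for v
      by (rule word_elt_closed) (use that in auto)
    have uw: "set (u @ [Vertex w]) \<subseteq> lpa_gens G" using word w by (auto simp: lpa_gens_iff)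
    have clsk: "cls (\<lambda>x. k * word_elt v x) = cls c \<otimes>\<^bsub>L\<^esub> wcls v" if "set v \<subseteq> lpa_gens G" for v
      using lpa_simps(2)[OF c word_closed[OF that]] cm[OF that] by simp
    have "cls (\<lambda>x. k * word_elt u x) \<otimes>\<^bsub>L\<^esub> wcls [Vertex w] = cls c \<otimes>\<^bsub>L\<^esub> wcls (u @ [Vertex w])"
      unfolding clsk[OF word]
      using L.m_assoc[OF cls_closed[OF c] wcls_closed[OF word] wc] wcls_append[OF word, of "[Vertex w]"] uw
      by simp
    also have "\<dots> = cls (sink_elt w (free_act G (\<lambda>x. k * word_elt u x) (sink_gen w)))"
    proof -
      have act: "free_act G (\<lambda>x. k * word_elt u x) (sink_gen w) =
          (\<lambda>p'. k * of_bool (word_act G u (SinkPath [] w) = Some p'))"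
      proof
        fix p'
        have "{x. k * word_elt u x \<noteq> 0} \<subseteq> {u}" by (auto simp: word_elt_def)
        then show "free_act G (\<lambda>x. k * word_elt u x) (sink_gen w) p' =
            k * of_bool (word_act G u (SinkPath [] w) = Some p')"
          unfolding free_act_sink_gen by (subst basis_act_superset[of "{u}"]) (auto simp: word_elt_def)
      qed
      show ?thesis
      proof (cases "word_act G u (SinkPath [] w)")
        case None
        then show ?thesis
          unfolding act wcls_word_act[OF w word]
          using L.r_null[OF cls_closed[OF c]] by (simp add: elt_zero cls_zero lpa_simps(5))
      next
        case (Some p)
        have "SinkPath [] w \<in> tail_class G (SinkPath [] w)"
          using \<delta> by (auto simp: chen_simps sink_gen_def)
        then have p: "p \<in> tail_class G (SinkPath [] w)"
          using word_act_closed[OF _ _ Some] word by auto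
        then have path: "sink_path w (sink_word w p) = p"
          by (rule sink_path_class)
        have "sink_elt w (\<lambda>p'. k * of_bool (p = p')) = (\<lambda>x. k * word_elt (sink_word w p) x)"
        proof
          fix x
          show "sink_elt w (\<lambda>p'. k * of_bool (p = p')) x = k * word_elt (sink_word w p) x"
          proof (cases "x = sink_word w p")
            case True
            then show ?thesis by (simp add: sink_elt_def word_elt_def path)
          next
            case False
            then show ?thesis by (auto simp: sink_elt_def word_elt_def)
          qed
        qed
        then show ?thesis
          unfolding act wcls_word_act[OF w word] Some using clsk[OF sink_word_closed[OF p]] by simp
      qed
    qed
    finally show ?case .
  next
    case (add a b)
    let ?f = "free_act G a (sink_gen w)" and ?g = "free_act G b (sink_gen w)"
    have fg: "?f \<in> carrier (chen_module K G (SinkPath [] w))" "?g \<in> carrier (chen_module K G (SinkPath [] w))"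
      using add \<delta> by (auto intro: free_act_closed simp del: free_algebra_simps)
    have fin: "finite {p. sink_gen w p \<noteq> (0 :: 'k)}" by (simp add: sink_gen_def)
    have "sink_elt w (\<lambda>p. ?f p + ?g p) = sink_elt w ?f \<oplus>\<^bsub>F\<^esub> sink_elt w ?g"
      by (simp add: sink_elt_def fun_eq_iff)
    then have "cls (sink_elt w (free_act G (\<lambda>x. a x + b x) (sink_gen w))) =
        cls (sink_elt w ?f) \<oplus>\<^bsub>L\<^esub> cls (sink_elt w ?g)"
      unfolding free_act_add_left[OF free_algebra_closedD(1)[OF add(1)] free_algebra_closedD(1)[OF add(2)] fin]
      using lpa_simps(3)[OF sink_elt_closed[OF fg(1)] sink_elt_closed[OF fg(2)]] by simp
    also have "\<dots> = (cls a \<oplus>\<^bsub>L\<^esub> cls b) \<otimes>\<^bsub>L\<^esub> wcls [Vertex w]"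
      using L.l_distr[OF cls_closed[OF add(1)] cls_closed[OF add(2)] wc] add(3,4) by simp
    also have "\<dots> = cls (\<lambda>x. a x + b x) \<otimes>\<^bsub>L\<^esub> wcls [Vertex w]"
      unfolding lpa_simps(3)[OF add(1,2)] by simp
    finally show ?case by simp
  }
qed

theorem chen_module_sink:
  assumes w: "w \<in> verts G" "out_arcs G w = {}"
  shows "\<exists>\<phi> \<in> module_hom L (left_ideal L (wcls [Vertex w])) (chen_module K G (SinkPath [] w)).
    bij_betw \<phi> (carrier (left_ideal L (wcls [Vertex w]))) (carrier (chen_module K G (SinkPath [] w)))"
proof -
  let ?V = "chen_module K G (SinkPath [] w)" and ?N = "left_ideal L (wcls [Vertex w])"
  interpret F: ring F by (rule ring_free_algebra)
  interpret L: ring L by (rule ring_lpa)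
  interpret V: left_module L ?V by (rule left_module_chen)
  have N: "carrier ?N = (\<lambda>X. X \<otimes>\<^bsub>L\<^esub> wcls [Vertex w]) ` carrier L"
    "\<And>x y. x \<oplus>\<^bsub>?N\<^esub> y = x \<oplus>\<^bsub>L\<^esub> y" "\<And>x y. x \<odot>\<^bsub>?N\<^esub> y = x \<otimes>\<^bsub>L\<^esub> y"
    by (simp_all add: left_ideal_def)
  note \<delta> = sink_gen_closed[OF w]
  have wg: "set [Vertex w] \<subseteq> lpa_gens G" using w by (simp add: lpa_gens_iff)
  have wc: "wcls [Vertex w] \<in> carrier L" by (rule wcls_closed[OF wg])
  have NL: "carrier ?N \<subseteq> carrier L" unfolding N using wc by blast
  have addN: "x \<oplus>\<^bsub>L\<^esub> y \<in> carrier ?N" if xy: "x \<in> carrier ?N" "y \<in> carrier ?N" for x y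
  proof -
    from xy obtain X Y where XY: "X \<in> carrier L" "Y \<in> carrier L"
      "x = X \<otimes>\<^bsub>L\<^esub> wcls [Vertex w]" "y = Y \<otimes>\<^bsub>L\<^esub> wcls [Vertex w]" unfolding N by blast
    show ?thesis
      unfolding N XY(3,4) L.l_distr[OF XY(1,2) wc, symmetric] by (rule imageI[OF L.a_closed[OF XY(1,2)]])
  qed
  have multN: "a \<otimes>\<^bsub>L\<^esub> x \<in> carrier ?N" if a: "a \<in> carrier L" and x: "x \<in> carrier ?N" for a x
  proof -
    from x obtain X where X: "X \<in> carrier L" "x = X \<otimes>\<^bsub>L\<^esub> wcls [Vertex w]" unfolding N by blast
    show ?thesis
      unfolding N X(2) L.m_assoc[OF a X(1) wc, symmetric] by (rule imageI[OF L.m_closed[OF a X(1)]])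
  qed
  have w\<delta>: "wcls [Vertex w] \<odot>\<^bsub>?V\<^esub> sink_gen w = sink_gen w"
  proof -
    have c: "word_elt [Vertex w] \<in> carrier F" by (rule word_elt_closed) (use wg in simp)
    show ?thesis
      unfolding chen_smult_cls[OF c \<delta>]
    proof
      fix p'
      show "free_act G (word_elt [Vertex w]) (sink_gen w) p' = sink_gen w p'"
        unfolding free_act_sink_gen basis_act_word_elt by (auto simp: sink_gen_def)
    qed
  qed
  define \<phi> where "\<phi> = (\<lambda>x \<in> carrier ?N. x \<odot>\<^bsub>?V\<^esub> sink_gen w)"
  have \<phi>_cls: "\<phi> (cls a \<otimes>\<^bsub>L\<^esub> wcls [Vertex w]) = free_act G a (sink_gen w)" if a: "a \<in> carrier F" for a
  proof -
    have "cls a \<otimes>\<^bsub>L\<^esub> wcls [Vertex w] \<in> carrier ?N" unfolding N using cls_closed[OF a] by blast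
    then have "\<phi> (cls a \<otimes>\<^bsub>L\<^esub> wcls [Vertex w]) = (cls a \<otimes>\<^bsub>L\<^esub> wcls [Vertex w]) \<odot>\<^bsub>?V\<^esub> sink_gen w"
      unfolding \<phi>_def by (rule restrict_apply')
    then show ?thesis
      unfolding V.smult_assoc1[OF cls_closed[OF a] wc \<delta>] w\<delta> chen_smult_cls[OF a \<delta>] .
  qed
  have rep: "\<exists>a \<in> carrier F. x = cls a \<otimes>\<^bsub>L\<^esub> wcls [Vertex w]" if "x \<in> carrier ?N" for x
  proof -
    from that obtain X where X: "X \<in> carrier L" "x = X \<otimes>\<^bsub>L\<^esub> wcls [Vertex w]" unfolding N by blast
    from X(1) obtain a where "a \<in> carrier F" "X = cls a" by (rule lpa_cases)
    with X(2) show ?thesis by blast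
  qed
  have hom: "\<phi> \<in> module_hom L ?N ?V"
    unfolding module_hom_def mem_Collect_eq
  proof (intro conjI ballI)
    show "\<phi> \<in> carrier ?N \<rightarrow>\<^sub>E carrier ?V"
      unfolding \<phi>_def using V.smult_closed[OF subsetD[OF NL] \<delta>] by (intro restrict_PiE_iff[THEN iffD2] ballI)
  next
    fix x y assume xy: "x \<in> carrier ?N" "y \<in> carrier ?N"
    show "\<phi> (x \<oplus>\<^bsub>?N\<^esub> y) = \<phi> x \<oplus>\<^bsub>?V\<^esub> \<phi> y"
      unfolding N(2) \<phi>_def restrict_apply'[OF addN[OF xy]] restrict_apply'[OF xy(1)] restrict_apply'[OF xy(2)]
      by (rule V.smult_l_distr[OF subsetD[OF NL xy(1)] subsetD[OF NL xy(2)] \<delta>])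
  next
    fix a x assume a: "a \<in> carrier L" and x: "x \<in> carrier ?N"
    show "\<phi> (a \<odot>\<^bsub>?N\<^esub> x) = a \<odot>\<^bsub>?V\<^esub> \<phi> x"
      unfolding N(3) \<phi>_def restrict_apply'[OF multN[OF a x]] restrict_apply'[OF x]
      by (rule V.smult_assoc1[OF a subsetD[OF NL x] \<delta>])
  qed
  have "bij_betw \<phi> (carrier ?N) (carrier ?V)"
  proof (rule bij_betw_imageI)
    have inv: "cls (sink_elt w (\<phi> x)) = x" if x: "x \<in> carrier ?N" for x
    proof -
      obtain a where a: "a \<in> carrier F" "x = cls a \<otimes>\<^bsub>L\<^esub> wcls [Vertex w]" using rep[OF x] by blast
      show ?thesis unfolding a(2) \<phi>_cls[OF a(1)] by (rule cls_mult_sink[OF w a(1), symmetric])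
    qed
    show "inj_on \<phi> (carrier ?N)" by (rule inj_on_inverseI[of _ "\<lambda>f. cls (sink_elt w f)"]) (rule inv)
    show "\<phi> ` carrier ?N = carrier ?V"
    proof (rule equalityI; rule subsetI)
      fix f assume "f \<in> \<phi> ` carrier ?N"
      then obtain x where "x \<in> carrier ?N" "f = \<phi> x" by blast
      then show "f \<in> carrier ?V" using hom unfolding module_hom_def by blast
    next
      fix f assume f: "f \<in> carrier ?V"
      have c: "sink_elt w f \<in> carrier F" by (rule sink_elt_closed[OF f])
      have "\<phi> (cls (sink_elt w f) \<otimes>\<^bsub>L\<^esub> wcls [Vertex w]) = f"
        unfolding \<phi>_cls[OF c] by (rule free_act_sink_elt[OF f])
      moreover have "cls (sink_elt w f) \<otimes>\<^bsub>L\<^esub> wcls [Vertex w] \<in> carrier ?N"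
        unfolding N using cls_closed[OF c] by blast
      ultimately show "f \<in> \<phi> ` carrier ?N" by (metis imageI)
    qed
  qed
  then show ?thesis using hom by blast
qed

end
end

declare free_algebra_simps [simp del]

end

theory Submission
  imports Defs
begin

text \<open>
  Write \<open>v\<close> for the source of \<open>d\<close>. The map \<open>Lv \<rightarrow> V\<^bsub>[d\<^sup>\<infinity>]\<^esub>\<close> sending \<open>a\<close> to \<open>a d\<^sup>\<infinity>\<close> is onto with kernel
  \<open>L(d - v)\<close>: modulo that left ideal every path ending at \<open>v\<close> is determined by the infinite path
  that \<open>d\<^sup>\<infinity>\<close> completes it to, because \<open>d\<close> is not a proper power. Right multiplication by \<open>d - v\<close> is
  injective on \<open>Lv\<close>, because \<open>c d = c\<close> forces \<open>c = 0\<close> in the \<open>\<int>\<close>-graded algebra \<open>L\<close>. Hence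
  \<open>Ext\<^sup>1(V\<^bsub>[d\<^sup>\<infinity>]\<^esub>, T)\<close> is \<open>vT / (d - v)vT\<close>. Prepending \<open>d\<close> splits the basis of \<open>vT\<close>
  into chains \<open>p, dp, d\<^sup>2p, \<dots>\<close> starting at the paths not divisible by \<open>d\<close>, plus the fixed point
  \<open>d\<^sup>\<infinity>\<close> if it lies in \<open>T\<close>; each of these contributes one dimension.
\<close>

section \<open>Quotient spaces and their dimension\<close>

text \<open>Ext is a quotient of a Hom space out of the syzygy of a free module on all of M, so no
  basis of it is exhibited by hand. Its dimension is read off from coordinate functionals, and these
  look only at the value of a homomorphism at a single syzygy: s = d - v placed on the basis vector
  indexed by \<open>d\<^sup>\<infinity>\<close>. The coordinates are the sums of coefficients along
  chains. They vanish on (d - v)vT because prepending d moves coefficients within a chain, and they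
  are the only obstruction because the difference of two members of a chain telescopes into (d -
  v)vT. L is given by generators and relations, and no normal form for its elements is constructed.
  The grading gets around this in the cancellation step: the relations are homogeneous, so
  homogeneous components make sense modulo the ideal. Both halves of the result come from one
  computation. In the class of \<open>d\<^sup>\<infinity>\<close> there is one more chain,
  consisting of a single path that is divisible by d and hence missing from the nondivisible
  ones.\<close>

lemma has_dimensionI:
  fixes V :: "('k::field, 'm) module"
  assumes V: "module class_ring V"
    and add: "\<And>x y j. x \<in> carrier V \<Longrightarrow> y \<in> carrier V \<Longrightarrow> j \<in> J \<Longrightarrow> \<Theta> (x \<oplus>\<^bsub>V\<^esub> y) j = \<Theta> x j + \<Theta> y j"
    and smult: "\<And>k x j. x \<in> carrier V \<Longrightarrow> j \<in> J \<Longrightarrow> \<Theta> (k \<odot>\<^bsub>V\<^esub> x) j = k * \<Theta> x j"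
    and finite_support: "\<And>x. x \<in> carrier V \<Longrightarrow> finite {j \<in> J. \<Theta> x j \<noteq> 0}"
    and inj: "\<And>x. x \<in> carrier V \<Longrightarrow> (\<And>j. j \<in> J \<Longrightarrow> \<Theta> x j = 0) \<Longrightarrow> x = \<zero>\<^bsub>V\<^esub>"
    and dual: "\<And>j. j \<in> J \<Longrightarrow> \<exists>x \<in> carrier V. \<forall>i \<in> J. \<Theta> x i = of_bool (i = j)"
  shows "has_dimension V |J|"
proof -
  interpret vectorspace class_ring V
    by (rule vectorspace.intro[OF V class_field])
  have zero: "\<Theta> \<zero>\<^bsub>V\<^esub> j = 0" if "j \<in> J" for j
    using smult[of "\<zero>\<^bsub>V\<^esub>" j 0] that by simp
  from dual obtain b where b: "\<And>j. j \<in> J \<Longrightarrow> b j \<in> carrier V"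
    "\<And>i j. i \<in> J \<Longrightarrow> j \<in> J \<Longrightarrow> \<Theta> (b j) i = of_bool (i = j)"
    by metis
  have \<Theta>_lincomb: "\<Theta> (lincomb a A) j = (\<Sum>x\<in>A. a x * \<Theta> x j)"
    if "finite A" "A \<subseteq> carrier V" "j \<in> J" for a A j
    using that
  proof (induction A)
    case empty
    then show ?case by (simp add: lincomb_def zero)
  next
    case (insert x A)
    have "lincomb a (insert x A) = a x \<odot>\<^bsub>V\<^esub> x \<oplus>\<^bsub>V\<^esub> lincomb a A"
      unfolding lincomb_def using insert.hyps insert.prems by (intro finsum_insert) auto
    moreover have "lincomb a A \<in> carrier V" "a x \<odot>\<^bsub>V\<^esub> x \<in> carrier V"
      using insert.prems by auto
    ultimately show ?case
      using insert by (simp add: add smult)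
  qed
  have inj_b: "inj_on b J"
  proof (rule inj_onI)
    fix i j assume ij: "i \<in> J" "j \<in> J" "b i = b j"
    then show "i = j" using b(2)[of i j] b(2)[of i i] by (simp split: if_splits)
  qed
  have bJ: "b ` J \<subseteq> carrier V" using b(1) by blast
  have \<Theta>_b: "(\<Sum>x\<in>b ` A. a x * \<Theta> x j) = (if j \<in> A then a (b j) else 0)"
    if "finite A" "A \<subseteq> J" "j \<in> J" for a A j
  proof -
    have "(\<Sum>x\<in>b ` A. a x * \<Theta> x j) = (\<Sum>i\<in>A. a (b i) * \<Theta> (b i) j)"
      by (subst sum.reindex[OF inj_on_subset[OF inj_b that(2)]]) simp
    also have "\<dots> = (\<Sum>i\<in>A. if i = j then a (b i) else 0)"
      using that b(2) by (intro sum.cong refl) auto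
    finally show ?thesis using that by simp
  qed
  have "lin_indpt (b ` J)"
  proof
    assume "lin_dep (b ` J)"
    then obtain A a x where A: "finite A" "A \<subseteq> b ` J" "lincomb a A = \<zero>\<^bsub>V\<^esub>" "x \<in> A" "a x \<noteq> 0"
      unfolding lin_dep_def by auto
    then obtain A' where A': "A' \<subseteq> J" "A = b ` A'" by (auto simp: subset_image_iff)
    then have fin: "finite A'" using A(1) inj_on_subset[OF inj_b] by (auto dest: finite_imageD)
    obtain j where j: "j \<in> A'" "x = b j" using A(4) A' by blast
    then have jJ: "j \<in> J" using A' by blast
    \<comment> \<open>Applying the coordinate j to the vanishing combination isolates the
      coefficient of \<open>b j\<close>.\<close>
    have "0 = \<Theta> (lincomb a A) j" unfolding A(3) using zero[OF jJ] by simp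
    also have "\<dots> = a x"
      using \<Theta>_lincomb[of A j a] \<Theta>_b[OF fin A'(1) jJ, of a] A A' bJ j jJ by auto
    finally show False using A(5) by simp
  qed
  moreover have "span (b ` J) = carrier V"
  proof
    show "span (b ` J) \<subseteq> carrier V" using bJ by (rule span_is_subset2)
    show "carrier V \<subseteq> span (b ` J)"
    proof
      fix x assume x: "x \<in> carrier V"
      define A where "A = {j \<in> J. \<Theta> x j \<noteq> 0}"
      \<comment> \<open>The coefficient of \<open>b j\<close> has to be the j-th coordinate of x;
        combinations are indexed by vectors rather than by J, hence the inverse of b.\<close>
      define a where "a = (\<lambda>y. \<Theta> x (the_inv_into J b y))"
      have A: "finite A" "A \<subseteq> J" using finite_support[OF x] by (auto simp: A_def)
      have bA: "finite (b ` A)" "b ` A \<subseteq> carrier V" using A b(1) by auto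
      define y where "y = lincomb a (b ` A)"
      have y: "y \<in> carrier V" unfolding y_def using bA by auto
      have \<Theta>y: "\<Theta> y j = \<Theta> x j" if "j \<in> J" for j
        unfolding y_def \<Theta>_lincomb[OF bA that] \<Theta>_b[OF A that]
        using that by (simp add: a_def the_inv_into_f_f[OF inj_b] A_def)
      \<comment> \<open>The difference has all coordinates zero, and coordinates separate
        points.\<close>
      have "x \<ominus>\<^bsub>V\<^esub> y = \<zero>\<^bsub>V\<^esub>"
      proof (rule inj)
        show "x \<ominus>\<^bsub>V\<^esub> y \<in> carrier V" using x y by simp
        fix j assume j: "j \<in> J"
        have "(x \<ominus>\<^bsub>V\<^esub> y) \<oplus>\<^bsub>V\<^esub> y = x" using x y by (simp add: minus_eq M.a_assoc M.l_neg)
        then have "\<Theta> x j = \<Theta> (x \<ominus>\<^bsub>V\<^esub> y) j + \<Theta> y j"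
          using add[of "x \<ominus>\<^bsub>V\<^esub> y" y j] x y j by simp
        then show "\<Theta> (x \<ominus>\<^bsub>V\<^esub> y) j = 0" using \<Theta>y[OF j] by simp
      qed
      then have "x = lincomb a (b ` A)" using x y by (simp add: y_def)
      then show "x \<in> span (b ` J)" unfolding span_def using A bA by (auto intro!: exI[of _ a] exI[of _ "b ` A"])
    qed
  qed
  ultimately have "basis (b ` J)" unfolding basis_def using bJ by blast
  moreover have "|b ` J| =o |J|"
    using inj_b card_of_ordIso bij_betw_imageI ordIso_symmetric by blast
  ultimately show ?thesis unfolding has_dimension_def using vectorspace_axioms by blast
qed

section \<open>Quotients of modules by submodules\<close>

locale quotient_space = submodule R N M
  for R :: "('k, 'r) ring_scheme" and N and M :: "('k, 'm) module" (structure)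
begin

sublocale module R M by (rule module)

sublocale abelian_subgroup N M
proof (rule abelian_subgroupI3[OF additive_subgroup.intro M.abelian_group_axioms])
  show "subgroup N (add_monoid M)"
  proof (rule group.subgroupI)
    show "Group.group (add_monoid M)" by (rule M.a_group)
    fix x assume x: "x \<in> N"
    have "\<ominus>\<^bsub>M\<^esub> x = (\<ominus>\<^bsub>R\<^esub> \<one>\<^bsub>R\<^esub>) \<odot>\<^bsub>M\<^esub> x" using x subset by (auto simp: smult_minus_1)
    then show "inv\<^bsub>add_monoid M\<^esub> x \<in> N" using x by (simp add: a_inv_def)
  next
    show "N \<noteq> {}" using submodule.zero_closed[OF submodule_axioms] by blast
  qed (use subset in auto)
qed

abbreviation "Q \<equiv> quotient_module M N"

lemma coset_cases:
  assumes "X \<in> carrier Q" obtains x where "x \<in> carrier M" "X = N +>\<^bsub>M\<^esub> x"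
  using assms unfolding quotient_module_simps A_RCOSETS_def' by blast

lemma coset_closed: "x \<in> carrier M \<Longrightarrow> N +>\<^bsub>M\<^esub> x \<in> carrier Q"
  unfolding quotient_module_simps A_RCOSETS_def' by blast

lemma coset_add:
  "x \<in> carrier M \<Longrightarrow> y \<in> carrier M \<Longrightarrow> (N +>\<^bsub>M\<^esub> x) \<oplus>\<^bsub>Q\<^esub> (N +>\<^bsub>M\<^esub> y) = N +>\<^bsub>M\<^esub> (x \<oplus>\<^bsub>M\<^esub> y)"
  unfolding quotient_module_simps by (rule a_rcos_sum)

text \<open>The scalar multiple in \<open>quotient_module\<close> is a union over all
  representatives; each of them yields the same coset, so the union collapses.\<close>

lemma coset_smult:
  assumes k: "k \<in> carrier R" and x: "x \<in> carrier M"
  shows "k \<odot>\<^bsub>Q\<^esub> (N +>\<^bsub>M\<^esub> x) = N +>\<^bsub>M\<^esub> (k \<odot>\<^bsub>M\<^esub> x)"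
proof -
  have "N +>\<^bsub>M\<^esub> (k \<odot>\<^bsub>M\<^esub> y) = N +>\<^bsub>M\<^esub> (k \<odot>\<^bsub>M\<^esub> x)" if y: "y \<in> N +>\<^bsub>M\<^esub> x" for y
  proof -
    from y obtain n where n: "n \<in> N" "y = n \<oplus>\<^bsub>M\<^esub> x" unfolding a_r_coset_def' by blast
    then have "k \<odot>\<^bsub>M\<^esub> y = k \<odot>\<^bsub>M\<^esub> n \<oplus>\<^bsub>M\<^esub> k \<odot>\<^bsub>M\<^esub> x" using k x subset by (auto intro: smult_r_distr)
    then have "k \<odot>\<^bsub>M\<^esub> y \<in> N +>\<^bsub>M\<^esub> (k \<odot>\<^bsub>M\<^esub> x)" unfolding a_r_coset_def' using k n by auto
    then show ?thesis by (rule M.a_repr_independence[OF _ smult_closed[OF k x] a_subgroup, symmetric])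
  qed
  then have "(\<Union>y\<in>N +>\<^bsub>M\<^esub> x. N +>\<^bsub>M\<^esub> (k \<odot>\<^bsub>M\<^esub> y)) = (\<Union>y\<in>N +>\<^bsub>M\<^esub> x. N +>\<^bsub>M\<^esub> (k \<odot>\<^bsub>M\<^esub> x))"
    by (rule SUP_cong[OF refl])
  also have "\<dots> = N +>\<^bsub>M\<^esub> (k \<odot>\<^bsub>M\<^esub> x)" using a_rcos_self[OF x] by blast
  finally show ?thesis unfolding quotient_module_simps .
qed

lemma module_quotient: "module R Q"
proof (rule moduleI[OF is_cring])
  show "abelian_group Q"
  proof (rule abelian_groupI)
    fix X assume "X \<in> carrier Q"
    then obtain x where x: "x \<in> carrier M" "X = N +>\<^bsub>M\<^esub> x" by (rule coset_cases)
    have Z: "\<zero>\<^bsub>Q\<^esub> = N +>\<^bsub>M\<^esub> \<zero>\<^bsub>M\<^esub>" unfolding quotient_module_simps using subset by simp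
    show "\<zero>\<^bsub>Q\<^esub> \<oplus>\<^bsub>Q\<^esub> X = X" unfolding Z x(2) using x(1) by (simp add: coset_add)
    show "\<exists>Y\<in>carrier Q. Y \<oplus>\<^bsub>Q\<^esub> X = \<zero>\<^bsub>Q\<^esub>"
      unfolding Z x(2) using x(1)
      by (intro bexI[of _ "N +>\<^bsub>M\<^esub> \<ominus>\<^bsub>M\<^esub> x"]) (simp_all add: coset_add M.l_neg coset_closed)
  next
    have "\<zero>\<^bsub>Q\<^esub> = N +>\<^bsub>M\<^esub> \<zero>\<^bsub>M\<^esub>" unfolding quotient_module_simps using subset by simp
    then show "\<zero>\<^bsub>Q\<^esub> \<in> carrier Q" by (simp add: coset_closed)
    next
    fix X Y assume "X \<in> carrier Q" "Y \<in> carrier Q"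
    then obtain x y where xy: "x \<in> carrier M" "X = N +>\<^bsub>M\<^esub> x" "y \<in> carrier M" "Y = N +>\<^bsub>M\<^esub> y"
      by (metis coset_cases)
    then show "X \<oplus>\<^bsub>Q\<^esub> Y \<in> carrier Q" "X \<oplus>\<^bsub>Q\<^esub> Y = Y \<oplus>\<^bsub>Q\<^esub> X"
      by (simp_all add: coset_add coset_closed M.a_comm)
    fix Z assume "Z \<in> carrier Q"
    then obtain z where "z \<in> carrier M" "Z = N +>\<^bsub>M\<^esub> z" by (rule coset_cases)
    with xy show "X \<oplus>\<^bsub>Q\<^esub> Y \<oplus>\<^bsub>Q\<^esub> Z = X \<oplus>\<^bsub>Q\<^esub> (Y \<oplus>\<^bsub>Q\<^esub> Z)"
      by (simp add: coset_add M.a_assoc)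
  qed
next
  fix a X assume a: "a \<in> carrier R" and X: "X \<in> carrier Q"
  obtain x where x: "x \<in> carrier M" "X = N +>\<^bsub>M\<^esub> x" using X by (rule coset_cases)
  show "a \<odot>\<^bsub>Q\<^esub> X \<in> carrier Q" using a x by (simp add: coset_smult coset_closed)
  fix b assume b: "b \<in> carrier R"
  show "(a \<oplus>\<^bsub>R\<^esub> b) \<odot>\<^bsub>Q\<^esub> X = a \<odot>\<^bsub>Q\<^esub> X \<oplus>\<^bsub>Q\<^esub> b \<odot>\<^bsub>Q\<^esub> X"
    "(a \<otimes>\<^bsub>R\<^esub> b) \<odot>\<^bsub>Q\<^esub> X = a \<odot>\<^bsub>Q\<^esub> (b \<odot>\<^bsub>Q\<^esub> X)"
    using a b x by (simp_all add: coset_smult coset_add smult_l_distr smult_assoc1)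
next
  fix a X Y assume a: "a \<in> carrier R" and X: "X \<in> carrier Q" and Y: "Y \<in> carrier Q"
  obtain x where x: "x \<in> carrier M" "X = N +>\<^bsub>M\<^esub> x" using X by (rule coset_cases)
  obtain y where y: "y \<in> carrier M" "Y = N +>\<^bsub>M\<^esub> y" using Y by (rule coset_cases)
  show "a \<odot>\<^bsub>Q\<^esub> (X \<oplus>\<^bsub>Q\<^esub> Y) = a \<odot>\<^bsub>Q\<^esub> X \<oplus>\<^bsub>Q\<^esub> a \<odot>\<^bsub>Q\<^esub> Y"
    using a x y by (simp add: coset_smult coset_add smult_r_distr)
next
  fix X assume X: "X \<in> carrier Q"
  then obtain x where x: "x \<in> carrier M" "X = N +>\<^bsub>M\<^esub> x" by (rule coset_cases)
  show "\<one>\<^bsub>R\<^esub> \<odot>\<^bsub>Q\<^esub> X = X" using x by (simp add: coset_smult)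
qed

end

text \<open>Coordinates whose common kernel is exactly S descend to the quotient and separate its
  points. The basis is then the image of the dual vectors.\<close>

lemma has_dimension_quotientI:
  fixes H :: "('k::field, 'm) module"
  assumes S: "submodule class_ring S H"
    and add: "\<And>x y j. x \<in> carrier H \<Longrightarrow> y \<in> carrier H \<Longrightarrow> j \<in> J \<Longrightarrow> \<Theta> (x \<oplus>\<^bsub>H\<^esub> y) j = \<Theta> x j + \<Theta> y j"
    and smult: "\<And>k x j. x \<in> carrier H \<Longrightarrow> j \<in> J \<Longrightarrow> \<Theta> (k \<odot>\<^bsub>H\<^esub> x) j = k * \<Theta> x j"
    and finite_support: "\<And>x. x \<in> carrier H \<Longrightarrow> finite {j \<in> J. \<Theta> x j \<noteq> 0}"
    and kernel: "\<And>x. x \<in> carrier H \<Longrightarrow> x \<in> S \<longleftrightarrow> (\<forall>j \<in> J. \<Theta> x j = 0)"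
    and dual: "\<And>j. j \<in> J \<Longrightarrow> \<exists>x \<in> carrier H. \<forall>i \<in> J. \<Theta> x i = of_bool (i = j)"
  shows "has_dimension (quotient_module H S) |J|"
proof -
  interpret quotient_space class_ring S H
    by (rule quotient_space.intro[OF S])
  \<comment> \<open>An arbitrary representative serves, since two of them differ by an element of S,
    where every coordinate vanishes.\<close>
  define \<Psi> where "\<Psi> X = \<Theta> (SOME x. x \<in> X)" for X
  have \<Psi>: "\<Psi> (S +>\<^bsub>H\<^esub> x) j = \<Theta> x j" if x: "x \<in> carrier H" and j: "j \<in> J" for x j
  proof -
    have "(SOME y. y \<in> S +>\<^bsub>H\<^esub> x) \<in> S +>\<^bsub>H\<^esub> x"
      using a_rcos_self[OF x] by (rule someI[of "\<lambda>y. y \<in> S +>\<^bsub>H\<^esub> x"])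
    then obtain s where s: "s \<in> S" "(SOME y. y \<in> S +>\<^bsub>H\<^esub> x) = s \<oplus>\<^bsub>H\<^esub> x"
      unfolding a_r_coset_def' by blast
    then have "s \<in> carrier H" using subset by blast
    moreover from this have "\<Theta> s j = 0" using s(1) kernel j by blast
    ultimately show ?thesis unfolding \<Psi>_def s(2) using add[of s x j] x j by simp
  qed
  show ?thesis
  proof (rule has_dimensionI[where \<Theta> = \<Psi>, OF module_quotient])
    fix X j assume X: "X \<in> carrier Q" and j: "j \<in> J"
    obtain x where x: "x \<in> carrier H" "X = S +>\<^bsub>H\<^esub> x" using X by (rule coset_cases)
    show "\<Psi> (k \<odot>\<^bsub>Q\<^esub> X) j = k * \<Psi> X j" for k
      unfolding x(2) using x(1) j by (simp add: coset_smult \<Psi> smult)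
    fix Y assume Y: "Y \<in> carrier Q"
    obtain y where y: "y \<in> carrier H" "Y = S +>\<^bsub>H\<^esub> y" using Y by (rule coset_cases)
    show "\<Psi> (X \<oplus>\<^bsub>Q\<^esub> Y) j = \<Psi> X j + \<Psi> Y j"
      unfolding x(2) y(2) using x(1) y(1) j by (simp add: coset_add \<Psi> add)
  next
    fix X assume X: "X \<in> carrier Q"
    obtain x where x: "x \<in> carrier H" "X = S +>\<^bsub>H\<^esub> x" using X by (rule coset_cases)
    have "{j \<in> J. \<Psi> X j \<noteq> 0} = {j \<in> J. \<Theta> x j \<noteq> 0}" unfolding x(2) using \<Psi>[OF x(1)] by auto
    then show "finite {j \<in> J. \<Psi> X j \<noteq> 0}" using finite_support[OF x(1)] by simp
    assume "\<And>j. j \<in> J \<Longrightarrow> \<Psi> X j = 0"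
    then have "x \<in> S" using kernel[OF x(1)] \<Psi>[OF x(1)] x(2) by auto
    then show "X = \<zero>\<^bsub>Q\<^esub>"
      unfolding x(2) quotient_module_simps using x(1) M.a_coset_join2 a_subgroup by blast
  next
    fix j assume "j \<in> J"
    then obtain x where "x \<in> carrier H" "\<forall>i\<in>J. \<Theta> x i = of_bool (i = j)" using dual by blast
    then show "\<exists>X\<in>carrier Q. \<forall>i\<in>J. \<Psi> X i = of_bool (i = j)"
      using \<Psi> coset_closed by (intro bexI[of _ "S +>\<^bsub>H\<^esub> x"]) auto
  qed
qed

section \<open>Extensions of a cyclic module\<close>

context left_module
begin

lemma smult_zero_right: "a \<in> carrier R \<Longrightarrow> a \<odot>\<^bsub>M\<^esub> \<zero>\<^bsub>M\<^esub> = \<zero>\<^bsub>M\<^esub>"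
  using smult_r_distr[of a "\<zero>\<^bsub>M\<^esub>" "\<zero>\<^bsub>M\<^esub>"] smult_closed[of a "\<zero>\<^bsub>M\<^esub>"]
  by (metis M.add.r_cancel_one M.zero_closed M.l_zero)

lemma smult_zero_left: "x \<in> carrier M \<Longrightarrow> \<zero>\<^bsub>R\<^esub> \<odot>\<^bsub>M\<^esub> x = \<zero>\<^bsub>M\<^esub>"
  using smult_l_distr[of "\<zero>\<^bsub>R\<^esub>" "\<zero>\<^bsub>R\<^esub>" x] smult_closed[of "\<zero>\<^bsub>R\<^esub>" x]
  by (metis M.add.r_cancel_one R.zero_closed R.l_zero)

lemma smult_minus_left:
  assumes "a \<in> carrier R" "x \<in> carrier M"
  shows "(\<ominus>\<^bsub>R\<^esub> a) \<odot>\<^bsub>M\<^esub> x = \<ominus>\<^bsub>M\<^esub> (a \<odot>\<^bsub>M\<^esub> x)"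
  using assms smult_l_distr[of "\<ominus>\<^bsub>R\<^esub> a" a x] smult_closed
  by (metis M.minus_equality R.a_inv_closed R.l_neg smult_zero_left)

lemma smult_diff_left:
  assumes "a \<in> carrier R" "b \<in> carrier R" "x \<in> carrier M"
  shows "(a \<ominus>\<^bsub>R\<^esub> b) \<odot>\<^bsub>M\<^esub> x = a \<odot>\<^bsub>M\<^esub> x \<ominus>\<^bsub>M\<^esub> b \<odot>\<^bsub>M\<^esub> x"
  using assms by (simp add: R.minus_eq M.minus_eq smult_l_distr smult_minus_left)

end

section \<open>Free modules and their universal property\<close>

definition free_lift ::
    "('a, 'r) ring_scheme \<Rightarrow> ('a, 'n, 'x) module_scheme \<Rightarrow> 's set \<Rightarrow> ('s \<Rightarrow> 'n) \<Rightarrow> ('s \<Rightarrow> 'a) \<Rightarrow> 'n" where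
  "free_lift R N S g f = (\<Oplus>\<^bsub>N\<^esub> s \<in> {s \<in> S. f s \<noteq> \<zero>\<^bsub>R\<^esub>}. f s \<odot>\<^bsub>N\<^esub> g s)"

definition free_single :: "('a, 'r) ring_scheme \<Rightarrow> 's set \<Rightarrow> 's \<Rightarrow> 'a \<Rightarrow> 's \<Rightarrow> 'a" where
  "free_single R S t a = (\<lambda>s \<in> S. if s = t then a else \<zero>\<^bsub>R\<^esub>)"

lemma free_module_simps:
  "carrier (free_module R S) = {f \<in> S \<rightarrow>\<^sub>E carrier R. finite {s \<in> S. f s \<noteq> \<zero>\<^bsub>R\<^esub>}}"
  "\<zero>\<^bsub>free_module R S\<^esub> = (\<lambda>s \<in> S. \<zero>\<^bsub>R\<^esub>)"
  "f \<oplus>\<^bsub>free_module R S\<^esub> g = (\<lambda>s \<in> S. f s \<oplus>\<^bsub>R\<^esub> g s)"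
  "a \<odot>\<^bsub>free_module R S\<^esub> f = (\<lambda>s \<in> S. a \<otimes>\<^bsub>R\<^esub> f s)"
  by (simp_all add: free_module_def)

context ring
begin

lemma free_moduleD:
  assumes "f \<in> carrier (free_module R S)"
  shows "finite {s \<in> S. f s \<noteq> \<zero>}" "s \<in> S \<Longrightarrow> f s \<in> carrier R" "f \<in> extensional S"
  using assms by (auto simp: free_module_simps PiE_iff)

lemma free_moduleI:
  assumes "\<And>s. s \<in> S \<Longrightarrow> f s \<in> carrier R" "f \<in> extensional S" "finite T" "\<And>s. s \<in> S \<Longrightarrow> s \<notin> T \<Longrightarrow> f s = \<zero>"
  shows "f \<in> carrier (free_module R S)"
proof -
  have "{s \<in> S. f s \<noteq> \<zero>} \<subseteq> T" using assms(4) by blast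
  then have "finite {s \<in> S. f s \<noteq> \<zero>}" using assms(3) by (rule finite_subset)
  then show ?thesis using assms(1,2) by (auto simp: free_module_simps PiE_iff)
qed

lemma left_module_free: "left_module R (free_module R S)" (is "left_module R ?F")
proof (intro left_module.intro left_module_axioms.intro ring_axioms)
  have closed: "f \<oplus>\<^bsub>?F\<^esub> g \<in> carrier ?F" if fg: "f \<in> carrier ?F" "g \<in> carrier ?F" for f g
  proof (rule free_moduleI)
    show "finite ({s \<in> S. f s \<noteq> \<zero>} \<union> {s \<in> S. g s \<noteq> \<zero>})"
      using free_moduleD(1)[OF fg(1)] free_moduleD(1)[OF fg(2)] by simp
  qed (use free_moduleD(2)[OF fg(1)] free_moduleD(2)[OF fg(2)] in \<open>auto simp: free_module_simps\<close>)
  have scaled: "(\<lambda>s \<in> S. a \<otimes> f s) \<in> carrier ?F" if a: "a \<in> carrier R" and f: "f \<in> carrier ?F" for a f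
    by (rule free_moduleI[OF _ _ free_moduleD(1)[OF f]]) (use a free_moduleD(2)[OF f] in auto)
  show "abelian_group ?F"
  proof (rule abelian_groupI)
    show "\<zero>\<^bsub>?F\<^esub> \<in> carrier ?F"
      by (rule free_moduleI[of _ _ "{}"]) (auto simp: free_module_simps)
  next
    fix f assume f: "f \<in> carrier ?F"
    show "\<zero>\<^bsub>?F\<^esub> \<oplus>\<^bsub>?F\<^esub> f = f"
      using free_moduleD(2,3)[OF f] by (auto simp: free_module_simps fun_eq_iff extensional_def)
    have "(\<lambda>s \<in> S. (\<ominus> \<one>) \<otimes> f s) \<oplus>\<^bsub>?F\<^esub> f = \<zero>\<^bsub>?F\<^esub>"
      using free_moduleD(2)[OF f] by (auto simp: free_module_simps fun_eq_iff l_minus l_neg)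
    then show "\<exists>g\<in>carrier ?F. g \<oplus>\<^bsub>?F\<^esub> f = \<zero>\<^bsub>?F\<^esub>" using scaled[OF _ f, of "\<ominus> \<one>"] by auto
  next
    fix f g assume fg: "f \<in> carrier ?F" "g \<in> carrier ?F"
    show "f \<oplus>\<^bsub>?F\<^esub> g \<in> carrier ?F" by (rule closed[OF fg])
    show "f \<oplus>\<^bsub>?F\<^esub> g = g \<oplus>\<^bsub>?F\<^esub> f"
      using free_moduleD(2)[OF fg(1)] free_moduleD(2)[OF fg(2)]
      by (auto simp: free_module_simps fun_eq_iff a_comm)
    fix h assume h: "h \<in> carrier ?F"
    show "f \<oplus>\<^bsub>?F\<^esub> g \<oplus>\<^bsub>?F\<^esub> h = f \<oplus>\<^bsub>?F\<^esub> (g \<oplus>\<^bsub>?F\<^esub> h)"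
      using free_moduleD(2)[OF fg(1)] free_moduleD(2)[OF fg(2)] free_moduleD(2)[OF h]
      by (auto simp: free_module_simps fun_eq_iff a_assoc)
  qed
  fix a f assume a: "a \<in> carrier R" and f: "f \<in> carrier ?F"
  note fD = free_moduleD(2)[OF f]
  show "a \<odot>\<^bsub>?F\<^esub> f \<in> carrier ?F" unfolding free_module_simps(4) by (rule scaled[OF a f])
  {
    fix g assume g: "g \<in> carrier ?F"
    show "a \<odot>\<^bsub>?F\<^esub> (f \<oplus>\<^bsub>?F\<^esub> g) = a \<odot>\<^bsub>?F\<^esub> f \<oplus>\<^bsub>?F\<^esub> a \<odot>\<^bsub>?F\<^esub> g"
      using a fD free_moduleD(2)[OF g] by (auto simp: free_module_simps fun_eq_iff r_distr)
  }
  fix b assume b: "b \<in> carrier R"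
  show "(a \<oplus> b) \<odot>\<^bsub>?F\<^esub> f = a \<odot>\<^bsub>?F\<^esub> f \<oplus>\<^bsub>?F\<^esub> b \<odot>\<^bsub>?F\<^esub> f"
    "(a \<otimes> b) \<odot>\<^bsub>?F\<^esub> f = a \<odot>\<^bsub>?F\<^esub> (b \<odot>\<^bsub>?F\<^esub> f)"
    using a b fD by (auto simp: free_module_simps fun_eq_iff l_distr m_assoc)
next
  fix f assume f: "f \<in> carrier ?F"
  show "\<one> \<odot>\<^bsub>?F\<^esub> f = f"
    using free_moduleD(2,3)[OF f] by (auto simp: free_module_simps fun_eq_iff extensional_def)
qed

lemma free_single_closed: "t \<in> S \<Longrightarrow> a \<in> carrier R \<Longrightarrow> free_single R S t a \<in> carrier (free_module R S)"
  by (rule free_moduleI[of _ _ "{t}"]) (auto simp: free_single_def)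

lemma free_single_add:
  "a \<in> carrier R \<Longrightarrow> b \<in> carrier R \<Longrightarrow>
    free_single R S t (a \<oplus> b) = free_single R S t a \<oplus>\<^bsub>free_module R S\<^esub> free_single R S t b"
  by (auto simp: free_single_def free_module_simps fun_eq_iff)

lemma free_single_smult:
  "a \<in> carrier R \<Longrightarrow> b \<in> carrier R \<Longrightarrow>
    free_single R S t (a \<otimes> b) = a \<odot>\<^bsub>free_module R S\<^esub> free_single R S t b"
  by (auto simp: free_single_def free_module_simps fun_eq_iff)

text \<open>The ring as a left module over itself, so that lifts from a free module can take values
  in the ring (see \<open>aug_lift\<close>).\<close>

lemma left_module_regular: "left_module R (left_ideal R \<one>)" "carrier (left_ideal R \<one>) = carrier R"
proof -
  show c: "carrier (left_ideal R \<one>) = carrier R" by (simp add: left_ideal_def image_def set_eq_iff)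
  have simps: "add (left_ideal R \<one>) = add R" "\<zero>\<^bsub>left_ideal R \<one>\<^esub> = \<zero>"
    "smult (left_ideal R \<one>) = mult R" by (simp_all add: left_ideal_def)
  show "left_module R (left_ideal R \<one>)"
  proof (intro left_module.intro left_module_axioms.intro ring_axioms)
    show "abelian_group (left_ideal R \<one>)"
      by (rule abelian_groupI) (auto simp: c simps a_ac intro: bexI[of _ "\<ominus> _"] l_neg)
  qed (simp_all add: c simps l_distr r_distr m_assoc)
qed

end

context left_module
begin

text \<open>The sum in \<open>free_lift\<close> runs over the support of f, which changes under
  addition and scaling. Padding with zero terms brings different elements to a common index
  set.\<close>

lemma free_lift_superset:
  assumes f: "f \<in> carrier (free_module R S)" and g: "g \<in> S \<rightarrow> carrier M"
    and T: "finite T" "{s \<in> S. f s \<noteq> \<zero>\<^bsub>R\<^esub>} \<subseteq> T" "T \<subseteq> S"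
  shows "free_lift R M S g f = (\<Oplus>\<^bsub>M\<^esub> s \<in> T. f s \<odot>\<^bsub>M\<^esub> g s)"
  unfolding free_lift_def
proof (rule M.add.finprod_mono_neutral_cong_left[OF T(1,2)])
  show "(\<lambda>s. f s \<odot>\<^bsub>M\<^esub> g s) \<in> T \<rightarrow> carrier M"
    using T g R.free_moduleD(2)[OF f] by (auto intro!: smult_closed)
  show "f s \<odot>\<^bsub>M\<^esub> g s = \<zero>\<^bsub>M\<^esub>" if "s \<in> T - {s \<in> S. f s \<noteq> \<zero>\<^bsub>R\<^esub>}" for s
    using that T g by (auto intro!: smult_zero_left)
qed simp

lemma free_lift_closed:
  assumes "f \<in> carrier (free_module R S)" "g \<in> S \<rightarrow> carrier M"
  shows "free_lift R M S g f \<in> carrier M"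
  unfolding free_lift_def using assms R.free_moduleD(2)[OF assms(1)]
  by (auto intro!: M.finsum_closed smult_closed)

lemma free_lift_add:
  assumes f: "f \<in> carrier (free_module R S)" and f': "f' \<in> carrier (free_module R S)"
    and g: "g \<in> S \<rightarrow> carrier M"
  shows "free_lift R M S g (f \<oplus>\<^bsub>free_module R S\<^esub> f') = free_lift R M S g f \<oplus>\<^bsub>M\<^esub> free_lift R M S g f'"
proof -
  interpret F: left_module R "free_module R S" by (rule R.left_module_free)
  let ?T = "{s \<in> S. f s \<noteq> \<zero>\<^bsub>R\<^esub>} \<union> {s \<in> S. f' s \<noteq> \<zero>\<^bsub>R\<^esub>}"
  have T: "finite ?T" "?T \<subseteq> S" using R.free_moduleD(1)[OF f] R.free_moduleD(1)[OF f'] by auto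
  note fD = R.free_moduleD(2)[OF f] R.free_moduleD(2)[OF f']
  have "free_lift R M S g (f \<oplus>\<^bsub>free_module R S\<^esub> f') =
      (\<Oplus>\<^bsub>M\<^esub> s \<in> ?T. (f \<oplus>\<^bsub>free_module R S\<^esub> f') s \<odot>\<^bsub>M\<^esub> g s)"
    by (rule free_lift_superset[OF F.a_closed[OF f f'] g T(1) _ T(2)]) (auto simp: free_module_simps)
  also have "\<dots> = (\<Oplus>\<^bsub>M\<^esub> s \<in> ?T. f s \<odot>\<^bsub>M\<^esub> g s \<oplus>\<^bsub>M\<^esub> f' s \<odot>\<^bsub>M\<^esub> g s)"
    using fD g by (intro M.finsum_cong') (auto simp: free_module_simps smult_l_distr smult_closed Pi_iff)
  also have "\<dots> = (\<Oplus>\<^bsub>M\<^esub> s \<in> ?T. f s \<odot>\<^bsub>M\<^esub> g s) \<oplus>\<^bsub>M\<^esub> (\<Oplus>\<^bsub>M\<^esub> s \<in> ?T. f' s \<odot>\<^bsub>M\<^esub> g s)"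
    using fD g by (intro M.finsum_addf) (auto intro!: smult_closed)
  also have "(\<Oplus>\<^bsub>M\<^esub> s \<in> ?T. f s \<odot>\<^bsub>M\<^esub> g s) = free_lift R M S g f"
    by (rule free_lift_superset[OF f g T(1) _ T(2), symmetric]) auto
  also have "(\<Oplus>\<^bsub>M\<^esub> s \<in> ?T. f' s \<odot>\<^bsub>M\<^esub> g s) = free_lift R M S g f'"
    by (rule free_lift_superset[OF f' g T(1) _ T(2), symmetric]) auto
  finally show ?thesis .
qed

lemma finsum_smult_left:
  assumes "finite T" "a \<in> carrier R" "h \<in> T \<rightarrow> carrier M"
  shows "a \<odot>\<^bsub>M\<^esub> (\<Oplus>\<^bsub>M\<^esub> s \<in> T. h s) = (\<Oplus>\<^bsub>M\<^esub> s \<in> T. a \<odot>\<^bsub>M\<^esub> h s)"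
  using assms
proof (induction T)
  case empty
  then show ?case by (simp add: smult_zero_right)
next
  case (insert t T)
  then show ?case by (simp add: Pi_iff smult_r_distr smult_closed)
qed

lemma free_lift_smult:
  assumes f: "f \<in> carrier (free_module R S)" and a: "a \<in> carrier R" and g: "g \<in> S \<rightarrow> carrier M"
  shows "free_lift R M S g (a \<odot>\<^bsub>free_module R S\<^esub> f) = a \<odot>\<^bsub>M\<^esub> free_lift R M S g f"
proof -
  interpret F: left_module R "free_module R S" by (rule R.left_module_free)
  let ?T = "{s \<in> S. f s \<noteq> \<zero>\<^bsub>R\<^esub>}"
  have T: "finite ?T" "?T \<subseteq> S" using R.free_moduleD(1)[OF f] by auto
  note fD = R.free_moduleD(2)[OF f]
  have "free_lift R M S g (a \<odot>\<^bsub>free_module R S\<^esub> f) =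
      (\<Oplus>\<^bsub>M\<^esub> s \<in> ?T. (a \<odot>\<^bsub>free_module R S\<^esub> f) s \<odot>\<^bsub>M\<^esub> g s)"
    by (rule free_lift_superset[OF F.smult_closed[OF a f] g T(1) _ T(2)])
      (use a in \<open>auto simp: free_module_simps\<close>)
  also have "\<dots> = (\<Oplus>\<^bsub>M\<^esub> s \<in> ?T. a \<odot>\<^bsub>M\<^esub> (f s \<odot>\<^bsub>M\<^esub> g s))"
    using fD g a by (intro M.finsum_cong') (auto simp: free_module_simps smult_assoc1 smult_closed Pi_iff)
  also have "\<dots> = a \<odot>\<^bsub>M\<^esub> free_lift R M S g f"
    unfolding free_lift_def using fD g a T
    by (intro finsum_smult_left[symmetric]) (auto intro!: smult_closed)
  finally show ?thesis .
qed

lemma free_lift_single: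
  assumes a: "a \<in> carrier R" and t: "t \<in> S" and g: "g \<in> S \<rightarrow> carrier M"
  shows "free_lift R M S g (free_single R S t a) = a \<odot>\<^bsub>M\<^esub> g t"
proof -
  have "g t \<in> carrier M" using t g by blast
  moreover have "free_lift R M S g (free_single R S t a) = (\<Oplus>\<^bsub>M\<^esub> s \<in> {t}. free_single R S t a s \<odot>\<^bsub>M\<^esub> g s)"
    by (rule free_lift_superset[OF R.free_single_closed[OF t a] g])
      (use t in \<open>auto simp: free_single_def\<close>)
  ultimately show ?thesis using a t by (simp add: free_single_def smult_closed)
qed

text \<open>Naturality of the lift. Linearity of \<phi> is assumed pointwise instead of through
  \<open>module_hom\<close>, whose members are extensional, so that right multiplication and
  evaluation can be used directly for \<phi>.\<close>

lemma free_lift_hom: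
  assumes N: "left_module R N" and f: "f \<in> carrier (free_module R S)" and g: "g \<in> S \<rightarrow> carrier M"
    and closed: "\<And>x. x \<in> carrier M \<Longrightarrow> \<phi> x \<in> carrier N"
    and add: "\<And>x y. x \<in> carrier M \<Longrightarrow> y \<in> carrier M \<Longrightarrow> \<phi> (x \<oplus>\<^bsub>M\<^esub> y) = \<phi> x \<oplus>\<^bsub>N\<^esub> \<phi> y"
    and smult: "\<And>a x. a \<in> carrier R \<Longrightarrow> x \<in> carrier M \<Longrightarrow> \<phi> (a \<odot>\<^bsub>M\<^esub> x) = a \<odot>\<^bsub>N\<^esub> \<phi> x"
  shows "\<phi> (free_lift R M S g f) = free_lift R N S (\<lambda>s. \<phi> (g s)) f"
proof -
  interpret N: left_module R N by (rule N)
  have zero: "\<phi> \<zero>\<^bsub>M\<^esub> = \<zero>\<^bsub>N\<^esub>"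
    using smult[of "\<zero>\<^bsub>R\<^esub>" "\<zero>\<^bsub>M\<^esub>"] by (simp add: smult_zero_left N.smult_zero_left closed)
  have "\<phi> (\<Oplus>\<^bsub>M\<^esub> s \<in> T. f s \<odot>\<^bsub>M\<^esub> g s) = (\<Oplus>\<^bsub>N\<^esub> s \<in> T. f s \<odot>\<^bsub>N\<^esub> \<phi> (g s))"
    if "finite T" "T \<subseteq> S" for T
    using that
  proof (induction T)
    case empty
    then show ?case using zero by simp
  next
    case (insert t T)
    have "f s \<in> carrier R" "g s \<in> carrier M" if "s \<in> S" for s
      using that R.free_moduleD(2)[OF f] g by auto
    then show ?case using insert
      by (subst M.finsum_insert, simp, simp, fastforce intro: smult_closed, fastforce intro: smult_closed,
          subst N.finsum_insert, simp, simp, fastforce intro: N.smult_closed closed,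
          fastforce intro: N.smult_closed closed)
        (subst add, auto simp: smult subset_iff intro!: smult_closed M.finsum_closed)
  qed
  then show ?thesis unfolding free_lift_def using R.free_moduleD(1)[OF f] by auto
qed

end

section \<open>The syzygy in the canonical free presentation\<close>

locale syzygy_module = left_module R M
  for R :: "('a, 'r) ring_scheme" and M :: "('a, 'm) module" (structure)
begin

lemma augmentation_eq: "augmentation R M = free_lift R M (carrier M) (\<lambda>m. m)"
  by (simp add: augmentation_def free_lift_def fun_eq_iff)

lemma syzygy_simps:
  "carrier (syzygy R M) = {f \<in> carrier (free_module R (carrier M)). augmentation R M f = \<zero>\<^bsub>M\<^esub>}"
  "\<zero>\<^bsub>syzygy R M\<^esub> = \<zero>\<^bsub>free_module R (carrier M)\<^esub>"
  "f \<oplus>\<^bsub>syzygy R M\<^esub> g = f \<oplus>\<^bsub>free_module R (carrier M)\<^esub> g"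
  "a \<odot>\<^bsub>syzygy R M\<^esub> f = a \<odot>\<^bsub>free_module R (carrier M)\<^esub> f"
  by (simp_all add: syzygy_def)

lemma left_module_syzygy: "left_module R (syzygy R M)"
proof (intro left_module.intro left_module_axioms.intro R.ring_axioms)
  interpret F: left_module R "free_module R (carrier M)" by (rule R.left_module_free)
  have id: "(\<lambda>m. m) \<in> carrier M \<rightarrow> carrier M" by simp
  have smult: "a \<odot>\<^bsub>free_module R (carrier M)\<^esub> x \<in> carrier (syzygy R M)"
    if "a \<in> carrier R" "x \<in> carrier (syzygy R M)" for a x
    using that by (simp add: syzygy_simps augmentation_eq F.smult_closed free_lift_smult[OF _ _ id] smult_zero_right)
  have zero: "\<zero>\<^bsub>free_module R (carrier M)\<^esub> \<in> carrier (syzygy R M)"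
    using free_lift_smult[OF F.zero_closed R.zero_closed id] free_lift_closed[OF F.zero_closed id]
    by (simp add: syzygy_simps augmentation_eq F.smult_zero_left smult_zero_left)
  show "abelian_group (syzygy R M)"
  proof (rule abelian_groupI)
    fix x assume x: "x \<in> carrier (syzygy R M)"
    have "(\<ominus>\<^bsub>R\<^esub> \<one>\<^bsub>R\<^esub>) \<odot>\<^bsub>free_module R (carrier M)\<^esub> x \<oplus>\<^bsub>free_module R (carrier M)\<^esub> x = \<zero>\<^bsub>free_module R (carrier M)\<^esub>"
      using x by (simp add: syzygy_simps F.smult_minus_left F.smult_one F.l_neg)
    then show "\<exists>y\<in>carrier (syzygy R M). y \<oplus>\<^bsub>syzygy R M\<^esub> x = \<zero>\<^bsub>syzygy R M\<^esub>"
      using smult[OF _ x, of "\<ominus>\<^bsub>R\<^esub> \<one>\<^bsub>R\<^esub>"] by (auto simp: syzygy_simps)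
  qed (use zero in \<open>auto simp: syzygy_simps augmentation_eq free_lift_add[OF _ _ id] F.a_ac\<close>)
  show "a \<odot>\<^bsub>syzygy R M\<^esub> x \<in> carrier (syzygy R M)"
    if "a \<in> carrier R" "x \<in> carrier (syzygy R M)" for a x
    using smult[OF that] by (simp add: syzygy_simps)
qed (auto simp: syzygy_simps R.left_module_free[THEN left_module.smult_l_distr]
  R.left_module_free[THEN left_module.smult_r_distr] R.left_module_free[THEN left_module.smult_assoc1]
  R.left_module_free[THEN left_module.smult_one])

end

section \<open>Spaces of homomorphisms over an algebra\<close>

locale hom_algebra = P: left_module A P + N: left_module A N
  for A :: "('k::field, 'a) module" and P :: "('a, 'p) module" and N :: "('a, 'n) module" +
  assumes scalar_closed: "k \<odot>\<^bsub>A\<^esub> \<one>\<^bsub>A\<^esub> \<in> carrier A"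
    and scalar_central: "a \<in> carrier A \<Longrightarrow> (k \<odot>\<^bsub>A\<^esub> \<one>\<^bsub>A\<^esub>) \<otimes>\<^bsub>A\<^esub> a = a \<otimes>\<^bsub>A\<^esub> (k \<odot>\<^bsub>A\<^esub> \<one>\<^bsub>A\<^esub>)"
    and scalar_add: "(k + l) \<odot>\<^bsub>A\<^esub> \<one>\<^bsub>A\<^esub> = k \<odot>\<^bsub>A\<^esub> \<one>\<^bsub>A\<^esub> \<oplus>\<^bsub>A\<^esub> l \<odot>\<^bsub>A\<^esub> \<one>\<^bsub>A\<^esub>"
    and scalar_mult: "(k * l) \<odot>\<^bsub>A\<^esub> \<one>\<^bsub>A\<^esub> = (k \<odot>\<^bsub>A\<^esub> \<one>\<^bsub>A\<^esub>) \<otimes>\<^bsub>A\<^esub> (l \<odot>\<^bsub>A\<^esub> \<one>\<^bsub>A\<^esub>)"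
    and scalar_one: "1 \<odot>\<^bsub>A\<^esub> \<one>\<^bsub>A\<^esub> = \<one>\<^bsub>A\<^esub>"
begin

abbreviation (input) "sc k \<equiv> k \<odot>\<^bsub>A\<^esub> \<one>\<^bsub>A\<^esub>"

lemma scalar_zero: "sc 0 = \<zero>\<^bsub>A\<^esub>"
  using scalar_add[of 0 0] scalar_closed[of 0]
  by (metis P.R.add.r_cancel_one P.R.zero_closed P.R.l_zero add.right_neutral)

lemma hom_homD:
  assumes "f \<in> module_hom A P N"
  shows "x \<in> carrier P \<Longrightarrow> f x \<in> carrier N" "f \<in> extensional (carrier P)"
    "x \<in> carrier P \<Longrightarrow> y \<in> carrier P \<Longrightarrow> f (x \<oplus>\<^bsub>P\<^esub> y) = f x \<oplus>\<^bsub>N\<^esub> f y"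
    "a \<in> carrier A \<Longrightarrow> x \<in> carrier P \<Longrightarrow> f (a \<odot>\<^bsub>P\<^esub> x) = a \<odot>\<^bsub>N\<^esub> f x"
  using assms by (auto simp: module_hom_def PiE_iff)

lemma module_homI:
  assumes "\<And>x. x \<in> carrier P \<Longrightarrow> f x \<in> carrier N"
    "\<And>x y. x \<in> carrier P \<Longrightarrow> y \<in> carrier P \<Longrightarrow> f (x \<oplus>\<^bsub>P\<^esub> y) = f x \<oplus>\<^bsub>N\<^esub> f y"
    "\<And>a x. a \<in> carrier A \<Longrightarrow> x \<in> carrier P \<Longrightarrow> f (a \<odot>\<^bsub>P\<^esub> x) = a \<odot>\<^bsub>N\<^esub> f x"
  shows "restrict f (carrier P) \<in> module_hom A P N"
  using assms by (auto simp: module_hom_def P.smult_closed)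

lemma Hom_simps:
  "carrier (Hom_space A P N) = module_hom A P N"
  "\<zero>\<^bsub>Hom_space A P N\<^esub> = (\<lambda>x \<in> carrier P. \<zero>\<^bsub>N\<^esub>)"
  "f \<oplus>\<^bsub>Hom_space A P N\<^esub> g = (\<lambda>x \<in> carrier P. f x \<oplus>\<^bsub>N\<^esub> g x)"
  "k \<odot>\<^bsub>Hom_space A P N\<^esub> f = (\<lambda>x \<in> carrier P. sc k \<odot>\<^bsub>N\<^esub> f x)"
  by (simp_all add: Hom_space_def)

text \<open>This is where centrality of \<open>sc k\<close> enters; it keeps scalar multiples of
  A-linear maps A-linear.\<close>

lemma sc_commute:
  assumes "a \<in> carrier A" "y \<in> carrier N"
  shows "sc k \<odot>\<^bsub>N\<^esub> (a \<odot>\<^bsub>N\<^esub> y) = a \<odot>\<^bsub>N\<^esub> (sc k \<odot>\<^bsub>N\<^esub> y)"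
  using assms by (simp add: N.smult_assoc1[symmetric] scalar_closed scalar_central)

lemma Hom_eqI:
  assumes "f \<in> extensional (carrier P)" "g \<in> extensional (carrier P)" "\<And>x. x \<in> carrier P \<Longrightarrow> f x = g x"
  shows "f = g"
  using assms by (rule extensionalityI)

lemma Hom_add_closed:
  assumes "f \<in> module_hom A P N" "g \<in> module_hom A P N"
  shows "f \<oplus>\<^bsub>Hom_space A P N\<^esub> g \<in> module_hom A P N"
  unfolding Hom_simps using assms
  by (intro module_homI) (simp_all add: hom_homD N.a_ac N.smult_r_distr P.smult_closed N.smult_closed)

lemma Hom_smult_closed:
  assumes "f \<in> module_hom A P N"
  shows "k \<odot>\<^bsub>Hom_space A P N\<^esub> f \<in> module_hom A P N"
  unfolding Hom_simps using assms
  by (intro module_homI)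
    (simp_all add: hom_homD N.smult_r_distr P.smult_closed N.smult_closed scalar_closed sc_commute)

lemma Hom_zero_closed: "\<zero>\<^bsub>Hom_space A P N\<^esub> \<in> module_hom A P N"
  unfolding Hom_simps by (intro module_homI) (simp_all add: N.smult_zero_right)

lemma module_Hom: "module class_ring (Hom_space A P N)" (is "module _ ?H")
proof (rule moduleI[OF domain.axioms(1)[OF field.axioms(1)[OF class_field]]])
  note simps = Hom_simps hom_homD(1) N.smult_closed scalar_closed
  show "abelian_group ?H"
  proof (rule abelian_groupI)
    fix f assume f: "f \<in> carrier ?H"
    then have f': "f \<in> module_hom A P N" by (simp add: Hom_simps)
    show "\<zero>\<^bsub>?H\<^esub> \<oplus>\<^bsub>?H\<^esub> f = f"
      by (rule Hom_eqI) (simp_all add: simps hom_homD(2) f')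
    have "(- 1) \<odot>\<^bsub>?H\<^esub> f \<oplus>\<^bsub>?H\<^esub> f = \<zero>\<^bsub>?H\<^esub>"
    proof (rule Hom_eqI)
      fix x assume x: "x \<in> carrier P"
      have "sc (- 1) \<odot>\<^bsub>N\<^esub> f x \<oplus>\<^bsub>N\<^esub> f x = (sc (- 1) \<oplus>\<^bsub>A\<^esub> sc 1) \<odot>\<^bsub>N\<^esub> f x"
        using hom_homD(1)[OF f' x]
        by (simp add: N.smult_l_distr scalar_closed scalar_one N.smult_one)
      also have "\<dots> = \<zero>\<^bsub>N\<^esub>"
        using hom_homD(1)[OF f' x] by (simp flip: scalar_add add: scalar_zero N.smult_zero_left)
      finally show "((- 1) \<odot>\<^bsub>?H\<^esub> f \<oplus>\<^bsub>?H\<^esub> f) x = \<zero>\<^bsub>?H\<^esub> x" using x by (simp add: simps)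
    qed (simp_all add: Hom_simps)
    then show "\<exists>g\<in>carrier ?H. g \<oplus>\<^bsub>?H\<^esub> f = \<zero>\<^bsub>?H\<^esub>"
      using Hom_smult_closed[OF f', of "- 1"] by (auto simp: Hom_simps(1))
  next
    fix f g assume "f \<in> carrier ?H" "g \<in> carrier ?H"
    then have fg: "f \<in> module_hom A P N" "g \<in> module_hom A P N" by (simp_all add: Hom_simps)
    show "f \<oplus>\<^bsub>?H\<^esub> g \<in> carrier ?H" using Hom_add_closed[OF fg] by (simp add: Hom_simps)
    show "f \<oplus>\<^bsub>?H\<^esub> g = g \<oplus>\<^bsub>?H\<^esub> f"
      by (rule Hom_eqI) (simp_all add: simps hom_homD(2) fg N.a_comm)
    fix h assume "h \<in> carrier ?H"
    then have h: "h \<in> module_hom A P N" by (simp add: Hom_simps)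
    show "f \<oplus>\<^bsub>?H\<^esub> g \<oplus>\<^bsub>?H\<^esub> h = f \<oplus>\<^bsub>?H\<^esub> (g \<oplus>\<^bsub>?H\<^esub> h)"
      by (rule Hom_eqI) (simp_all add: simps hom_homD(2) fg h N.a_assoc)
  next
    show "\<zero>\<^bsub>?H\<^esub> \<in> carrier ?H" using Hom_zero_closed by (simp add: Hom_simps)
  qed
next
  fix k f assume "f \<in> carrier ?H"
  then have f: "f \<in> module_hom A P N" by (simp add: Hom_simps)
  show "k \<odot>\<^bsub>?H\<^esub> f \<in> carrier ?H" using Hom_smult_closed[OF f] by (simp add: Hom_simps)
  fix l
  show "(k \<oplus>\<^bsub>class_ring\<^esub> l) \<odot>\<^bsub>?H\<^esub> f = k \<odot>\<^bsub>?H\<^esub> f \<oplus>\<^bsub>?H\<^esub> l \<odot>\<^bsub>?H\<^esub> f"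
  proof (rule Hom_eqI)
    fix x assume x: "x \<in> carrier P"
    show "((k \<oplus>\<^bsub>class_ring\<^esub> l) \<odot>\<^bsub>?H\<^esub> f) x = (k \<odot>\<^bsub>?H\<^esub> f \<oplus>\<^bsub>?H\<^esub> l \<odot>\<^bsub>?H\<^esub> f) x"
      using x hom_homD(1)[OF f x] by (simp add: Hom_simps scalar_add scalar_closed N.smult_l_distr)
  qed (simp_all add: Hom_simps)
  show "(k \<otimes>\<^bsub>class_ring\<^esub> l) \<odot>\<^bsub>?H\<^esub> f = k \<odot>\<^bsub>?H\<^esub> (l \<odot>\<^bsub>?H\<^esub> f)"
  proof (rule Hom_eqI)
    fix x assume x: "x \<in> carrier P"
    show "((k \<otimes>\<^bsub>class_ring\<^esub> l) \<odot>\<^bsub>?H\<^esub> f) x = (k \<odot>\<^bsub>?H\<^esub> (l \<odot>\<^bsub>?H\<^esub> f)) x"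
      using x hom_homD(1)[OF f x] by (simp add: Hom_simps scalar_mult scalar_closed N.smult_assoc1)
  qed (simp_all add: Hom_simps)
next
  fix k f g assume "f \<in> carrier ?H" "g \<in> carrier ?H"
  then have fg: "f \<in> module_hom A P N" "g \<in> module_hom A P N" by (simp_all add: Hom_simps)
  show "k \<odot>\<^bsub>?H\<^esub> (f \<oplus>\<^bsub>?H\<^esub> g) = k \<odot>\<^bsub>?H\<^esub> f \<oplus>\<^bsub>?H\<^esub> k \<odot>\<^bsub>?H\<^esub> g"
    by (rule Hom_eqI) (simp_all add: Hom_simps hom_homD(1) scalar_closed fg N.smult_r_distr)
next
  fix f assume "f \<in> carrier ?H"
  then have f: "f \<in> module_hom A P N" by (simp add: Hom_simps)
  show "\<one>\<^bsub>class_ring\<^esub> \<odot>\<^bsub>?H\<^esub> f = f"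
    by (rule Hom_eqI) (simp_all add: Hom_simps hom_homD(1,2) f scalar_one N.smult_one)
qed

end

text \<open>
  The assumptions say that \<open>0 \<rightarrow> Av \<rightarrow> Av \<rightarrow> M \<rightarrow> 0\<close>, with right multiplication by \<open>s\<close> and
  evaluation at \<open>m\<^sub>0\<close>, is a projective resolution of \<open>M\<close>; hence \<open>Ext\<^sup>1(M, N)\<close> is \<open>vN / s(vN)\<close>.
\<close>

locale cyclic_resolution = hom_algebra A M N
  for A :: "('k::field, 'a) module" and M :: "('a, 'm) module" and N :: "('a, 'n) module" +
  fixes m\<^sub>0 v s
  assumes m\<^sub>0: "m\<^sub>0 \<in> carrier M" and v: "v \<in> carrier A" and s: "s \<in> carrier A"
    and generated: "m \<in> carrier M \<Longrightarrow> \<exists>a \<in> carrier A. a \<odot>\<^bsub>M\<^esub> m\<^sub>0 = m"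
    and vv: "v \<otimes>\<^bsub>A\<^esub> v = v" and sv: "s \<otimes>\<^bsub>A\<^esub> v = s" and vs: "v \<otimes>\<^bsub>A\<^esub> s = s"
    and v_m\<^sub>0: "v \<odot>\<^bsub>M\<^esub> m\<^sub>0 = m\<^sub>0" and s_m\<^sub>0: "s \<odot>\<^bsub>M\<^esub> m\<^sub>0 = \<zero>\<^bsub>M\<^esub>"
    and annihilator: "a \<in> carrier A \<Longrightarrow> a \<otimes>\<^bsub>A\<^esub> v = a \<Longrightarrow> a \<odot>\<^bsub>M\<^esub> m\<^sub>0 = \<zero>\<^bsub>M\<^esub> \<Longrightarrow>
      \<exists>c \<in> carrier A. a = c \<otimes>\<^bsub>A\<^esub> s"
    and cancel: "a \<in> carrier A \<Longrightarrow> a \<otimes>\<^bsub>A\<^esub> v = a \<Longrightarrow> a \<otimes>\<^bsub>A\<^esub> s = \<zero>\<^bsub>A\<^esub> \<Longrightarrow> a = \<zero>\<^bsub>A\<^esub>"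
begin

sublocale syzygy_module A M ..

abbreviation "Fr \<equiv> free_module A (carrier M)"
abbreviation "Sy \<equiv> syzygy A M"
abbreviation "\<epsilon> \<equiv> free_single A (carrier M) m\<^sub>0"

sublocale Fr: left_module A Fr by (rule P.R.left_module_free)
sublocale Sy: left_module A Sy by (rule left_module_syzygy)
sublocale FrN: hom_algebra A Fr N
  by unfold_locales (fact scalar_closed scalar_central scalar_add scalar_mult scalar_one)+
sublocale SyN: hom_algebra A Sy N
  by unfold_locales (fact scalar_closed scalar_central scalar_add scalar_mult scalar_one)+

text \<open>
  Since \<open>a \<mapsto> a m\<^sub>0\<close> is onto, the augmentation of the free module on \<open>M\<close> factors through it; \<open>aug_lift\<close>
  is such a factorization, with values in \<open>Av\<close>. It replaces a comparison of resolutions.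
\<close>

definition section_coeff :: "'m \<Rightarrow> 'a" where
  "section_coeff m = (SOME a. a \<in> carrier A \<and> a \<otimes>\<^bsub>A\<^esub> v = a \<and> a \<odot>\<^bsub>M\<^esub> m\<^sub>0 = m \<and> (m = m\<^sub>0 \<longrightarrow> a = v))"

definition aug_lift :: "('m \<Rightarrow> 'a) \<Rightarrow> 'a" where
  "aug_lift = free_lift A (left_ideal A \<one>\<^bsub>A\<^esub>) (carrier M) section_coeff"

text \<open>The normalization at \<open>m\<^sub>0\<close> makes \<open>aug_lift\<close> send
  \<open>\<epsilon> a\<close> to av, and in particular the syzygy \<open>\<epsilon> s\<close> to
  s.\<close>

lemma section_coeff:
  assumes m: "m \<in> carrier M"
  shows "section_coeff m \<in> carrier A" "section_coeff m \<otimes>\<^bsub>A\<^esub> v = section_coeff m" "section_coeff m \<odot>\<^bsub>M\<^esub> m\<^sub>0 = m" "m = m\<^sub>0 \<Longrightarrow> section_coeff m = v"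
proof -
  have "\<exists>a. a \<in> carrier A \<and> a \<otimes>\<^bsub>A\<^esub> v = a \<and> a \<odot>\<^bsub>M\<^esub> m\<^sub>0 = m \<and> (m = m\<^sub>0 \<longrightarrow> a = v)"
  proof (cases "m = m\<^sub>0")
    case True
    then show ?thesis using v vv v_m\<^sub>0 by blast
  next
    case False
    obtain a where "a \<in> carrier A" "a \<odot>\<^bsub>M\<^esub> m\<^sub>0 = m" using generated[OF m] by blast
    \<comment> \<open>Right multiplication by v moves the coefficient into Av and keeps its value at
      \<open>m\<^sub>0\<close>, which v fixes.\<close>
    then have "a \<otimes>\<^bsub>A\<^esub> v \<in> carrier A \<and> (a \<otimes>\<^bsub>A\<^esub> v) \<otimes>\<^bsub>A\<^esub> v = a \<otimes>\<^bsub>A\<^esub> v \<and> (a \<otimes>\<^bsub>A\<^esub> v) \<odot>\<^bsub>M\<^esub> m\<^sub>0 = m"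
      using v m\<^sub>0 by (simp add: P.R.m_assoc vv P.smult_assoc1 v_m\<^sub>0)
    then show ?thesis using False by blast
  qed
  from someI_ex[OF this] show "section_coeff m \<in> carrier A" "section_coeff m \<otimes>\<^bsub>A\<^esub> v = section_coeff m" "section_coeff m \<odot>\<^bsub>M\<^esub> m\<^sub>0 = m"
    "m = m\<^sub>0 \<Longrightarrow> section_coeff m = v"
    unfolding section_coeff_def by blast+
qed

text \<open>The second and third claims push a linear map, right multiplication by v and evaluation
  at \<open>m\<^sub>0\<close>, through the lift and compare on basis elements. Together they put the
  lift of a syzygy into Av and into the annihilator of \<open>m\<^sub>0\<close>, hence into
  As.\<close>

lemma aug_lift:
  shows "x \<in> carrier Fr \<Longrightarrow> aug_lift x \<in> carrier A" "x \<in> carrier Fr \<Longrightarrow> aug_lift x \<otimes>\<^bsub>A\<^esub> v = aug_lift x"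
    "x \<in> carrier Fr \<Longrightarrow> aug_lift x \<odot>\<^bsub>M\<^esub> m\<^sub>0 = augmentation A M x"
    "x \<in> carrier Fr \<Longrightarrow> y \<in> carrier Fr \<Longrightarrow> aug_lift (x \<oplus>\<^bsub>Fr\<^esub> y) = aug_lift x \<oplus>\<^bsub>A\<^esub> aug_lift y"
    "a \<in> carrier A \<Longrightarrow> x \<in> carrier Fr \<Longrightarrow> aug_lift (a \<odot>\<^bsub>Fr\<^esub> x) = a \<otimes>\<^bsub>A\<^esub> aug_lift x"
    "a \<in> carrier A \<Longrightarrow> aug_lift (\<epsilon> a) = a \<otimes>\<^bsub>A\<^esub> v"
proof -
  interpret A: left_module A "left_ideal A \<one>\<^bsub>A\<^esub>" by (rule P.R.left_module_regular)
  note cA = P.R.left_module_regular(2)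
  have A_simps: "z \<oplus>\<^bsub>left_ideal A \<one>\<^bsub>A\<^esub>\<^esub> w = z \<oplus>\<^bsub>A\<^esub> w" "z \<odot>\<^bsub>left_ideal A \<one>\<^bsub>A\<^esub>\<^esub> w = z \<otimes>\<^bsub>A\<^esub> w" for z w
    by (simp_all add: left_ideal_def)
  have section_coeff': "section_coeff \<in> carrier M \<rightarrow> carrier (left_ideal A \<one>\<^bsub>A\<^esub>)" using section_coeff(1) by (simp add: cA)
  have cong: "free_lift A X (carrier M) g x = free_lift A X (carrier M) g' x"
    if "\<And>m. m \<in> carrier M \<Longrightarrow> g m = g' m" "left_module A X" "g' \<in> carrier M \<rightarrow> carrier X" "x \<in> carrier Fr"
    for X :: "('a, 'x) module" and g g' x
  proof -
    interpret X: left_module A X by fact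
    show ?thesis unfolding free_lift_def
      by (rule X.finsum_cong') (use that P.R.free_moduleD(2)[OF that(4)] in \<open>auto intro!: X.smult_closed\<close>)
  qed
  show "aug_lift x \<in> carrier A" if "x \<in> carrier Fr"
    using A.free_lift_closed[OF that section_coeff'] by (simp add: aug_lift_def cA)
  show "aug_lift x \<otimes>\<^bsub>A\<^esub> v = aug_lift x" if x: "x \<in> carrier Fr"
  proof -
    have "aug_lift x \<otimes>\<^bsub>A\<^esub> v = free_lift A (left_ideal A \<one>\<^bsub>A\<^esub>) (carrier M) (\<lambda>m. section_coeff m \<otimes>\<^bsub>A\<^esub> v) x"
      unfolding aug_lift_def using v
      by (intro A.free_lift_hom[OF A.left_module_axioms x section_coeff'])
        (simp_all add: cA A_simps P.R.l_distr P.R.m_assoc)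
    also have "\<dots> = aug_lift x"
      unfolding aug_lift_def by (rule cong[OF _ A.left_module_axioms section_coeff' x]) (simp add: section_coeff(2))
    finally show ?thesis .
  qed
  show "aug_lift x \<odot>\<^bsub>M\<^esub> m\<^sub>0 = augmentation A M x" if x: "x \<in> carrier Fr"
  proof -
    have "aug_lift x \<odot>\<^bsub>M\<^esub> m\<^sub>0 = free_lift A M (carrier M) (\<lambda>m. section_coeff m \<odot>\<^bsub>M\<^esub> m\<^sub>0) x"
      unfolding aug_lift_def using m\<^sub>0
      by (intro A.free_lift_hom[OF P.left_module_axioms x section_coeff'])
        (simp_all add: cA A_simps P.smult_closed P.smult_l_distr P.smult_assoc1)
    also have "\<dots> = augmentation A M x"
      unfolding augmentation_eq by (rule cong[OF _ P.left_module_axioms _ x]) (simp_all add: section_coeff(3))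
    finally show ?thesis .
  qed
  show "aug_lift (x \<oplus>\<^bsub>Fr\<^esub> y) = aug_lift x \<oplus>\<^bsub>A\<^esub> aug_lift y" if "x \<in> carrier Fr" "y \<in> carrier Fr"
    using A.free_lift_add[OF that section_coeff'] by (simp add: aug_lift_def A_simps)
  show "aug_lift (a \<odot>\<^bsub>Fr\<^esub> x) = a \<otimes>\<^bsub>A\<^esub> aug_lift x" if "a \<in> carrier A" "x \<in> carrier Fr"
    using A.free_lift_smult[OF that(2,1) section_coeff'] by (simp add: aug_lift_def A_simps)
  show "aug_lift (\<epsilon> a) = a \<otimes>\<^bsub>A\<^esub> v" if "a \<in> carrier A"
    using A.free_lift_single[OF that m\<^sub>0 section_coeff'] by (simp add: aug_lift_def A_simps section_coeff(4)[OF m\<^sub>0])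
qed

lemma \<epsilon>_closed: "a \<in> carrier A \<Longrightarrow> \<epsilon> a \<in> carrier Fr"
  by (rule P.R.free_single_closed[OF m\<^sub>0])

lemma augmentation_\<epsilon>: "a \<in> carrier A \<Longrightarrow> augmentation A M (\<epsilon> a) = a \<odot>\<^bsub>M\<^esub> m\<^sub>0"
  unfolding augmentation_eq by (rule P.free_lift_single[OF _ m\<^sub>0]) simp_all

lemma \<epsilon>_s_closed: "\<epsilon> s \<in> carrier Sy"
  unfolding syzygy_simps using \<epsilon>_closed[OF s] augmentation_\<epsilon>[OF s] s_m\<^sub>0 by simp

text \<open>On a syzygy x the lift has the form cs with c in Av. Division by s is unambiguous on Av
  by \<open>cancel\<close>, so c depends linearly on x, and sending x to cn is the required
  homomorphism.\<close>

lemma syzygy_hom_exists: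
  assumes n: "n \<in> carrier N" "v \<odot>\<^bsub>N\<^esub> n = n"
  shows "\<exists>h \<in> module_hom A Sy N. h (\<epsilon> s) = n"
proof -
  have "\<exists>c. c \<in> carrier A \<and> c \<otimes>\<^bsub>A\<^esub> v = c \<and> aug_lift x = c \<otimes>\<^bsub>A\<^esub> s" if x: "x \<in> carrier Sy" for x
  proof -
    have x': "x \<in> carrier Fr" "augmentation A M x = \<zero>\<^bsub>M\<^esub>" using x by (auto simp: syzygy_simps)
    obtain c where c: "c \<in> carrier A" "aug_lift x = c \<otimes>\<^bsub>A\<^esub> s"
      using annihilator[OF aug_lift(1)[OF x'(1)] aug_lift(2)[OF x'(1)]] aug_lift(3)[OF x'(1)] x'(2) by auto
    \<comment> \<open>Replacing c by cv puts it into Av without changing the product, because vs =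
      s.\<close>
    then show ?thesis
      using v s by (intro exI[of _ "c \<otimes>\<^bsub>A\<^esub> v"]) (simp add: P.R.m_assoc vv vs)
  qed
  then obtain c where c: "\<And>x. x \<in> carrier Sy \<Longrightarrow> c x \<in> carrier A"
    "\<And>x. x \<in> carrier Sy \<Longrightarrow> c x \<otimes>\<^bsub>A\<^esub> v = c x" "\<And>x. x \<in> carrier Sy \<Longrightarrow> aug_lift x = c x \<otimes>\<^bsub>A\<^esub> s" by metis
  \<comment> \<open>This uniqueness turns each linearity property of \<open>aug_lift\<close> into
    one of c.\<close>
  have unique: "a = a'" if a: "a \<in> carrier A" "a \<otimes>\<^bsub>A\<^esub> v = a" "a' \<in> carrier A" "a' \<otimes>\<^bsub>A\<^esub> v = a'" "a \<otimes>\<^bsub>A\<^esub> s = a' \<otimes>\<^bsub>A\<^esub> s" for a a'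
  proof -
    have "a \<ominus>\<^bsub>A\<^esub> a' = \<zero>\<^bsub>A\<^esub>"
      by (rule cancel)
        (use a v s in \<open>simp_all add: P.R.minus_eq P.R.l_distr P.R.l_minus P.R.r_neg\<close>)
    then show ?thesis using a by simp
  qed
  have SyFr: "x \<in> carrier Fr" if "x \<in> carrier Sy" for x using that by (simp add: syzygy_simps)
  define h where "h = (\<lambda>x \<in> carrier Sy. c x \<odot>\<^bsub>N\<^esub> n)"
  have "h \<in> module_hom A Sy N"
    unfolding h_def
  proof (rule SyN.module_homI)
    fix x assume x: "x \<in> carrier Sy"
    show "c x \<odot>\<^bsub>N\<^esub> n \<in> carrier N" using x c n by (simp add: N.smult_closed)
    {
      fix y assume y: "y \<in> carrier Sy"
      have "c (x \<oplus>\<^bsub>Sy\<^esub> y) = c x \<oplus>\<^bsub>A\<^esub> c y"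
        by (rule unique)
          (use x y c v s Sy.a_closed[OF x y] aug_lift(4)[OF SyFr[OF x] SyFr[OF y]] in
            \<open>simp_all add: P.R.l_distr flip: c(3) syzygy_simps(3)\<close>)
      then show "c (x \<oplus>\<^bsub>Sy\<^esub> y) \<odot>\<^bsub>N\<^esub> n = c x \<odot>\<^bsub>N\<^esub> n \<oplus>\<^bsub>N\<^esub> c y \<odot>\<^bsub>N\<^esub> n"
        using x y c n by (simp add: N.smult_l_distr)
    }
    fix a assume a: "a \<in> carrier A"
    have "c (a \<odot>\<^bsub>Sy\<^esub> x) = a \<otimes>\<^bsub>A\<^esub> c x"
      by (rule unique)
        (use x a c v s Sy.smult_closed[OF a x] aug_lift(5)[OF a SyFr[OF x]] in
          \<open>simp_all add: P.R.m_assoc flip: c(3) syzygy_simps(4)\<close>)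
    then show "c (a \<odot>\<^bsub>Sy\<^esub> x) \<odot>\<^bsub>N\<^esub> n = a \<odot>\<^bsub>N\<^esub> (c x \<odot>\<^bsub>N\<^esub> n)"
      using x a c n by (simp add: N.smult_assoc1)
  qed
  \<comment> \<open>The lift of \<open>\<epsilon> s\<close> is sv = s = vs, so v itself is the
    quotient by s.\<close>
  moreover have "c (\<epsilon> s) = v"
    by (rule unique) (use c \<epsilon>_s_closed v aug_lift(6)[OF s] in \<open>simp_all add: vv vs sv flip: c(3)\<close>)
  then have "h (\<epsilon> s) = n" unfolding h_def using \<epsilon>_s_closed n by simp
  ultimately show ?thesis by blast
qed

text \<open>An extension has to choose an image n in vN for \<open>\<epsilon> v\<close>, and this
  forces the value sn at \<open>\<epsilon> s\<close>. Conversely,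
  \<open>x - \<epsilon> (aug_lift x)\<close> is always a syzygy, so h on this part plus
  \<open>aug_lift x\<close> acting on n defines an extension.\<close>

lemma syzygy_hom_extends_iff:
  assumes h: "h \<in> module_hom A Sy N"
  shows "h \<in> (\<lambda>g. restrict g (carrier Sy)) ` module_hom A Fr N \<longleftrightarrow>
    (\<exists>n \<in> carrier N. v \<odot>\<^bsub>N\<^esub> n = n \<and> h (\<epsilon> s) = s \<odot>\<^bsub>N\<^esub> n)"
proof
  assume "h \<in> (\<lambda>g. restrict g (carrier Sy)) ` module_hom A Fr N"
  then obtain g where g: "g \<in> module_hom A Fr N" "h = restrict g (carrier Sy)" by blast
  \<comment> \<open>In the free module \<open>\<epsilon> s\<close> is s times
    \<open>\<epsilon> v\<close>, since sv = s; \<open>\<epsilon> v\<close> itself need not be a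
    syzygy.\<close>
  have "h (\<epsilon> s) = g (s \<odot>\<^bsub>Fr\<^esub> \<epsilon> v)"
    using g(2) \<epsilon>_s_closed s v by (simp add: sv flip: P.R.free_single_smult)
  also have "\<dots> = s \<odot>\<^bsub>N\<^esub> g (\<epsilon> v)" by (rule FrN.hom_homD(4)[OF g(1) s \<epsilon>_closed[OF v]])
  finally have "h (\<epsilon> s) = s \<odot>\<^bsub>N\<^esub> g (\<epsilon> v)" .
  moreover have "v \<odot>\<^bsub>N\<^esub> g (\<epsilon> v) = g (\<epsilon> v)"
    using FrN.hom_homD(4)[OF g(1) v \<epsilon>_closed[OF v]] v by (simp add: vv flip: P.R.free_single_smult)
  moreover have "g (\<epsilon> v) \<in> carrier N" by (rule FrN.hom_homD(1)[OF g(1) \<epsilon>_closed[OF v]])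
  ultimately show "\<exists>n \<in> carrier N. v \<odot>\<^bsub>N\<^esub> n = n \<and> h (\<epsilon> s) = s \<odot>\<^bsub>N\<^esub> n" by blast
next
  assume "\<exists>n \<in> carrier N. v \<odot>\<^bsub>N\<^esub> n = n \<and> h (\<epsilon> s) = s \<odot>\<^bsub>N\<^esub> n"
  then obtain n where n: "n \<in> carrier N" "v \<odot>\<^bsub>N\<^esub> n = n" "h (\<epsilon> s) = s \<odot>\<^bsub>N\<^esub> n" by blast
  have id: "(\<lambda>m. m) \<in> carrier M \<rightarrow> carrier M" by simp
  \<comment> \<open>Subtracting \<open>\<epsilon> (aug_lift x)\<close> cancels the augmentation of
    x. This linear map into the syzygies need not fix them; the second term of g below compensates
    for that.\<close>
  define r where "r x = x \<oplus>\<^bsub>Fr\<^esub> \<epsilon> (\<ominus>\<^bsub>A\<^esub> aug_lift x)" for x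
  have \<epsilon>aug_lift: "\<epsilon> (\<ominus>\<^bsub>A\<^esub> aug_lift x) \<in> carrier Fr" if "x \<in> carrier Fr" for x
    using aug_lift(1)[OF that] by (simp add: \<epsilon>_closed)
  have r: "r x \<in> carrier Sy" if x: "x \<in> carrier Fr" for x
  proof -
    have "augmentation A M (r x) = aug_lift x \<odot>\<^bsub>M\<^esub> m\<^sub>0 \<oplus>\<^bsub>M\<^esub> augmentation A M (\<epsilon> (\<ominus>\<^bsub>A\<^esub> aug_lift x))"
      unfolding r_def aug_lift(3)[OF x] unfolding augmentation_eq by (rule P.free_lift_add[OF x \<epsilon>aug_lift[OF x] id])
    also have "\<dots> = \<zero>\<^bsub>M\<^esub>"
      using aug_lift(1)[OF x] m\<^sub>0 by (simp add: augmentation_\<epsilon> P.smult_minus_left P.smult_closed P.r_neg)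
    finally show ?thesis using x \<epsilon>aug_lift[OF x] by (simp add: syzygy_simps r_def)
  qed
  have r_add: "r (x \<oplus>\<^bsub>Fr\<^esub> y) = r x \<oplus>\<^bsub>Sy\<^esub> r y" if xy: "x \<in> carrier Fr" "y \<in> carrier Fr" for x y
  proof -
    have "\<epsilon> (\<ominus>\<^bsub>A\<^esub> aug_lift (x \<oplus>\<^bsub>Fr\<^esub> y)) = \<epsilon> (\<ominus>\<^bsub>A\<^esub> aug_lift x) \<oplus>\<^bsub>Fr\<^esub> \<epsilon> (\<ominus>\<^bsub>A\<^esub> aug_lift y)"
      using xy aug_lift(1) by (simp add: aug_lift(4) P.R.minus_add flip: P.R.free_single_add)
    then show ?thesis
      unfolding r_def syzygy_simps using xy \<epsilon>aug_lift by (simp add: Fr.a_ac)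
  qed
  have r_smult: "r (a \<odot>\<^bsub>Fr\<^esub> x) = a \<odot>\<^bsub>Sy\<^esub> r x" if a: "a \<in> carrier A" and x: "x \<in> carrier Fr" for a x
  proof -
    have "\<epsilon> (\<ominus>\<^bsub>A\<^esub> aug_lift (a \<odot>\<^bsub>Fr\<^esub> x)) = a \<odot>\<^bsub>Fr\<^esub> \<epsilon> (\<ominus>\<^bsub>A\<^esub> aug_lift x)"
      using a x aug_lift(1) by (simp add: aug_lift(5) P.R.r_minus flip: P.R.free_single_smult)
    then show ?thesis
      unfolding r_def syzygy_simps using a x \<epsilon>aug_lift by (simp add: Fr.smult_r_distr)
  qed
  define g where "g = (\<lambda>x \<in> carrier Fr. h (r x) \<oplus>\<^bsub>N\<^esub> aug_lift x \<odot>\<^bsub>N\<^esub> n)"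
  have "g \<in> module_hom A Fr N"
    unfolding g_def
    by (rule FrN.module_homI)
      (simp_all add: r r_add r_smult aug_lift(1,4,5) SyN.hom_homD[OF h] n(1) N.smult_closed N.smult_l_distr
        N.smult_assoc1 N.smult_r_distr N.a_ac)
  moreover have "restrict g (carrier Sy) = h"
  proof (rule SyN.Hom_eqI)
    fix x assume x: "x \<in> carrier Sy"
    then have x': "x \<in> carrier Fr" "augmentation A M x = \<zero>\<^bsub>M\<^esub>" by (auto simp: syzygy_simps)
    obtain c where c: "c \<in> carrier A" "aug_lift x = c \<otimes>\<^bsub>A\<^esub> s"
      using annihilator[OF aug_lift(1)[OF x'(1)] aug_lift(2)[OF x'(1)]] aug_lift(3)[OF x'(1)] x'(2) by auto
    \<comment> \<open>For a syzygy the subtracted term is a multiple of \<open>\<epsilon> s\<close>,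
      so the assumption on \<open>h (\<epsilon> s)\<close> determines the error exactly.\<close>
    have eq: "\<epsilon> (\<ominus>\<^bsub>A\<^esub> aug_lift x) = (\<ominus>\<^bsub>A\<^esub> c) \<odot>\<^bsub>Sy\<^esub> \<epsilon> s"
      using c s by (simp add: syzygy_simps P.R.l_minus flip: P.R.free_single_smult)
    have "h (r x) = h (x \<oplus>\<^bsub>Sy\<^esub> (\<ominus>\<^bsub>A\<^esub> c) \<odot>\<^bsub>Sy\<^esub> \<epsilon> s)" unfolding r_def eq[symmetric] syzygy_simps(3) ..
    also have "\<dots> = h x \<oplus>\<^bsub>N\<^esub> (\<ominus>\<^bsub>A\<^esub> c) \<odot>\<^bsub>N\<^esub> h (\<epsilon> s)"
      using x c \<epsilon>_s_closed by (simp add: SyN.hom_homD[OF h] Sy.smult_closed)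
    also have "\<dots> = h x \<oplus>\<^bsub>N\<^esub> \<ominus>\<^bsub>N\<^esub> (aug_lift x \<odot>\<^bsub>N\<^esub> n)"
      using c s n by (simp add: N.smult_minus_left N.smult_closed N.smult_assoc1)
    finally have "h (r x) \<oplus>\<^bsub>N\<^esub> aug_lift x \<odot>\<^bsub>N\<^esub> n = h x"
      using SyN.hom_homD(1)[OF h x] aug_lift(1)[OF x'(1)] n(1) by (simp add: N.smult_closed N.a_assoc N.l_neg)
    then show "restrict g (carrier Sy) x = h x" using x x' by (simp add: g_def)
  qed (use SyN.hom_homD(2)[OF h] in simp_all)
  ultimately show "h \<in> (\<lambda>g. restrict g (carrier Sy)) ` module_hom A Fr N" by blast
qed

lemma submodule_restrictions:
  "submodule class_ring ((\<lambda>g. restrict g (carrier Sy)) ` module_hom A Fr N) (Hom_space A Sy N)"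
  (is "submodule _ (?\<rho> ` _) ?H")
proof (rule submodule.intro)
  have sub: "x \<in> carrier Fr" if "x \<in> carrier Sy" for x using that by (simp add: syzygy_simps)
  show "module class_ring ?H" by (rule SyN.module_Hom)
  show "?\<rho> ` module_hom A Fr N \<subseteq> carrier ?H"
  proof
    fix h assume "h \<in> ?\<rho> ` module_hom A Fr N"
    then obtain g where g: "g \<in> module_hom A Fr N" "h = ?\<rho> g" by blast
    show "h \<in> carrier ?H"
      unfolding SyN.Hom_simps g(2)
      by (rule SyN.module_homI) (simp_all add: FrN.hom_homD[OF g(1)] sub syzygy_simps(3,4))
  qed
  show "\<zero>\<^bsub>?H\<^esub> \<in> ?\<rho> ` module_hom A Fr N"
    by (rule image_eqI[OF _ FrN.Hom_zero_closed])
      (auto simp: SyN.Hom_simps FrN.Hom_simps sub fun_eq_iff restrict_def)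
next
  have sub: "x \<in> carrier Fr" if "x \<in> carrier Sy" for x using that by (simp add: syzygy_simps)
  fix f g assume "f \<in> ?\<rho> ` module_hom A Fr N" "g \<in> ?\<rho> ` module_hom A Fr N"
  then obtain f' g' where fg: "f' \<in> module_hom A Fr N" "g' \<in> module_hom A Fr N" "f = ?\<rho> f'" "g = ?\<rho> g'"
    by blast
  show "f \<oplus>\<^bsub>?H\<^esub> g \<in> ?\<rho> ` module_hom A Fr N"
    by (rule image_eqI[OF _ FrN.Hom_add_closed[OF fg(1,2)]])
      (auto simp: SyN.Hom_simps FrN.Hom_simps sub fun_eq_iff restrict_def fg(3,4))
next
  have sub: "x \<in> carrier Fr" if "x \<in> carrier Sy" for x using that by (simp add: syzygy_simps)
  fix k f assume "f \<in> ?\<rho> ` module_hom A Fr N"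
  then obtain f' where f: "f' \<in> module_hom A Fr N" "f = ?\<rho> f'" by blast
  show "k \<odot>\<^bsub>?H\<^esub> f \<in> ?\<rho> ` module_hom A Fr N"
    by (rule image_eqI[OF _ FrN.Hom_smult_closed[OF f(1)]])
      (auto simp: SyN.Hom_simps FrN.Hom_simps sub fun_eq_iff restrict_def f(2))
qed

text \<open>Evaluation at \<open>\<epsilon> s\<close> maps the homomorphisms out of the syzygy onto
  vN by \<open>syzygy_hom_exists\<close>, and the preimage of s(vN) consists of the restrictions by
  \<open>syzygy_hom_extends_iff\<close>. Coordinates on vN modulo s(vN) therefore become coordinates
  on Ext.\<close>

theorem has_dimension_Ext1I:
  fixes \<Lambda> :: "'n \<Rightarrow> 'j \<Rightarrow> 'k"
  defines "T \<equiv> {n \<in> carrier N. v \<odot>\<^bsub>N\<^esub> n = n}"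
  assumes add: "\<And>x y j. x \<in> T \<Longrightarrow> y \<in> T \<Longrightarrow> j \<in> J \<Longrightarrow> \<Lambda> (x \<oplus>\<^bsub>N\<^esub> y) j = \<Lambda> x j + \<Lambda> y j"
    and smult: "\<And>k x j. x \<in> T \<Longrightarrow> j \<in> J \<Longrightarrow> \<Lambda> ((k \<odot>\<^bsub>A\<^esub> \<one>\<^bsub>A\<^esub>) \<odot>\<^bsub>N\<^esub> x) j = k * \<Lambda> x j"
    and finite_support: "\<And>x. x \<in> T \<Longrightarrow> finite {j \<in> J. \<Lambda> x j \<noteq> 0}"
    and kernel: "\<And>x. x \<in> T \<Longrightarrow> (\<exists>n \<in> T. x = s \<odot>\<^bsub>N\<^esub> n) \<longleftrightarrow> (\<forall>j \<in> J. \<Lambda> x j = 0)"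
    and dual: "\<And>j. j \<in> J \<Longrightarrow> \<exists>x \<in> T. \<forall>i \<in> J. \<Lambda> x i = of_bool (i = j)"
  shows "has_dimension (Ext1 A M N) |J|"
proof -
  have T: "h (\<epsilon> s) \<in> T" if h: "h \<in> module_hom A Sy N" for h
    using SyN.hom_homD(1)[OF h \<epsilon>_s_closed] SyN.hom_homD(4)[OF h v \<epsilon>_s_closed] v s
    by (simp add: T_def syzygy_simps vs flip: P.R.free_single_smult)
  show ?thesis
    unfolding Ext1_def
  proof (rule has_dimension_quotientI[where \<Theta> = "\<lambda>h. \<Lambda> (h (\<epsilon> s))", OF submodule_restrictions])
    fix h assume "h \<in> carrier (Hom_space A Sy N)"
    then have h: "h \<in> module_hom A Sy N" by (simp add: SyN.Hom_simps)
    show "finite {j \<in> J. \<Lambda> (h (\<epsilon> s)) j \<noteq> 0}" by (rule finite_support[OF T[OF h]])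
    show "h \<in> (\<lambda>g. restrict g (carrier Sy)) ` module_hom A Fr N \<longleftrightarrow> (\<forall>j\<in>J. \<Lambda> (h (\<epsilon> s)) j = 0)"
      unfolding syzygy_hom_extends_iff[OF h] using kernel[OF T[OF h]] by (auto simp: T_def)
    show "\<Lambda> ((k \<odot>\<^bsub>Hom_space A Sy N\<^esub> h) (\<epsilon> s)) j = k * \<Lambda> (h (\<epsilon> s)) j" if "j \<in> J" for k j
      using smult[OF T[OF h] that] \<epsilon>_s_closed by (simp add: SyN.Hom_simps)
    fix g assume "g \<in> carrier (Hom_space A Sy N)"
    then have g: "g \<in> module_hom A Sy N" by (simp add: SyN.Hom_simps)
    show "\<Lambda> ((h \<oplus>\<^bsub>Hom_space A Sy N\<^esub> g) (\<epsilon> s)) j = \<Lambda> (h (\<epsilon> s)) j + \<Lambda> (g (\<epsilon> s)) j" if "j \<in> J" for j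
      using add[OF T[OF h] T[OF g] that] \<epsilon>_s_closed by (simp add: SyN.Hom_simps)
  next
    fix j assume "j \<in> J"
    then obtain n where n: "n \<in> T" "\<forall>i\<in>J. \<Lambda> n i = of_bool (i = j)" using dual by blast
    then obtain h where "h \<in> module_hom A Sy N" "h (\<epsilon> s) = n"
      using syzygy_hom_exists by (auto simp: T_def)
    then show "\<exists>h\<in>carrier (Hom_space A Sy N). \<forall>i\<in>J. \<Lambda> (h (\<epsilon> s)) i = of_bool (i = j)"
      using n(2) by (intro bexI[of _ h]) (simp_all add: SyN.Hom_simps)
  qed
qed

end

section \<open>Scalars and grading of the Leavitt path algebra\<close>

locale leavitt = fin_digraph G
  for G :: "('v, 'e) pre_digraph" +
  fixes K :: "'k::field itself"
begin

abbreviation "FA \<equiv> free_algebra K (lpa_gens G)"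
abbreviation "LI \<equiv> lpa_ideal K G"
abbreviation "LA \<equiv> lpa K G"
abbreviation "cl a \<equiv> LI +>\<^bsub>FA\<^esub> a"
abbreviation "wcl u \<equiv> cl (word_elt u :: ('v, 'e) lpa_gen list \<Rightarrow> 'k)"

sublocale FA: ring FA by (rule ring_free_algebra)
sublocale LI: ideal LI FA by (rule ideal_lpa_ideal)
sublocale LA: ring LA by (rule ring_lpa)

section \<open>Scalars in the Leavitt path algebra\<close>

lemma FA_smult_closed: "a \<in> carrier FA \<Longrightarrow> (\<lambda>w. k * a w) \<in> carrier FA"
  by (rule free_algebra_closedI[OF free_algebra_closedD(1) _ free_algebra_closedD(2)]) auto

lemma FA_word_closed: "set u \<subseteq> lpa_gens G \<Longrightarrow> word_elt u \<in> carrier FA"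
  by (rule word_elt_closed) auto

text \<open>Scaling is multiplication by a central element, a multiple of the empty word. This is
  why the ring ideal of relations is also a subspace.\<close>

lemma scalar_word_mult:
  assumes "a \<in> carrier FA"
  shows "(\<lambda>w. k * word_elt [] w) \<otimes>\<^bsub>FA\<^esub> a = (\<lambda>w. k * a w)"
    "a \<otimes>\<^bsub>FA\<^esub> (\<lambda>w. k * word_elt [] w) = (\<lambda>w. k * a w)"
proof -
  have "(\<lambda>w. k * word_elt [] w) \<otimes>\<^bsub>FA\<^esub> a = (\<lambda>w. k * (word_elt [] \<otimes>\<^bsub>FA\<^esub> a) w)"
    by (simp add: free_algebra_simps(2) sum_distrib_left mult.assoc)
  then show "(\<lambda>w. k * word_elt [] w) \<otimes>\<^bsub>FA\<^esub> a = (\<lambda>w. k * a w)"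
    unfolding free_algebra_one(1)[OF assms] .
  have "a \<otimes>\<^bsub>FA\<^esub> (\<lambda>w. k * word_elt [] w) = (\<lambda>w. k * (a \<otimes>\<^bsub>FA\<^esub> word_elt []) w)"
    by (simp add: free_algebra_simps(2) sum_distrib_left mult_ac)
  then show "a \<otimes>\<^bsub>FA\<^esub> (\<lambda>w. k * word_elt [] w) = (\<lambda>w. k * a w)"
    unfolding free_algebra_one(2)[OF assms] .
qed

lemma module_FA: "module class_ring FA"
  by (rule moduleI[OF domain.axioms(1)[OF field.axioms(1)[OF class_field]] FA.is_abelian_group])
    (simp_all add: free_algebra_simps(5,6) FA_smult_closed algebra_simps)

lemma submodule_LI: "submodule class_ring LI FA"
proof (rule submodule.intro[OF module_FA])
  fix k :: 'k and a assume a: "a \<in> LI"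
  have "(\<lambda>w. k * word_elt [] w) \<otimes>\<^bsub>FA\<^esub> a \<in> LI"
    using a by (intro LI.I_l_closed FA_smult_closed FA_word_closed) auto
  then show "k \<odot>\<^bsub>FA\<^esub> a \<in> LI"
    unfolding scalar_word_mult(1)[OF LI.a_Hcarr[OF a]] by (simp add: free_algebra_simps(6))
qed (use LI.a_subset LI.a_closed LI.zero_closed in auto)

lemma cl_smult:
  assumes "a \<in> carrier FA"
  shows "k \<odot>\<^bsub>LA\<^esub> cl a = cl (\<lambda>w. k * a w)"
proof -
  interpret quotient_space class_ring LI FA by (rule quotient_space.intro[OF submodule_LI])
  show ?thesis using coset_smult[OF _ assms, of k] by (simp add: lpa_def free_algebra_simps(6))
qed

lemma scalar_eq: "k \<odot>\<^bsub>LA\<^esub> \<one>\<^bsub>LA\<^esub> = cl (\<lambda>w. k * word_elt [] w)"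
  unfolding lpa_simps(4) free_algebra_simps(3) by (rule cl_smult[OF FA_word_closed]) simp

lemma scalar_mult_cl:
  assumes "a \<in> carrier FA"
  shows "(k \<odot>\<^bsub>LA\<^esub> \<one>\<^bsub>LA\<^esub>) \<otimes>\<^bsub>LA\<^esub> cl a = cl (\<lambda>w. k * a w)" "cl a \<otimes>\<^bsub>LA\<^esub> (k \<odot>\<^bsub>LA\<^esub> \<one>\<^bsub>LA\<^esub>) = cl (\<lambda>w. k * a w)"
proof -
  have "(\<lambda>w. k * word_elt [] w) \<in> carrier FA" by (intro FA_smult_closed FA_word_closed) simp
  then show "(k \<odot>\<^bsub>LA\<^esub> \<one>\<^bsub>LA\<^esub>) \<otimes>\<^bsub>LA\<^esub> cl a = cl (\<lambda>w. k * a w)"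
    "cl a \<otimes>\<^bsub>LA\<^esub> (k \<odot>\<^bsub>LA\<^esub> \<one>\<^bsub>LA\<^esub>) = cl (\<lambda>w. k * a w)"
    unfolding scalar_eq using assms by (simp_all add: lpa_simps(2) scalar_word_mult)
qed

lemma hom_algebra_chen: "hom_algebra LA (chen_module K G p) (chen_module K G q)"
proof (intro hom_algebra.intro hom_algebra_axioms.intro left_module_chen)
  fix k l :: 'k
  have c: "(\<lambda>w. k * word_elt [] w) \<in> carrier FA" for k :: 'k
    by (intro FA_smult_closed FA_word_closed) simp
  show "k \<odot>\<^bsub>LA\<^esub> \<one>\<^bsub>LA\<^esub> \<in> carrier LA" unfolding scalar_eq by (rule cls_closed[OF c])
  show "(k \<odot>\<^bsub>LA\<^esub> \<one>\<^bsub>LA\<^esub>) \<otimes>\<^bsub>LA\<^esub> a = a \<otimes>\<^bsub>LA\<^esub> (k \<odot>\<^bsub>LA\<^esub> \<one>\<^bsub>LA\<^esub>)" if "a \<in> carrier LA" for a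
    using that by (rule lpa_cases) (simp add: scalar_mult_cl)
  show "(k + l) \<odot>\<^bsub>LA\<^esub> \<one>\<^bsub>LA\<^esub> = k \<odot>\<^bsub>LA\<^esub> \<one>\<^bsub>LA\<^esub> \<oplus>\<^bsub>LA\<^esub> l \<odot>\<^bsub>LA\<^esub> \<one>\<^bsub>LA\<^esub>"
    unfolding scalar_eq lpa_simps(3)[OF c c] by (simp add: free_algebra_simps(5) distrib_right)
  show "(k * l) \<odot>\<^bsub>LA\<^esub> \<one>\<^bsub>LA\<^esub> = (k \<odot>\<^bsub>LA\<^esub> \<one>\<^bsub>LA\<^esub>) \<otimes>\<^bsub>LA\<^esub> (l \<odot>\<^bsub>LA\<^esub> \<one>\<^bsub>LA\<^esub>)"
    unfolding scalar_eq[of l] scalar_eq[of "k * l"] scalar_mult_cl(1)[OF c] by (simp add: mult.assoc)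
  show "1 \<odot>\<^bsub>LA\<^esub> \<one>\<^bsub>LA\<^esub> = \<one>\<^bsub>LA\<^esub>" using scalar_eq[of 1] by (simp add: lpa_simps(4) free_algebra_simps(3))
qed

lemma scalar_act:
  assumes f: "f \<in> carrier (chen_module K G q)"
  shows "(k \<odot>\<^bsub>LA\<^esub> \<one>\<^bsub>LA\<^esub>) \<odot>\<^bsub>chen_module K G q\<^esub> f = (\<lambda>p. k * f p)"
proof
  have c: "(\<lambda>w. k * word_elt [] w) \<in> carrier FA" by (intro FA_smult_closed FA_word_closed) simp
  have fin: "finite {p. f p \<noteq> 0}" using f by (simp add: chen_simps)
  have act: "basis_act G (\<lambda>w. k * word_elt [] w) p p' = k * of_bool (p = p')" for p p'
    by (subst basis_act_superset[of "{[]}"]) (auto simp: word_elt_def)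
  fix p
  have "free_act G (\<lambda>w. k * word_elt [] w) f p = (\<Sum>p'|f p' \<noteq> 0. if p' = p then k * f p else 0)"
    unfolding free_act_superset[OF fin order.refl] act by (rule sum.cong) auto
  also have "\<dots> = k * f p" using fin by simp
  finally show "((k \<odot>\<^bsub>LA\<^esub> \<one>\<^bsub>LA\<^esub>) \<odot>\<^bsub>chen_module K G q\<^esub> f) p = k * f p"
    unfolding scalar_eq chen_smult_cls[OF c f] .
qed

section \<open>The grading by the integers\<close>

fun gen_degree :: "('v, 'e) lpa_gen \<Rightarrow> int" where
  "gen_degree (Vertex v) = 0"
| "gen_degree (Edge e) = 1"
| "gen_degree (Ghost e) = - 1"

definition word_degree :: "('v, 'e) lpa_gen list \<Rightarrow> int" where
  "word_degree u = sum_list (map gen_degree u)"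

definition component :: "int \<Rightarrow> (('v, 'e) lpa_gen list \<Rightarrow> 'k) \<Rightarrow> ('v, 'e) lpa_gen list \<Rightarrow> 'k" where
  "component i a = (\<lambda>w. if word_degree w = i then a w else 0)"

lemma degree_append: "word_degree (u @ v) = word_degree u + word_degree v"
  by (simp add: word_degree_def)

lemma word_mult_left:
  fixes a :: "('v, 'e) lpa_gen list \<Rightarrow> 'k"
  shows "word_elt u \<otimes>\<^bsub>FA\<^esub> a = (\<lambda>w. if take (length u) w = u then a (drop (length u) w) else 0)"
proof
  fix w :: "('v, 'e) lpa_gen list"
  have "(\<Sum>i\<le>length w. word_elt u (take i w) * a (drop i w)) =
      (\<Sum>i\<le>length w. if i = length u then (if take (length u) w = u then a (drop (length u) w) else 0) else 0)"
    by (rule sum.cong) (auto simp: word_elt_def)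
  also have "\<dots> = (if take (length u) w = u then a (drop (length u) w) else 0)" by auto
  finally show "(word_elt u \<otimes>\<^bsub>FA\<^esub> a) w = (if take (length u) w = u then a (drop (length u) w) else 0)"
    by (simp add: free_algebra_simps(2))
qed

lemma word_mult_right:
  fixes a :: "('v, 'e) lpa_gen list \<Rightarrow> 'k"
  shows "a \<otimes>\<^bsub>FA\<^esub> word_elt u = (\<lambda>w. if drop (length w - length u) w = u then a (take (length w - length u) w) else 0)"
proof
  fix w :: "('v, 'e) lpa_gen list"
  let ?n = "length w - length u"
  have "(\<Sum>i\<le>length w. a (take i w) * word_elt u (drop i w)) =
      (\<Sum>i\<le>length w. if i = ?n then (if drop ?n w = u then a (take ?n w) else 0) else 0)"
    by (rule sum.cong) (auto simp: word_elt_def)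
  also have "\<dots> = (if drop ?n w = u then a (take ?n w) else 0)" by auto
  finally show "(a \<otimes>\<^bsub>FA\<^esub> word_elt u) w = (if drop ?n w = u then a (take ?n w) else 0)"
    by (simp add: free_algebra_simps(2))
qed

lemma component_word_mult_left:
  "component i (word_elt u \<otimes>\<^bsub>FA\<^esub> a) = word_elt u \<otimes>\<^bsub>FA\<^esub> component (i - word_degree u) a"
proof
  fix w :: "('v, 'e) lpa_gen list"
  have "word_degree w = word_degree u + word_degree (drop (length u) w)" if t: "take (length u) w = u"
    using degree_append[of u "drop (length u) w"] append_take_drop_id[of "length u" w] unfolding t by simp
  then show "component i (word_elt u \<otimes>\<^bsub>FA\<^esub> a) w = (word_elt u \<otimes>\<^bsub>FA\<^esub> component (i - word_degree u) a) w"
    by (auto simp: component_def word_mult_left)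
qed

lemma component_word_mult_right:
  "component i (a \<otimes>\<^bsub>FA\<^esub> word_elt u) = component (i - word_degree u) a \<otimes>\<^bsub>FA\<^esub> word_elt u"
proof
  fix w :: "('v, 'e) lpa_gen list"
  let ?n = "length w - length u"
  have "word_degree w = word_degree u + word_degree (take ?n w)" if t: "drop ?n w = u"
    using degree_append[of "take ?n w" u] append_take_drop_id[of ?n w] unfolding t by simp
  then show "component i (a \<otimes>\<^bsub>FA\<^esub> word_elt u) w = (component (i - word_degree u) a \<otimes>\<^bsub>FA\<^esub> word_elt u) w"
    by (auto simp: component_def word_mult_right)
qed

lemma component_add: "component i (a \<oplus>\<^bsub>FA\<^esub> b) = component i a \<oplus>\<^bsub>FA\<^esub> component i b"
  by (auto simp: component_def free_algebra_simps(5))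

lemma FA_minus: "a \<in> carrier FA \<Longrightarrow> \<ominus>\<^bsub>FA\<^esub> a = (\<lambda>w. - a w)"
  using FA_smult_closed[of a "- 1"]
  by (intro FA.minus_equality) (auto simp: free_algebra_simps(4,5))

lemma LI_smult: "a \<in> LI \<Longrightarrow> (\<lambda>w. k * a w) \<in> LI"
  using submodule.smult_closed[OF submodule_LI, of k a] by (simp add: free_algebra_simps(6))

text \<open>Ghost edges count negatively, so that in CK1 and CK2 both sides have degree 0.\<close>

lemma lpa_rel_homogeneous:
  assumes "lpa_rel G a (b :: ('v, 'e) lpa_gen list \<Rightarrow> 'k)"
  shows "\<exists>n. \<forall>w. a w \<noteq> 0 \<or> b w \<noteq> 0 \<longrightarrow> word_degree w = n"
  using assms
proof cases
  case (CK2 v)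
  have "word_degree w = 0" if "(\<Sum>e\<in>out_arcs G v. word_elt [Edge e, Ghost e] w :: 'k) \<noteq> 0" for w
    using that by (rule sum.not_neutral_contains_not_neutral) (auto simp: word_elt_def word_degree_def)
  then show ?thesis unfolding CK2 by (intro exI[of _ 0]) (auto simp: word_elt_def word_degree_def)
next
  case unit
  have "word_degree w = 0" if "(\<Sum>v\<in>verts G. word_elt [Vertex v] w :: 'k) \<noteq> 0" for w
    using that by (rule sum.not_neutral_contains_not_neutral) (auto simp: word_elt_def word_degree_def)
  then show ?thesis unfolding unit by (intro exI[of _ 0]) (auto simp: word_elt_def word_degree_def)
qed (auto simp: word_elt_def word_degree_def split: if_splits)

text \<open>The ideal of relations is homogeneous, so the grading of the free algebra passes to L.
  The elements all of whose components lie in the ideal form a two-sided ideal J, and J contains the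
  generators.\<close>

lemma component_LI:
  assumes "a \<in> LI"
  shows "component i a \<in> LI"
proof -
  define J where "J = {a \<in> carrier FA. \<forall>i. component i a \<in> LI}"
  have zero: "component i (\<lambda>_. 0) = \<zero>\<^bsub>FA\<^esub>" for i by (simp add: component_def free_algebra_simps(4))
  have add: "a \<oplus>\<^bsub>FA\<^esub> b \<in> J" if "a \<in> J" "b \<in> J" for a b
    using that by (simp add: J_def component_add)
  have smult: "(\<lambda>w. k * a w) \<in> J" if a: "a \<in> J" for a k
  proof -
    have "component i (\<lambda>w. k * a w) = (\<lambda>w. k * component i a w)" for i by (auto simp: component_def)
    then show ?thesis using a by (simp add: J_def FA_smult_closed LI_smult)
  qed
  \<comment> \<open>Linearity reduces this to multiplication by a word, which only shifts
    components.\<close>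
  have left: "x \<otimes>\<^bsub>FA\<^esub> a \<in> J" if x: "x \<in> carrier FA" and a: "a \<in> J" for x a
    using x
  proof (induction rule: free_algebra_induct)
    case zero
    have "(\<lambda>_. 0) \<otimes>\<^bsub>FA\<^esub> a = \<zero>\<^bsub>FA\<^esub>" by (simp add: free_algebra_simps(2,4))
    then show ?case using zero FA.zero_closed LI.zero_closed by (simp add: J_def free_algebra_simps(4) component_def)
  next
    case (word k u)
    have "word_elt u \<otimes>\<^bsub>FA\<^esub> a \<in> J"
      using a FA_word_closed[OF word] by (simp add: J_def component_word_mult_left LI.I_l_closed)
    moreover have "(\<lambda>w. k * word_elt u w) \<otimes>\<^bsub>FA\<^esub> a = (\<lambda>w. k * (word_elt u \<otimes>\<^bsub>FA\<^esub> a) w)"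
      by (simp add: free_algebra_simps(2) sum_distrib_left mult.assoc)
    ultimately show ?case using smult by simp
  next
    case (add x y)
    have "(\<lambda>w. x w + y w) \<otimes>\<^bsub>FA\<^esub> a = x \<otimes>\<^bsub>FA\<^esub> a \<oplus>\<^bsub>FA\<^esub> y \<otimes>\<^bsub>FA\<^esub> a"
      using FA.l_distr[OF add(1,2), of a] a by (simp add: free_algebra_simps(5) J_def)
    then show ?case using add(3,4) \<open>\<And>a b. a \<in> J \<Longrightarrow> b \<in> J \<Longrightarrow> a \<oplus>\<^bsub>FA\<^esub> b \<in> J\<close> by simp
  qed
  have right: "a \<otimes>\<^bsub>FA\<^esub> x \<in> J" if x: "x \<in> carrier FA" and a: "a \<in> J" for x a
    using x
  proof (induction rule: free_algebra_induct)
    case zero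
    have "a \<otimes>\<^bsub>FA\<^esub> (\<lambda>_. 0) = \<zero>\<^bsub>FA\<^esub>" by (simp add: free_algebra_simps(2,4))
    then show ?case using zero FA.zero_closed LI.zero_closed by (simp add: J_def free_algebra_simps(4) component_def)
  next
    case (word k u)
    have "a \<otimes>\<^bsub>FA\<^esub> word_elt u \<in> J"
      using a FA_word_closed[OF word] by (simp add: J_def component_word_mult_right LI.I_r_closed)
    moreover have "a \<otimes>\<^bsub>FA\<^esub> (\<lambda>w. k * word_elt u w) = (\<lambda>w. k * (a \<otimes>\<^bsub>FA\<^esub> word_elt u) w)"
      by (simp add: free_algebra_simps(2) sum_distrib_left mult_ac)
    ultimately show ?case using smult by simp
  next
    case (add x y)
    have "a \<otimes>\<^bsub>FA\<^esub> (\<lambda>w. x w + y w) = a \<otimes>\<^bsub>FA\<^esub> x \<oplus>\<^bsub>FA\<^esub> a \<otimes>\<^bsub>FA\<^esub> y"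
      using FA.r_distr[OF add(1,2), of a] a by (simp add: free_algebra_simps(5) J_def)
    then show ?case using add(3,4) \<open>\<And>a b. a \<in> J \<Longrightarrow> b \<in> J \<Longrightarrow> a \<oplus>\<^bsub>FA\<^esub> b \<in> J\<close> by simp
  qed
  have "ideal J FA"
  proof (rule idealI[OF FA.ring_axioms _ left right])
    show "subgroup J (add_monoid FA)"
    proof (rule group.subgroupI[OF FA.add.is_group])
      have "\<zero>\<^bsub>FA\<^esub> \<in> J" using zero FA.zero_closed LI.zero_closed by (simp add: J_def free_algebra_simps(4))
      then show "J \<noteq> {}" by blast
      fix a assume a: "a \<in> J"
      then have "\<ominus>\<^bsub>FA\<^esub> a = (\<lambda>w. - 1 * a w)" using FA_minus[of a] by (simp add: J_def)
      then show "inv\<^bsub>add_monoid FA\<^esub> a \<in> J" using smult[OF a, of "- 1"] by (simp add: a_inv_def)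
    qed (use add in \<open>auto simp: J_def\<close>)
  qed
  moreover have "{a \<ominus>\<^bsub>FA\<^esub> b | a b. lpa_rel G a b} \<subseteq> J"
  proof
    fix c assume "c \<in> {a \<ominus>\<^bsub>FA\<^esub> b | a b. lpa_rel G a b}"
    then obtain a b where c: "c = a \<ominus>\<^bsub>FA\<^esub> b" and rel: "lpa_rel G a b" by blast
    have ab: "a \<in> carrier FA" "b \<in> carrier FA" using lpa_rel_closed[OF rel] by blast+
    have c_eq: "c = (\<lambda>w. a w - b w)" using FA_minus[OF ab(2)] by (simp add: c a_minus_def free_algebra_simps(5))
    obtain n where n: "\<And>w. a w \<noteq> 0 \<or> b w \<noteq> 0 \<Longrightarrow> word_degree w = n" using lpa_rel_homogeneous[OF rel] by blast
    have "a w = b w" if "word_degree w \<noteq> n" for w using n[of w] that by metis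
    \<comment> \<open>A generator lives in the single degree n, so its other components are
      zero.\<close>
    then have "component i c = (if i = n then c else \<zero>\<^bsub>FA\<^esub>)" for i
      by (auto simp: c_eq component_def free_algebra_simps(4) fun_eq_iff)
    moreover have "c \<in> LI"
      unfolding lpa_ideal_def
      by (rule subsetD[OF FA.genideal_self[OF lpa_rel_diff_closed]]) (use c rel in blast)
    ultimately show "c \<in> J" by (auto simp: J_def LI.a_Hcarr)
  qed
  ultimately have "LI \<subseteq> J" unfolding lpa_ideal_def by (rule FA.genideal_minimal)
  then show ?thesis using assms by (auto simp: J_def)
qed

text \<open>
  Right multiplication by \<open>u\<close> raises degrees, so the components of a fixed point vanish one after
  the other, starting from below.
\<close>

lemma mult_word_fixed_imp_zero:
  assumes X: "X \<in> carrier LA" and u: "set u \<subseteq> lpa_gens G" "word_degree u > 0" and fixed: "X \<otimes>\<^bsub>LA\<^esub> wcl u = X"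
  shows "X = \<zero>\<^bsub>LA\<^esub>"
proof -
  obtain a where a: "a \<in> carrier FA" "X = cl a" using X by (rule lpa_cases)
  note uc = FA_word_closed[OF u(1)]
  have "cl (a \<otimes>\<^bsub>FA\<^esub> word_elt u) = cl a" using fixed a uc by (simp add: lpa_simps(2))
  then have "a \<otimes>\<^bsub>FA\<^esub> word_elt u \<ominus>\<^bsub>FA\<^esub> a \<in> LI"
    using a uc FA.m_closed by (metis FA.quotient_eq_iff_same_a_r_cos LI.ideal_axioms)
  \<comment> \<open>Modulo the ideal, the component of a in degree i is the component lying
    \<open>word_degree u\<close> lower, multiplied by u.\<close>
  then have shift: "component (i - word_degree u) a \<otimes>\<^bsub>FA\<^esub> word_elt u \<oplus>\<^bsub>FA\<^esub> (\<lambda>w. - component i a w) \<in> LI" for i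
  proof -
    assume "a \<otimes>\<^bsub>FA\<^esub> word_elt u \<ominus>\<^bsub>FA\<^esub> a \<in> LI"
    from component_LI[OF this, of i] show ?thesis
      unfolding a_minus_def component_add component_word_mult_right FA_minus[OF a(1)]
      by (simp add: component_def if_distrib[of uminus] cong: if_cong)
  qed
  \<comment> \<open>Finite support bounds the degrees from below; this is where the induction
    starts.\<close>
  obtain m where m: "\<And>w. a w \<noteq> 0 \<Longrightarrow> m \<le> word_degree w"
  proof (cases "{w. a w \<noteq> 0} = {}")
    case False
    have "finite (word_degree ` {w. a w \<noteq> 0})" using free_algebra_closedD(1)[OF a(1)] by simp
    then show thesis using that[of "Min (word_degree ` {w. a w \<noteq> 0})"] by simp
  qed (use that in blast)
  \<comment> \<open>The measure is 0 for degrees below m, where the component is zero. The summand 1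
    makes it drop strictly also when i = m.\<close>
  have comp: "component i a \<in> LI" for i
  proof (induction "nat (i - m + 1)" arbitrary: i rule: less_induct)
    case less
    show ?case
    proof (cases "i < m")
      case True
      then have "component i a = \<zero>\<^bsub>FA\<^esub>" using m by (force simp: component_def free_algebra_simps(4))
      then show ?thesis using LI.zero_closed by simp
    next
      case False
      have "component (i - word_degree u) a \<in> LI" using u(2) False by (intro less) simp
      then have "component (i - word_degree u) a \<otimes>\<^bsub>FA\<^esub> word_elt u \<in> LI" by (rule LI.I_r_closed[OF _ uc])
      then have "(component (i - word_degree u) a \<otimes>\<^bsub>FA\<^esub> word_elt u \<oplus>\<^bsub>FA\<^esub> (\<lambda>w. - component i a w)) \<oplus>\<^bsub>FA\<^esub>
          (\<lambda>w. - 1 * (component (i - word_degree u) a \<otimes>\<^bsub>FA\<^esub> word_elt u) w) \<in> LI"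
        by (intro LI.a_closed shift LI_smult)
      then have "(\<lambda>w. - component i a w) \<in> LI" by (simp add: free_algebra_simps(5))
      from LI_smult[OF this, of "- 1"] show ?thesis by simp
    qed
  qed
  \<comment> \<open>Only finitely many degrees occur, so a is a finite sum of components.\<close>
  have "(\<lambda>w. if word_degree w \<in> D then a w else 0) \<in> LI" if "finite D" for D
    using that
  proof (induction D)
    case empty
    show ?case using LI.zero_closed by (simp add: free_algebra_simps(4))
  next
    case (insert i D)
    have "(\<lambda>w. if word_degree w \<in> insert i D then a w else 0) =
        component i a \<oplus>\<^bsub>FA\<^esub> (\<lambda>w. if word_degree w \<in> D then a w else 0)"
      using insert.hyps(2) by (auto simp: component_def free_algebra_simps(5))
    then show ?case using LI.a_closed[OF comp insert.IH] by simp
  qed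
  from this[of "word_degree ` {w. a w \<noteq> 0}"] have "(\<lambda>w. if word_degree w \<in> word_degree ` {w. a w \<noteq> 0} then a w else 0) \<in> LI"
    using free_algebra_closedD(1)[OF a(1)] by simp
  moreover have "(\<lambda>w. if word_degree w \<in> word_degree ` {w. a w \<noteq> 0} then a w else 0) = a"
    by (rule ext) auto
  ultimately have "a \<in> LI" by simp
  then show ?thesis unfolding a(2) lpa_simps(5) using FA.a_coset_join2 LI.a_subgroup a(1) by blast
qed

end

section \<open>Simple closed paths\<close>

lemma bappend_append: "bappend (\<alpha> @ \<beta>) p = bappend \<alpha> (bappend \<beta> p)"
  by (cases p) auto

lemma bappend_Nil: "bappend [] p = p"
  by (cases p) auto

lemma btail_funpow_bappend: "(btail ^^ length \<alpha>) (bappend \<alpha> p) = p"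
proof (induction \<alpha>)
  case (Cons e \<alpha>)
  have "btail (bappend (e # \<alpha>) p) = bappend \<alpha> p" by (cases p) auto
  then show ?case using Cons by (simp add: funpow_swap1)
qed (simp add: bappend_Nil)

lemma bappend_inject: "bappend \<alpha> p = bappend \<alpha> p' \<longleftrightarrow> p = p'"
  by (metis btail_funpow_bappend)

lemma tail_equiv_bappend: "tail_equiv (bappend \<alpha> p) q \<longleftrightarrow> tail_equiv p q"
proof
  assume "tail_equiv (bappend \<alpha> p) q"
  then obtain m n where "(btail ^^ m) (bappend \<alpha> p) = (btail ^^ n) q" by (auto simp: tail_equiv_def)
  \<comment> \<open>The given number m of steps may end inside \<alpha>;
    \<open>length \<alpha>\<close> further steps on both sides are enough to use up the
    prefix.\<close>
  then have "(btail ^^ length \<alpha>) ((btail ^^ m) (bappend \<alpha> p)) = (btail ^^ length \<alpha>) ((btail ^^ n) q)" by simp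
  then have "(btail ^^ (m + length \<alpha>)) (bappend \<alpha> p) = (btail ^^ (length \<alpha> + n)) q"
    by (simp add: funpow_add add.commute[of m])
  then have "(btail ^^ m) p = (btail ^^ (length \<alpha> + n)) q"
    by (simp add: funpow_add btail_funpow_bappend)
  then show "tail_equiv p q" unfolding tail_equiv_def by blast
next
  assume "tail_equiv p q"
  then obtain m n where "(btail ^^ m) p = (btail ^^ n) q" by (auto simp: tail_equiv_def)
  then have "(btail ^^ (m + length \<alpha>)) (bappend \<alpha> p) = (btail ^^ n) q"
    by (simp add: funpow_add btail_funpow_bappend)
  then show "tail_equiv (bappend \<alpha> p) q" unfolding tail_equiv_def by blast
qed

lemma tail_equiv_refl: "tail_equiv p p"
  unfolding tail_equiv_def by blast

lemma tail_equiv_sym: "tail_equiv p q \<Longrightarrow> tail_equiv q p"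
  unfolding tail_equiv_def by metis

lemma tail_equiv_trans: "tail_equiv p q \<Longrightarrow> tail_equiv q r \<Longrightarrow> tail_equiv p r"
proof -
  assume "tail_equiv p q" "tail_equiv q r"
  then obtain k l m n where 1: "(btail ^^ k) p = (btail ^^ l) q" "(btail ^^ m) q = (btail ^^ n) r"
    unfolding tail_equiv_def by blast
  have "(btail ^^ (m + k)) p = (btail ^^ m) ((btail ^^ l) q)" by (simp add: funpow_add 1)
  also have "\<dots> = (btail ^^ l) ((btail ^^ m) q)" by (metis add.commute comp_apply funpow_add)
  also have "\<dots> = (btail ^^ (l + n)) r" by (simp add: funpow_add 1)
  finally show ?thesis unfolding tail_equiv_def by blast
qed

section \<open>Periods of streams\<close>

lemma btail_funpow_InfPath: "(btail ^^ n) (InfPath t) = InfPath (sdrop n t)"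
  by (induction n arbitrary: t) (simp_all add: funpow_swap1)

lemma stake_periodic:
  assumes "sdrop g s = s"
  shows "stake (j * g) s = concat (replicate j (stake g s))"
proof (induction j)
  case (Suc j)
  have "stake (g + j * g) s = stake g s @ stake (j * g) (sdrop g s)" by (rule stake_add[symmetric])
  then show ?case using Suc assms by simp
qed simp

text \<open>Bezout without subtraction: a multiple of m equals a multiple of n plus the gcd. Both
  multiples are periods, so the gcd is one too. Positivity of m guarantees this form of the
  identity.\<close>

lemma sdrop_gcd:
  assumes "sdrop m s = s" "sdrop n s = s" "m > 0"
  shows "sdrop (gcd m n) s = s"
proof -
  have mult: "sdrop (k * l) s = s" if "sdrop l s = s" for k l
  proof (induction k)
    case (Suc k)
    then show ?case using that by (simp flip: sdrop_add)
  qed simp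
  obtain x y where "m * x = n * y + gcd m n" using bezout_nat[of m n] assms(3) by blast
  then have "sdrop (gcd m n) (sdrop (y * n) s) = sdrop (x * m) s"
    by (simp add: sdrop_add mult.commute)
  then show ?thesis unfolding mult[OF assms(1)] mult[OF assms(2)] .
qed

lemma (in fin_digraph) awalk_stake:
  assumes "InfPath t \<in> bpaths G"
  shows "awalk (tail G (t !! 0)) (stake n t) (tail G (t !! n))"
  using assms
proof (induction n arbitrary: t)
  case 0
  then have "shd t \<in> arcs G" by (auto simp: bpaths_def dest: spec[of _ 0])
  then show ?case by (simp add: awalk_def)
next
  case (Suc n)
  have t: "t !! i \<in> arcs G \<and> head G (t !! i) = tail G (t !! Suc i)" for i
    using Suc.prems by (auto simp: bpaths_def)
  have "InfPath (stl t) \<in> bpaths G" using t by (auto simp: bpaths_def simp flip: snth.simps(2))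
  from Suc.IH[OF this] have "awalk (tail G (stl t !! 0)) (stake n (stl t)) (tail G (t !! Suc n))" by simp
  then show ?case using t[of 0] by (auto simp: awalk_def)
qed

locale leavitt_cycle = leavitt G K
  for G :: "('v, 'e) pre_digraph" and K :: "'k::field itself" +
  fixes d :: "'e list"
  assumes d: "simple_closed_path G d"
begin

section \<open>The periodic path and its tail class\<close>

definition v\<^sub>0 :: 'v where "v\<^sub>0 = tail G (hd d)"
definition dinf :: "('v, 'e) bpath" where "dinf = InfPath (Stream.cycle d)"

lemma d_walk: "awalk v\<^sub>0 d v\<^sub>0" "d \<noteq> []" "v\<^sub>0 \<in> verts G"
proof -
  obtain u where u: "awalk u d u" "d \<noteq> []" using d by (auto simp: simple_closed_path_def closed_w_def)
  moreover have "u = tail G (hd d)" using u by (cases d) (auto simp: awalk_def)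
  then have "u = v\<^sub>0" by (simp add: v\<^sub>0_def)
  ultimately show "awalk v\<^sub>0 d v\<^sub>0" "d \<noteq> []" "v\<^sub>0 \<in> verts G" by (auto simp: awalk_def)
qed

lemma sdrop_cycle_d: "sdrop (n * length d) (Stream.cycle d) = Stream.cycle d"
  by (simp add: sdrop_cycle d_walk(2))

lemma snth_cycle_d: "Stream.cycle d !! 0 = hd d"
  by (simp add: Stream.cycle.sel d_walk(2))

lemma bsource_bappend_walk: "awalk u \<alpha> (bsource G p) \<Longrightarrow> bsource G (bappend \<alpha> p) = u"
  by (cases \<alpha>; cases p) (auto simp: awalk_def bappend_Nil)

lemma bappend_walk_closed:
  assumes "p \<in> bpaths G" "awalk u \<alpha> (bsource G p)"
  shows "bappend \<alpha> p \<in> bpaths G"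
  using assms(2)
proof (induction \<alpha> arbitrary: u)
  case Nil
  then show ?case using assms(1) by (simp add: bappend_Nil)
next
  case (Cons e \<alpha>)
  then have w: "e \<in> arcs G" "awalk (head G e) \<alpha> (bsource G p)" by (auto simp: awalk_def)
  have "bappend [e] (bappend \<alpha> p) \<in> bpaths G"
    using Cons.IH[OF w(2)] w by (intro bappend_closed) (simp_all add: bsource_bappend_walk)
  then show ?case by (simp flip: bappend_append)
qed

lemma bappend_closedD: "bappend \<alpha> p \<in> bpaths G \<Longrightarrow> p \<in> bpaths G"
proof (induction \<alpha>)
  case (Cons e \<alpha>)
  have "bappend (e # \<alpha>) p = bappend [e] (bappend \<alpha> p)" by (simp flip: bappend_append)
  then have "bappend \<alpha> p \<in> bpaths G" using btail_closed[OF Cons.prems] by (simp add: btail_bappend)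
  then show ?case by (rule Cons.IH)
qed (simp add: bappend_Nil)

lemma bappend_walk_source:
  assumes "bappend \<alpha> p \<in> bpaths G" "awalk u \<alpha> w" "\<alpha> \<noteq> []"
  shows "bsource G p = w"
proof -
  obtain \<beta> e where \<alpha>: "\<alpha> = \<beta> @ [e]" using assms(3) by (metis append_butlast_last_id)
  have "bappend [e] p \<in> bpaths G" using assms(1) bappend_closedD unfolding \<alpha> bappend_append by blast
  then have "head G e = bsource G p" by (rule bpaths_edge_source(2))
  moreover have "head G e = w" using assms(2) by (auto simp: \<alpha> awalk_def awlast_append)
  ultimately show ?thesis by simp
qed

lemma d_edges:
  assumes "i < length d"
  shows "d ! i \<in> arcs G" "head G (d ! i) = tail G (d ! (Suc i mod length d))"
proof -
  have *: "i < length \<alpha> \<Longrightarrow> awalk u \<alpha> w \<Longrightarrow> \<alpha> ! i \<in> arcs G \<and>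
      head G (\<alpha> ! i) = (if Suc i = length \<alpha> then w else tail G (\<alpha> ! Suc i))" for \<alpha> u w
  proof (induction \<alpha> arbitrary: u i)
    case (Cons e \<alpha>)
    then have c: "e \<in> arcs G" "awalk (head G e) \<alpha> w" by (auto simp: awalk_def)
    show ?case
    proof (cases i)
      case 0
      have "head G e = (if \<alpha> = [] then w else tail G (\<alpha> ! 0))" using c by (cases \<alpha>) (auto simp: awalk_def)
      then show ?thesis using 0 c by simp
    next
      case (Suc j)
      then show ?thesis using Cons.IH[OF _ c(2), of j] Cons.prems by simp
    qed
  qed simp
  show "d ! i \<in> arcs G" "head G (d ! i) = tail G (d ! (Suc i mod length d))"
    using *[OF assms d_walk(1)] assms d_walk(2)
    by (auto simp: v\<^sub>0_def hd_conv_nth mod_if)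
qed

lemma dinf_closed: "dinf \<in> bpaths G"
proof -
  have "Stream.cycle d !! n \<in> arcs G \<and> head G (Stream.cycle d !! n) = tail G (Stream.cycle d !! Suc n)" for n
  proof -
    have nth: "Stream.cycle d !! n = d ! (n mod length d)" for n
    proof -
      have "Stream.cycle d !! n = shd (Stream.cycle (rotate (n mod length d) d))"
        by (simp only: sdrop_simps(1)[symmetric] sdrop_cycle[OF d_walk(2)])
      then show ?thesis using d_walk(2) by (simp add: Stream.cycle.sel hd_rotate_conv_nth)
    qed
    show ?thesis unfolding nth using d_edges[of "n mod length d"] d_walk(2) by (simp add: mod_Suc_eq)
  qed
  then show ?thesis by (auto simp: bpaths_def dinf_def)
qed

lemma bsource_dinf: "bsource G dinf = v\<^sub>0"
  using snth_cycle_d by (simp add: dinf_def v\<^sub>0_def)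

lemma bappend_d_dinf: "bappend d dinf = dinf"
  using cycle_decomp[OF d_walk(2)] by (simp add: dinf_def)

text \<open>This is where \<open>d\<close> has to be simple: a shorter period of \<open>d\<^sup>\<infinity>\<close> would exhibit \<open>d\<close> as a power.\<close>

lemma shift_fixes_dinf:
  assumes "bappend \<gamma> dinf = dinf"
  shows "\<exists>k. \<gamma> = concat (replicate k d)"
proof -
  let ?c = "Stream.cycle d" and ?n = "length \<gamma>" and ?m = "length d"
  \<comment> \<open>Both lengths are periods of the stream, hence so is their gcd, and d is a power
    of the initial segment of that length.\<close>
  define g where "g = gcd ?m ?n"
  have m: "?m > 0" using d_walk(2) by simp
  have c: "\<gamma> @- ?c = ?c" using assms by (simp add: dinf_def)
  then have "sdrop ?n ?c = ?c" by (metis sdrop_shift drop_all order.refl shift.simps(1) diff_self_eq_0 sdrop.simps(1))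
  then have g: "sdrop g ?c = ?c" unfolding g_def using sdrop_gcd[of ?m ?c ?n] sdrop_cycle_d[of 1] m by simp
  have "g > 0" using m by (simp add: g_def)
  define \<beta> where "\<beta> = stake g ?c"
  have "g dvd ?m" by (simp add: g_def)
  then obtain j where j: "?m = j * g" by (auto simp: dvd_def mult.commute)
  have "stake ?m ?c = d" by (metis cycle_decomp[OF d_walk(2)] stake_shift take_all order.refl diff_self_eq_0 stake.simps(1) append_Nil2)
  then have d_eq: "d = concat (replicate j \<beta>)" unfolding j \<beta>_def stake_periodic[OF g] by simp
  \<comment> \<open>The edges at positions 0 and g agree by periodicity, so the segment returns to
    its starting vertex.\<close>
  have "closed_w \<beta>"
  proof -
    have "?c !! g = ?c !! 0" using g by (metis sdrop_simps(1) snth.simps(1))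
    then have "awalk (tail G (?c !! 0)) \<beta> (tail G (?c !! 0))"
      using awalk_stake[of ?c g] dinf_closed by (simp add: dinf_def \<beta>_def)
    then show ?thesis using \<open>g > 0\<close> by (auto simp: closed_w_def \<beta>_def)
  qed
  \<comment> \<open>Simplicity rules out j at least 2, and j = 0 would make d empty. So j = 1, and
    \<open>length d\<close> divides \<open>length \<gamma>\<close>.\<close>
  then have "j < 2" using d d_eq by (auto simp: simple_closed_path_def not_le[symmetric])
  then have "g = ?m" using j m by (cases j) auto
  then have "?m dvd ?n" by (metis g_def gcd_dvd2)
  then obtain k where k: "?n = k * ?m" by (auto simp: dvd_def mult.commute)
  have "\<gamma> = stake ?n ?c" by (metis c stake_shift take_all order.refl diff_self_eq_0 stake.simps(1) append_Nil2)
  also have "\<dots> = concat (replicate k (stake ?m ?c))"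
    unfolding k by (rule stake_periodic) (use sdrop_cycle_d[of 1] in simp)
  finally show ?thesis using \<open>stake ?m ?c = d\<close> by auto
qed

lemma dinf_class_walk:
  assumes "p \<in> tail_class G dinf"
  shows "\<exists>\<alpha>. awalk (bsource G p) \<alpha> v\<^sub>0 \<and> p = bappend \<alpha> dinf"
proof -
  obtain m n where mn: "(btail ^^ m) p = (btail ^^ n) dinf" and p: "p \<in> bpaths G"
    using assms by (auto simp: tail_class_def tail_equiv_def)
  obtain t where t: "p = InfPath t"
  proof (cases p)
    case (SinkPath \<alpha> w)
    have "\<exists>\<alpha>'. (btail ^^ m) p = SinkPath \<alpha>' w" by (induction m) (auto simp: SinkPath)
    then show ?thesis using mn by (auto simp: dinf_def btail_funpow_InfPath)
  qed
  have eq: "sdrop m t = sdrop n (Stream.cycle d)" using mn by (simp add: t dinf_def btail_funpow_InfPath)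
  \<comment> \<open>Padding n to a multiple of \<open>length d\<close> makes the common tail start
    at the beginning of a copy of d; natural subtraction is exact here because d is
    nonempty.\<close>
  define k where "k = n * length d - n"
  have "n + k = n * length d" unfolding k_def using d_walk(2) by (cases "length d") auto
  have "sdrop (m + k) t = sdrop (n + k) (Stream.cycle d)" by (simp add: eq flip: sdrop_add)
  then have tl: "sdrop (m + k) t = Stream.cycle d" unfolding \<open>n + k = n * length d\<close> sdrop_cycle_d .
  have "t !! (m + k) = hd d" using tl snth_cycle_d by (metis sdrop_simps(1) snth.simps(1))
  then have "awalk (bsource G p) (stake (m + k) t) v\<^sub>0"
    using awalk_stake[of t "m + k"] p by (simp add: t v\<^sub>0_def)
  moreover have "p = bappend (stake (m + k) t) dinf"
    by (simp add: t dinf_def stake_sdrop flip: tl)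
  ultimately show ?thesis by blast
qed

lemma dinf_class: "dinf \<in> tail_class G dinf"
  by (simp add: tail_class_def dinf_closed tail_equiv_refl)

text \<open>By \<open>shift_fixes_dinf\<close> such a walk is unique up to appending powers of d, a
  difference that disappears modulo Ls. The choice supplies representatives for the classes in Lv
  modulo Ls.\<close>

definition walk_to :: "('v, 'e) bpath \<Rightarrow> 'e list" where
  "walk_to p = (SOME \<alpha>. awalk (bsource G p) \<alpha> v\<^sub>0 \<and> p = bappend \<alpha> dinf)"

lemma walk_to:
  assumes "p \<in> tail_class G dinf"
  shows "awalk (bsource G p) (walk_to p) v\<^sub>0" "p = bappend (walk_to p) dinf"
  using someI_ex[OF dinf_class_walk[OF assms]] unfolding walk_to_def by auto

text \<open>The final vertex keeps the element inside the corner: the empty walk yields v and not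
  the identity of L.\<close>

definition path_word :: "'e list \<Rightarrow> ('v, 'e) lpa_gen list" where
  "path_word \<alpha> = map Edge \<alpha> @ [Vertex v\<^sub>0]"

lemma path_word_closed:
  assumes "awalk u \<alpha> v\<^sub>0"
  shows "set (path_word \<alpha>) \<subseteq> lpa_gens G"
  using assms d_walk(3) by (auto simp: path_word_def lpa_gens_iff awalk_def)

section \<open>Multiplying path elements by generators\<close>

abbreviation "V u \<equiv> wcl [Vertex u]"

lemma gen_closed: "g \<in> lpa_gens G \<Longrightarrow> wcl [g] \<in> carrier LA"
  by (rule wcls_closed) simp

lemma wcl_Cons:
  assumes "g \<in> lpa_gens G" "set u \<subseteq> lpa_gens G"
  shows "wcl (g # u) = wcl [g] \<otimes>\<^bsub>LA\<^esub> wcl u"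
  using wcls_append[of "[g]" u K] assms by simp

lemma V_mult:
  assumes "u \<in> verts G" "w \<in> verts G"
  shows "V u \<otimes>\<^bsub>LA\<^esub> V w = (if u = w then V u else \<zero>\<^bsub>LA\<^esub>)"
proof -
  have "V u \<otimes>\<^bsub>LA\<^esub> V w = wcl [Vertex u, Vertex w]" using assms by (intro wcl_Cons[symmetric]) (auto simp: lpa_gens_iff)
  also have "\<dots> = (if u = w then V u else \<zero>\<^bsub>LA\<^esub>)"
    using cls_eqI[OF lpa_rel.V[OF assms], where K = K] cls_zero[of K] by (auto simp: lpa_simps(5))
  finally show ?thesis .
qed

lemma edge_mult:
  assumes e: "e \<in> arcs G"
  shows "V (tail G e) \<otimes>\<^bsub>LA\<^esub> wcl [Edge e] = wcl [Edge e]" "wcl [Edge e] \<otimes>\<^bsub>LA\<^esub> V (head G e) = wcl [Edge e]"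
    "wcl [Ghost e] \<otimes>\<^bsub>LA\<^esub> V (tail G e) = wcl [Ghost e]"
proof -
  have "Vertex (tail G e) \<in> lpa_gens G" "Vertex (head G e) \<in> lpa_gens G" "Edge e \<in> lpa_gens G" "Ghost e \<in> lpa_gens G"
    using e by (simp_all add: lpa_gens_iff)
  then show "V (tail G e) \<otimes>\<^bsub>LA\<^esub> wcl [Edge e] = wcl [Edge e]" "wcl [Edge e] \<otimes>\<^bsub>LA\<^esub> V (head G e) = wcl [Edge e]"
    "wcl [Ghost e] \<otimes>\<^bsub>LA\<^esub> V (tail G e) = wcl [Ghost e]"
    using cls_eqI[OF lpa_rel.E1_source[OF e], where K = K] cls_eqI[OF lpa_rel.E1_range[OF e], where K = K]
      cls_eqI[OF lpa_rel.E2_source[OF e], where K = K] by (simp_all flip: wcl_Cons)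
qed

lemma ghost_edge_mult:
  assumes e: "e \<in> arcs G" "e' \<in> arcs G"
  shows "wcl [Ghost e] \<otimes>\<^bsub>LA\<^esub> wcl [Edge e'] = (if e = e' then V (head G e) else \<zero>\<^bsub>LA\<^esub>)"
proof -
  have "wcl [Ghost e] \<otimes>\<^bsub>LA\<^esub> wcl [Edge e'] = wcl [Ghost e, Edge e']"
    using e by (intro wcl_Cons[symmetric]) (auto simp: lpa_gens_iff)
  also have "\<dots> = (if e = e' then V (head G e) else \<zero>\<^bsub>LA\<^esub>)"
    using cls_eqI[OF lpa_rel.CK1[OF e], where K = K] cls_zero[of K] by (auto simp: lpa_simps(5))
  finally show ?thesis .
qed

abbreviation "pe \<alpha> \<equiv> wcl (path_word \<alpha>)"

lemma pe_closed: "awalk u \<alpha> v\<^sub>0 \<Longrightarrow> pe \<alpha> \<in> carrier LA"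
  by (rule wcls_closed[OF path_word_closed])

lemma pe_Cons:
  assumes "awalk u (e # \<alpha>) v\<^sub>0"
  shows "pe (e # \<alpha>) = wcl [Edge e] \<otimes>\<^bsub>LA\<^esub> pe \<alpha>"
proof -
  have "e \<in> arcs G" "awalk (head G e) \<alpha> v\<^sub>0" using assms by (auto simp: awalk_def)
  then show ?thesis
    using wcl_Cons[of "Edge e" "path_word \<alpha>"] path_word_closed by (auto simp: path_word_def lpa_gens_iff)
qed

lemma V_pe:
  assumes \<alpha>: "awalk u \<alpha> v\<^sub>0" and w: "w \<in> verts G"
  shows "V w \<otimes>\<^bsub>LA\<^esub> pe \<alpha> = (if w = u then pe \<alpha> else \<zero>\<^bsub>LA\<^esub>)"
proof (cases \<alpha>)
  case Nil
  then show ?thesis using \<alpha> V_mult[OF w d_walk(3)] by (auto simp: path_word_def awalk_def)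
next
  case (Cons e \<beta>)
  then have e: "e \<in> arcs G" "awalk (head G e) \<beta> v\<^sub>0" "u = tail G e" "awalk u (e # \<beta>) v\<^sub>0"
    using \<alpha> by (auto simp: awalk_def)
  note c = gen_closed[of "Vertex w"] gen_closed[of "Vertex u"] gen_closed[of "Edge e"] pe_closed[OF e(2)]
  have "V w \<otimes>\<^bsub>LA\<^esub> pe \<alpha> = V w \<otimes>\<^bsub>LA\<^esub> ((V u \<otimes>\<^bsub>LA\<^esub> wcl [Edge e]) \<otimes>\<^bsub>LA\<^esub> pe \<beta>)"
    unfolding Cons pe_Cons[OF e(4)] e(3) edge_mult(1)[OF e(1)] ..
  also have "\<dots> = (V w \<otimes>\<^bsub>LA\<^esub> V u) \<otimes>\<^bsub>LA\<^esub> (wcl [Edge e] \<otimes>\<^bsub>LA\<^esub> pe \<beta>)"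
    using c w e by (simp add: lpa_gens_iff LA.m_assoc)
  also have "\<dots> = (if w = u then V u \<otimes>\<^bsub>LA\<^esub> wcl [Edge e] \<otimes>\<^bsub>LA\<^esub> pe \<beta> else \<zero>\<^bsub>LA\<^esub>)"
    using c w e by (simp add: V_mult lpa_gens_iff LA.m_assoc)
  finally show ?thesis unfolding Cons pe_Cons[OF e(4)] using e(3) edge_mult(1)[OF e(1)] by simp
qed

text \<open>If the range of the edge is not the source of the path, inserting that range vertex
  between the two factors kills the product.\<close>

lemma edge_pe:
  assumes \<alpha>: "awalk u \<alpha> v\<^sub>0" and e: "e \<in> arcs G"
  shows "wcl [Edge e] \<otimes>\<^bsub>LA\<^esub> pe \<alpha> = (if head G e = u then pe (e # \<alpha>) else \<zero>\<^bsub>LA\<^esub>)"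
proof (cases "head G e = u")
  case True
  then have "awalk (tail G e) (e # \<alpha>) v\<^sub>0" using \<alpha> e by (auto simp: awalk_def)
  then show ?thesis using True pe_Cons by simp
next
  case False
  have c: "wcl [Edge e] \<in> carrier LA" "V (head G e) \<in> carrier LA" "pe \<alpha> \<in> carrier LA"
    using e \<alpha> by (auto intro!: gen_closed pe_closed simp: lpa_gens_iff)
  have "wcl [Edge e] \<otimes>\<^bsub>LA\<^esub> pe \<alpha> = wcl [Edge e] \<otimes>\<^bsub>LA\<^esub> (V (head G e) \<otimes>\<^bsub>LA\<^esub> pe \<alpha>)"
    using c edge_mult(2)[OF e] by (metis LA.m_assoc)
  then show ?thesis using False V_pe[OF \<alpha>, of "head G e"] e c by simp
qed

text \<open>With \<open>V_pe\<close> and \<open>edge_pe\<close> this reproduces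
  \<open>gen_act\<close> inside L, except that a ghost edge can be evaluated only against a nonempty
  path.\<close>

lemma ghost_pe:
  assumes \<alpha>: "awalk u (e' # \<alpha>) v\<^sub>0" and e: "e \<in> arcs G"
  shows "wcl [Ghost e] \<otimes>\<^bsub>LA\<^esub> pe (e' # \<alpha>) = (if e = e' then pe \<alpha> else \<zero>\<^bsub>LA\<^esub>)"
proof -
  have e': "e' \<in> arcs G" "awalk (head G e') \<alpha> v\<^sub>0" using \<alpha> by (auto simp: awalk_def)
  have "wcl [Ghost e] \<otimes>\<^bsub>LA\<^esub> pe (e' # \<alpha>) = (wcl [Ghost e] \<otimes>\<^bsub>LA\<^esub> wcl [Edge e']) \<otimes>\<^bsub>LA\<^esub> pe \<alpha>"
    unfolding pe_Cons[OF \<alpha>] using e e' by (intro LA.m_assoc[symmetric] gen_closed pe_closed) (auto simp: lpa_gens_iff)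
  then show ?thesis
    unfolding ghost_edge_mult[OF e e'(1)] using V_pe[OF e'(2), of "head G e"] e e' pe_closed[OF e'(2)]
    by (cases "e = e'") simp_all
qed

end

section \<open>The annihilator of the periodic path\<close>

context leavitt_cycle
begin

abbreviation "D \<equiv> wcl (map Edge d)"
abbreviation "s \<equiv> D \<ominus>\<^bsub>LA\<^esub> V v\<^sub>0"
abbreviation "CM \<equiv> chen_module K G"

lemma walk_gens: "awalk u \<alpha> w \<Longrightarrow> set (map Edge \<alpha>) \<subseteq> lpa_gens G"
  by (auto simp: lpa_gens_iff awalk_def)

lemma V_closed: "V v\<^sub>0 \<in> carrier LA"
  using d_walk(3) by (intro gen_closed) (simp add: lpa_gens_iff)

lemma D_closed: "D \<in> carrier LA"
  by (rule wcls_closed[OF walk_gens[OF d_walk(1)]])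

lemma s_closed: "s \<in> carrier LA"
  using D_closed V_closed by simp

lemma VV: "V v\<^sub>0 \<otimes>\<^bsub>LA\<^esub> V v\<^sub>0 = V v\<^sub>0"
  using V_mult[OF d_walk(3) d_walk(3)] by simp

lemma VD: "V v\<^sub>0 \<otimes>\<^bsub>LA\<^esub> D = D"
proof -
  obtain e \<alpha> where d_eq: "d = e # \<alpha>" using d_walk(2) by (cases d) auto
  then have e: "e \<in> arcs G" "v\<^sub>0 = tail G e" and g: "set (map Edge \<alpha>) \<subseteq> lpa_gens G"
    using d_walk(1) by (auto simp: awalk_def lpa_gens_iff)
  have "D = wcl [Edge e] \<otimes>\<^bsub>LA\<^esub> wcl (map Edge \<alpha>)"
    using wcl_Cons[of "Edge e" "map Edge \<alpha>"] e(1) g by (simp add: d_eq lpa_gens_iff)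
  moreover have "wcl [Edge e] \<in> carrier LA" "wcl (map Edge \<alpha>) \<in> carrier LA"
    using e(1) g by (auto intro!: gen_closed wcls_closed simp: lpa_gens_iff)
  ultimately show ?thesis using V_closed edge_mult(1)[OF e(1)] e(2) by (metis LA.m_assoc)
qed

lemma DV: "D \<otimes>\<^bsub>LA\<^esub> V v\<^sub>0 = D"
proof -
  obtain e \<alpha> where d_eq: "d = \<alpha> @ [e]" using d_walk(2) by (metis append_butlast_last_id)
  then have e: "e \<in> arcs G" "v\<^sub>0 = head G e" and g: "set (map Edge \<alpha>) \<subseteq> lpa_gens G"
    using d_walk(1) by (auto simp: awalk_def lpa_gens_iff)
  have "D = wcl (map Edge \<alpha>) \<otimes>\<^bsub>LA\<^esub> wcl [Edge e]"
    using wcls_append[of "map Edge \<alpha>" "[Edge e]" K] e(1) g by (simp add: d_eq lpa_gens_iff)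
  moreover have "wcl [Edge e] \<in> carrier LA" "wcl (map Edge \<alpha>) \<in> carrier LA"
    using e(1) g by (auto intro!: gen_closed wcls_closed simp: lpa_gens_iff)
  ultimately show ?thesis using V_closed edge_mult(2)[OF e(1)] e(2) by (metis LA.m_assoc)
qed

lemma Vs: "V v\<^sub>0 \<otimes>\<^bsub>LA\<^esub> s = s" and sV: "s \<otimes>\<^bsub>LA\<^esub> V v\<^sub>0 = s"
  using V_closed D_closed
  by (simp_all add: LA.minus_eq LA.r_distr LA.l_distr LA.r_minus LA.l_minus VD DV VV)

section \<open>Congruence modulo the left ideal Ls\<close>

definition eqv where
  "eqv x y \<longleftrightarrow> x \<in> carrier LA \<and> y \<in> carrier LA \<and> (\<exists>c \<in> carrier LA. x = y \<oplus>\<^bsub>LA\<^esub> c \<otimes>\<^bsub>LA\<^esub> s)"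

lemma eqv_closed: "eqv x y \<Longrightarrow> x \<in> carrier LA" "eqv x y \<Longrightarrow> y \<in> carrier LA"
  by (auto simp: eqv_def)

lemma eqv_refl: "x \<in> carrier LA \<Longrightarrow> eqv x x"
  using s_closed by (auto simp: eqv_def intro!: bexI[of _ "\<zero>\<^bsub>LA\<^esub>"])

lemma eqv_sym:
  assumes "eqv x y" shows "eqv y x"
proof -
  obtain c where c: "c \<in> carrier LA" "x = y \<oplus>\<^bsub>LA\<^esub> c \<otimes>\<^bsub>LA\<^esub> s" and xy: "x \<in> carrier LA" "y \<in> carrier LA"
    using assms by (auto simp: eqv_def)
  have "y = x \<oplus>\<^bsub>LA\<^esub> (\<ominus>\<^bsub>LA\<^esub> c) \<otimes>\<^bsub>LA\<^esub> s"
    using c xy s_closed by (simp add: LA.l_minus LA.a_assoc LA.r_neg)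
  then show ?thesis using c xy by (auto simp: eqv_def)
qed

lemma eqv_add:
  assumes "eqv x y" "eqv x' y'" shows "eqv (x \<oplus>\<^bsub>LA\<^esub> x') (y \<oplus>\<^bsub>LA\<^esub> y')"
proof -
  obtain c where c: "c \<in> carrier LA" "x = y \<oplus>\<^bsub>LA\<^esub> c \<otimes>\<^bsub>LA\<^esub> s"
    using assms(1) by (auto simp: eqv_def)
  obtain c' where c': "c' \<in> carrier LA" "x' = y' \<oplus>\<^bsub>LA\<^esub> c' \<otimes>\<^bsub>LA\<^esub> s"
    using assms(2) by (auto simp: eqv_def)
  note cl = eqv_closed[OF assms(1)] eqv_closed[OF assms(2)]
  have "x \<oplus>\<^bsub>LA\<^esub> x' = y \<oplus>\<^bsub>LA\<^esub> y' \<oplus>\<^bsub>LA\<^esub> (c \<oplus>\<^bsub>LA\<^esub> c') \<otimes>\<^bsub>LA\<^esub> s"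
    unfolding c(2) c'(2) using c(1) c'(1) cl s_closed by (simp add: LA.l_distr LA.a_ac)
  then show ?thesis using c(1) c'(1) cl s_closed by (auto simp: eqv_def)
qed

lemma eqv_trans:
  assumes "eqv x y" "eqv y z" shows "eqv x z"
proof -
  obtain c where c: "c \<in> carrier LA" "x = y \<oplus>\<^bsub>LA\<^esub> c \<otimes>\<^bsub>LA\<^esub> s"
    using assms(1) by (auto simp: eqv_def)
  obtain c' where c': "c' \<in> carrier LA" "y = z \<oplus>\<^bsub>LA\<^esub> c' \<otimes>\<^bsub>LA\<^esub> s"
    using assms(2) by (auto simp: eqv_def)
  note cl = eqv_closed[OF assms(1)] eqv_closed[OF assms(2)]
  have "x = z \<oplus>\<^bsub>LA\<^esub> (c \<oplus>\<^bsub>LA\<^esub> c') \<otimes>\<^bsub>LA\<^esub> s"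
    unfolding c(2) c'(2) using c(1) c'(1) cl s_closed by (simp add: LA.l_distr LA.a_ac)
  then show ?thesis using c(1) c'(1) cl s_closed by (auto simp: eqv_def)
qed

lemma eqv_left:
  assumes "eqv x y" "a \<in> carrier LA" shows "eqv (a \<otimes>\<^bsub>LA\<^esub> x) (a \<otimes>\<^bsub>LA\<^esub> y)"
proof -
  obtain c where c: "c \<in> carrier LA" "x = y \<oplus>\<^bsub>LA\<^esub> c \<otimes>\<^bsub>LA\<^esub> s"
    using assms(1) by (auto simp: eqv_def)
  note cl = eqv_closed[OF assms(1)]
  have "a \<otimes>\<^bsub>LA\<^esub> x = a \<otimes>\<^bsub>LA\<^esub> y \<oplus>\<^bsub>LA\<^esub> (a \<otimes>\<^bsub>LA\<^esub> c) \<otimes>\<^bsub>LA\<^esub> s"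
    unfolding c(2) using c(1) cl s_closed assms(2) by (simp add: LA.r_distr LA.m_assoc)
  then show ?thesis using c(1) cl assms(2) s_closed by (auto simp: eqv_def)
qed

text \<open>The difference of the two sides is the path \<alpha> times d - v.\<close>

lemma pe_append_d:
  assumes \<alpha>: "awalk u \<alpha> v\<^sub>0"
  shows "eqv (pe (\<alpha> @ d)) (pe \<alpha>)"
proof -
  let ?A = "wcl (map Edge \<alpha>)"
  have A: "?A \<in> carrier LA" by (rule wcls_closed[OF walk_gens[OF \<alpha>]])
  have g: "set [Vertex v\<^sub>0] \<subseteq> lpa_gens G" using d_walk(3) by (simp add: lpa_gens_iff)
  have "pe \<alpha> = ?A \<otimes>\<^bsub>LA\<^esub> V v\<^sub>0"
    unfolding path_word_def by (rule wcls_append[OF walk_gens[OF \<alpha>] g])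
  moreover have "pe (\<alpha> @ d) = ?A \<otimes>\<^bsub>LA\<^esub> D"
    using wcls_append[OF walk_gens[OF \<alpha>], of "map Edge d @ [Vertex v\<^sub>0]" K] wcls_append[OF walk_gens[OF d_walk(1)] g, of K]
      walk_gens[OF d_walk(1)] g DV by (simp add: path_word_def)
  moreover have "?A \<otimes>\<^bsub>LA\<^esub> D = ?A \<otimes>\<^bsub>LA\<^esub> V v\<^sub>0 \<oplus>\<^bsub>LA\<^esub> ?A \<otimes>\<^bsub>LA\<^esub> s"
    using A D_closed V_closed
    by (simp add: LA.minus_eq LA.r_distr LA.r_minus LA.a_lcomm[of "?A \<otimes>\<^bsub>LA\<^esub> V v\<^sub>0"] LA.r_neg)
  ultimately show ?thesis using A D_closed V_closed by (auto simp: eqv_def)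
qed

lemma pe_append_power:
  "awalk u \<alpha> v\<^sub>0 \<Longrightarrow> eqv (pe (\<alpha> @ concat (replicate k d))) (pe \<alpha>)"
proof (induction k arbitrary: \<alpha>)
  case 0
  then show ?case using eqv_refl[OF pe_closed] by simp
next
  case (Suc k)
  have "awalk u (\<alpha> @ d) v\<^sub>0" using Suc.prems d_walk(1) by (rule awalk_appendI)
  from Suc.IH[OF this] pe_append_d[OF Suc.prems] show ?case by (auto intro: eqv_trans)
qed

text \<open>Two walks with the same infinite completion are initial segments of one stream, so the
  shorter is a prefix of the longer. The remaining piece fixes \<open>dinf\<close>, hence is a power
  of d, and powers of d are absorbed modulo Ls.\<close>

lemma pe_cong:
  assumes \<alpha>: "awalk u \<alpha> v\<^sub>0" and \<beta>: "awalk w \<beta> v\<^sub>0" and eq: "bappend \<alpha> dinf = bappend \<beta> dinf"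
  shows "eqv (pe \<alpha>) (pe \<beta>)"
proof -
  have *: "eqv (pe \<beta>) (pe \<alpha>)"
    if le: "length \<alpha> \<le> length \<beta>" and \<alpha>: "awalk u \<alpha> v\<^sub>0" and eq: "bappend \<alpha> dinf = bappend \<beta> dinf" for u \<alpha> \<beta>
  proof -
    have shift: "\<alpha> @- Stream.cycle d = \<beta> @- Stream.cycle d" using eq by (simp add: dinf_def)
    have "\<alpha> = stake (length \<alpha>) (\<alpha> @- Stream.cycle d)" by (simp add: stake_shift)
    also have "\<dots> = take (length \<alpha>) \<beta>" unfolding shift using le by (simp add: stake_shift)
    finally obtain \<gamma> where \<gamma>: "\<beta> = \<alpha> @ \<gamma>" by (metis append_take_drop_id)
    then have "bappend \<gamma> dinf = dinf" using eq by (simp add: bappend_append bappend_inject)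
    then obtain k where "\<gamma> = concat (replicate k d)" using shift_fixes_dinf by blast
    then show ?thesis using pe_append_power[OF \<alpha>] \<gamma> by simp
  qed
  show ?thesis
  proof (cases "length \<alpha> \<le> length \<beta>")
    case True
    then show ?thesis using *[OF _ \<alpha> eq] eqv_sym by blast
  next
    case False
    then show ?thesis using *[OF _ \<beta> eq[symmetric]] by simp
  qed
qed

lemma bappend_dinf_class:
  assumes "awalk u \<alpha> v\<^sub>0"
  shows "bappend \<alpha> dinf \<in> tail_class G dinf"
  using bappend_walk_closed[OF dinf_closed, of u \<alpha>] assms
  by (simp add: tail_class_def bsource_dinf tail_equiv_bappend tail_equiv_refl)

section \<open>Chosen representatives and the action of words on them\<close>

abbreviation "rep p \<equiv> pe (walk_to p)"

lemma rep_closed: "p \<in> tail_class G dinf \<Longrightarrow> rep p \<in> carrier LA"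
  by (rule pe_closed[OF walk_to(1)])

lemma pe_rep: "awalk u \<alpha> v\<^sub>0 \<Longrightarrow> eqv (pe \<alpha>) (rep (bappend \<alpha> dinf))"
  using pe_cong[OF _ walk_to(1) walk_to(2)] bappend_dinf_class by blast

abbreviation "rep_opt r \<equiv> (case r of None \<Rightarrow> \<zero>\<^bsub>LA\<^esub> | Some p \<Rightarrow> rep p)"

text \<open>Modulo Ls, left multiplication on the chosen representatives copies the action on basis
  paths. The product is computed exactly; \<open>pe_rep\<close> then replaces the resulting walk by
  the chosen one.\<close>

lemma gen_rep:
  assumes g: "g \<in> lpa_gens G" and p: "p \<in> tail_class G dinf"
  shows "eqv (wcl [g] \<otimes>\<^bsub>LA\<^esub> rep p) (rep_opt (gen_act G g p))"
proof (cases g)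
  case (Vertex w)
  then have "w \<in> verts G" using g by (simp add: lpa_gens_iff)
  then show ?thesis using V_pe[OF walk_to(1)[OF p]] rep_closed[OF p] by (auto simp: Vertex intro: eqv_refl)
next
  case (Edge e)
  then have e: "e \<in> arcs G" using g by (simp add: lpa_gens_iff)
  show ?thesis
  proof (cases "head G e = bsource G p")
    case True
    then have "awalk (tail G e) (e # walk_to p) v\<^sub>0" using walk_to(1)[OF p] e by (auto simp: awalk_def)
    from pe_rep[OF this] show ?thesis
      using True edge_pe[OF walk_to(1)[OF p] e] walk_to(2)[OF p] bappend_append[of "[e]" "walk_to p" dinf]
      by (simp add: Edge)
  next
    case False
    then show ?thesis using edge_pe[OF walk_to(1)[OF p] e] by (auto simp: Edge intro: eqv_refl)
  qed
next
  case (Ghost e)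
  then have e: "e \<in> arcs G" using g by (simp add: lpa_gens_iff)
  \<comment> \<open>A ghost edge needs an edge to cancel. If the chosen walk is empty, then p is
    \<open>dinf\<close>, and d is a nonempty walk with the same completion.\<close>
  have "\<exists>\<alpha>. awalk (bsource G p) \<alpha> v\<^sub>0 \<and> p = bappend \<alpha> dinf \<and> \<alpha> \<noteq> []"
  proof (cases "walk_to p = []")
    case True
    then have "p = dinf" using walk_to(2)[OF p] by (simp add: bappend_Nil)
    show ?thesis
      by (rule exI[of _ d]) (simp only: \<open>p = dinf\<close> bsource_dinf bappend_d_dinf d_walk(1,2) not_False_eq_True simp_thms)
  next
    case False
    then show ?thesis using walk_to[OF p] by blast
  qed
  then obtain e' \<beta> where \<alpha>: "awalk (bsource G p) (e' # \<beta>) v\<^sub>0" "p = bappend (e' # \<beta>) dinf"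
    by (metis neq_Nil_conv)
  then have \<beta>: "awalk (head G e') \<beta> v\<^sub>0" by (auto simp: awalk_def)
  have 1: "eqv (wcl [g] \<otimes>\<^bsub>LA\<^esub> rep p) (wcl [g] \<otimes>\<^bsub>LA\<^esub> pe (e' # \<beta>))"
    by (rule eqv_left[OF eqv_sym[OF pe_rep[OF \<alpha>(1), folded \<alpha>(2)]] gen_closed[OF g]])
  have "wcl [g] \<otimes>\<^bsub>LA\<^esub> pe (e' # \<beta>) = (if e = e' then pe \<beta> else \<zero>\<^bsub>LA\<^esub>)"
    unfolding Ghost by (rule ghost_pe[OF \<alpha>(1) e])
  note 1 = 1[unfolded this]
  have p_eq: "p = bappend [e'] (bappend \<beta> dinf)" using \<alpha>(2) by (simp flip: bappend_append)
  have "bappend [e'] p' = bappend [e] p' \<longleftrightarrow> e = e'" for p' :: "('v, 'e) bpath"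
    by (cases p') auto
  then have "gen_act G g p = (if e = e' then Some (bappend \<beta> dinf) else None)"
    by (simp add: Ghost p_eq btail_bappend)
  then show ?thesis using 1 pe_rep[OF \<beta>] by (auto intro: eqv_trans)
qed

lemma word_rep:
  assumes "set u \<subseteq> lpa_gens G"
  shows "eqv (wcl u \<otimes>\<^bsub>LA\<^esub> V v\<^sub>0) (rep_opt (word_act G u dinf))"
  using assms
proof (induction u)
  case Nil
  have "awalk v\<^sub>0 [] v\<^sub>0" using d_walk(3) by (simp add: awalk_def)
  from pe_rep[OF this] have "eqv (V v\<^sub>0) (rep dinf)" by (simp add: path_word_def bappend_Nil)
  moreover have "wcl [] \<otimes>\<^bsub>LA\<^esub> V v\<^sub>0 = V v\<^sub>0"
    using LA.l_one[OF V_closed] by (simp add: lpa_simps(4) free_algebra_simps(3))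
  ultimately show ?case by simp
next
  case (Cons g u)
  then have g: "g \<in> lpa_gens G" "set u \<subseteq> lpa_gens G" by simp_all
  have 1: "eqv (wcl (g # u) \<otimes>\<^bsub>LA\<^esub> V v\<^sub>0) (wcl [g] \<otimes>\<^bsub>LA\<^esub> rep_opt (word_act G u dinf))"
    unfolding wcl_Cons[OF g] LA.m_assoc[OF gen_closed[OF g(1)] wcls_closed[OF g(2)] V_closed]
    by (rule eqv_left[OF Cons.IH[OF g(2)] gen_closed[OF g(1)]])
  show ?case
  proof (cases "word_act G u dinf")
    case None
    then show ?thesis using 1 gen_closed[OF g(1)] by simp
  next
    case (Some p)
    then have "p \<in> tail_class G dinf" using word_act_closed[OF _ dinf_class Some] g(2) by auto
    from gen_rep[OF g(1) this] show ?thesis using 1 Some by (auto intro: eqv_trans)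
  qed
qed

section \<open>A linear section of evaluation at the periodic path\<close>

definition pword :: "('v, 'e) bpath \<Rightarrow> ('v, 'e) lpa_gen list" where
  "pword p = path_word (walk_to p)"

text \<open>The combination of the words \<open>pword p\<close> with coefficients
  \<open>f p\<close>, written as a coefficient function on words, hence the inverse of
  \<open>pword\<close>. It satisfies both \<open>generated_by_dinf\<close> and, modulo Ls,
  \<open>eqv_lift\<close>.\<close>

definition lift_elt :: "(('v, 'e) bpath \<Rightarrow> 'k) \<Rightarrow> ('v, 'e) lpa_gen list \<Rightarrow> 'k" where
  "lift_elt f u = (if u \<in> pword ` tail_class G dinf then f (the_inv_into (tail_class G dinf) pword u) else 0)"

lemma inj_pword: "inj_on pword (tail_class G dinf)"
proof (rule inj_onI)
  fix p q assume pq: "p \<in> tail_class G dinf" "q \<in> tail_class G dinf" "pword p = pword q"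
  have "inj (Edge :: 'e \<Rightarrow> ('v, 'e) lpa_gen)" by (rule injI) simp
  then have "walk_to p = walk_to q" using pq(3) by (simp add: pword_def path_word_def inj_map_eq_map)
  then show "p = q" using walk_to(2) pq(1,2) by metis
qed

lemma lift_elt_pword: "p \<in> tail_class G dinf \<Longrightarrow> lift_elt f (pword p) = f p"
  by (simp add: lift_elt_def the_inv_into_f_f[OF inj_pword])

lemma lift_elt_support: "{u. lift_elt f u \<noteq> 0} \<subseteq> pword ` {p \<in> tail_class G dinf. f p \<noteq> 0}"
proof
  fix u assume u: "u \<in> {u. lift_elt f u \<noteq> 0}"
  then obtain p where p: "p \<in> tail_class G dinf" "u = pword p"
    unfolding lift_elt_def mem_Collect_eq by (metis imageE)
  have "f p \<noteq> 0" using u unfolding p(2) mem_Collect_eq lift_elt_pword[OF p(1)] .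
  with p(1) show "u \<in> pword ` {p \<in> tail_class G dinf. f p \<noteq> 0}"
    unfolding p(2) by (intro imageI) simp
qed

lemma pword_closed: "p \<in> tail_class G dinf \<Longrightarrow> set (pword p) \<subseteq> lpa_gens G"
  unfolding pword_def by (rule path_word_closed[OF walk_to(1)])

lemma lift_elt_closed:
  assumes f: "f \<in> carrier (CM dinf)"
  shows "lift_elt f \<in> carrier FA"
proof (rule free_algebra_closedI[OF _ lift_elt_support])
  show "finite (pword ` {p \<in> tail_class G dinf. f p \<noteq> 0})"
    using f by (intro finite_imageI) (auto simp: chen_simps elim: rev_finite_subset)
qed (use pword_closed in auto)

definition delta :: "('v, 'e) bpath \<Rightarrow> ('v, 'e) bpath \<Rightarrow> 'k" where
  "delta p = (\<lambda>p'. of_bool (p' = p))"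

lemma delta_closed: "p \<in> tail_class G q \<Longrightarrow> delta p \<in> carrier (CM q)"
  by (simp add: chen_simps delta_def)

lemma free_act_delta: "free_act G a (delta p) p' = basis_act G a p p'"
  by (subst free_act_superset[of "{p}"]) (auto simp: delta_def)

lemma cl_word_scale:
  assumes "set u \<subseteq> lpa_gens G"
  shows "cl (\<lambda>x. k * word_elt u x) = (k \<odot>\<^bsub>LA\<^esub> \<one>\<^bsub>LA\<^esub>) \<otimes>\<^bsub>LA\<^esub> wcl u"
  by (rule scalar_mult_cl(1)[OF FA_word_closed[OF assms], symmetric])

lemma cl_zero: "cl (\<lambda>_. 0) = \<zero>\<^bsub>LA\<^esub>"
  by (simp add: cls_zero lpa_simps(5))

text \<open>Modulo Ls, an element of Lv is recovered from its value at \<open>dinf\<close>. For a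
  single word this is \<open>word_rep\<close>; both sides are linear in a.\<close>

lemma eqv_lift:
  assumes "a \<in> carrier FA"
  shows "eqv (cl a \<otimes>\<^bsub>LA\<^esub> V v\<^sub>0) (cl (lift_elt (free_act G a (delta dinf))))"
  using assms
proof (induction rule: free_algebra_induct)
  case zero
  have "lift_elt (\<lambda>_. 0) = (\<lambda>_. 0)" by (simp add: lift_elt_def fun_eq_iff)
  then show ?case unfolding free_act_zero_left using V_closed by (simp add: cl_zero eqv_refl)
next
  case (word k u)
  have k: "k \<odot>\<^bsub>LA\<^esub> \<one>\<^bsub>LA\<^esub> \<in> carrier LA"
    unfolding scalar_eq by (intro cls_closed FA_smult_closed FA_word_closed) simp
  have act: "free_act G (\<lambda>x. k * word_elt u x) (delta dinf) = (\<lambda>p'. k * of_bool (word_act G u dinf = Some p'))"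
    unfolding free_act_delta fun_eq_iff
    by (subst basis_act_superset[of "{u}"]) (auto simp: word_elt_def)
  have "eqv (cl (\<lambda>x. k * word_elt u x) \<otimes>\<^bsub>LA\<^esub> V v\<^sub>0)
      ((k \<odot>\<^bsub>LA\<^esub> \<one>\<^bsub>LA\<^esub>) \<otimes>\<^bsub>LA\<^esub> rep_opt (word_act G u dinf))"
    unfolding cl_word_scale[OF word] LA.m_assoc[OF k wcls_closed[OF word] V_closed]
    by (rule eqv_left[OF word_rep[OF word] k])
  moreover have "(k \<odot>\<^bsub>LA\<^esub> \<one>\<^bsub>LA\<^esub>) \<otimes>\<^bsub>LA\<^esub> rep_opt (word_act G u dinf) = cl (lift_elt (\<lambda>p'. k * of_bool (word_act G u dinf = Some p')))"
  proof (cases "word_act G u dinf")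
    case None
    have "lift_elt (\<lambda>_. 0) = (\<lambda>_. 0)" by (simp add: lift_elt_def fun_eq_iff)
    then show ?thesis using None k by (simp add: cl_zero)
  next
    case (Some p)
    then have p: "p \<in> tail_class G dinf" using word_act_closed[OF _ dinf_class Some] word by auto
    have "lift_elt (\<lambda>p'. k * of_bool (p = p')) = (\<lambda>x. k * word_elt (pword p) x)"
    proof
      fix x
      show "lift_elt (\<lambda>p'. k * of_bool (p = p')) x = k * word_elt (pword p) x"
        using lift_elt_pword p by (auto simp: lift_elt_def word_elt_def the_inv_into_f_f[OF inj_pword])
    qed
    then show ?thesis using Some cl_word_scale[OF pword_closed[OF p], of k] by (simp add: pword_def)
  qed
  ultimately show ?case unfolding act by simp
next
  case (add a b)
  let ?f = "free_act G a (delta dinf)" and ?g = "free_act G b (delta dinf)"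
  have fg: "?f \<in> carrier (CM dinf)" "?g \<in> carrier (CM dinf)"
    using add delta_closed[OF dinf_class] by (auto intro: free_act_closed)
  have fin: "finite {p. delta dinf p \<noteq> 0}" by (simp add: delta_def)
  have "lift_elt (\<lambda>p. ?f p + ?g p) = lift_elt ?f \<oplus>\<^bsub>FA\<^esub> lift_elt ?g"
    by (simp add: lift_elt_def fun_eq_iff free_algebra_simps(5))
  then have "cl (lift_elt (free_act G (\<lambda>x. a x + b x) (delta dinf))) = cl (lift_elt ?f) \<oplus>\<^bsub>LA\<^esub> cl (lift_elt ?g)"
    unfolding free_act_add_left[OF free_algebra_closedD(1)[OF add(1)] free_algebra_closedD(1)[OF add(2)] fin]
    using lpa_simps(3)[OF lift_elt_closed[OF fg(1)] lift_elt_closed[OF fg(2)]] by simp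
  moreover have "cl (\<lambda>x. a x + b x) \<otimes>\<^bsub>LA\<^esub> V v\<^sub>0 = cl a \<otimes>\<^bsub>LA\<^esub> V v\<^sub>0 \<oplus>\<^bsub>LA\<^esub> cl b \<otimes>\<^bsub>LA\<^esub> V v\<^sub>0"
    using LA.l_distr[OF cls_closed[OF add(1)] cls_closed[OF add(2)] V_closed] lpa_simps(3)[OF add(1,2)]
    by (simp add: free_algebra_simps(5))
  ultimately show ?case using eqv_add[OF add(3,4)] by simp
qed

text \<open>If the value at \<open>dinf\<close> vanishes, the element recovered by
  \<open>eqv_lift\<close> is zero, so X is congruent to zero modulo Ls.\<close>

lemma annihilator_dinf:
  assumes a: "X \<in> carrier LA" "X \<otimes>\<^bsub>LA\<^esub> V v\<^sub>0 = X" "X \<odot>\<^bsub>CM dinf\<^esub> delta dinf = \<zero>\<^bsub>CM dinf\<^esub>"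
  shows "\<exists>c \<in> carrier LA. X = c \<otimes>\<^bsub>LA\<^esub> s"
proof -
  obtain a where x: "a \<in> carrier FA" "X = cl a" using a(1) by (rule lpa_cases)
  have "free_act G a (delta dinf) = (\<lambda>_. 0)"
    using a(3) chen_smult_cls[OF x(1) delta_closed[OF dinf_class]] by (simp add: x(2) chen_simps(2))
  moreover have "lift_elt (\<lambda>_. 0) = (\<lambda>_. 0)" by (simp add: lift_elt_def fun_eq_iff)
  ultimately have "eqv X \<zero>\<^bsub>LA\<^esub>" using eqv_lift[OF x(1)] a(2) by (simp add: x(2) cl_zero)
  then show ?thesis using s_closed by (auto simp: eqv_def)
qed

section \<open>The action on basis paths and the resolution\<close>

lemma word_act_walk:
  "awalk u \<alpha> (bsource G p) \<Longrightarrow> word_act G (map Edge \<alpha>) p = Some (bappend \<alpha> p)"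
proof (induction \<alpha> arbitrary: u)
  case (Cons e \<alpha>)
  then have w: "awalk (head G e) \<alpha> (bsource G p)" by (auto simp: awalk_def)
  have "bappend (e # \<alpha>) p = bappend [e] (bappend \<alpha> p)" by (simp flip: bappend_append)
  then show ?case using Cons.IH[OF w] bsource_bappend_walk[OF w] by simp
qed (simp add: bappend_Nil)

lemma generated_by_dinf:
  assumes f: "f \<in> carrier (CM dinf)"
  shows "\<exists>X \<in> carrier LA. X \<odot>\<^bsub>CM dinf\<^esub> delta dinf = f"
proof
  show "cl (lift_elt f) \<in> carrier LA" by (rule cls_closed[OF lift_elt_closed[OF f]])
  let ?T = "tail_class G dinf"
  have f': "finite {p \<in> ?T. f p \<noteq> 0}" "{p. f p \<noteq> 0} \<subseteq> ?T"
    using f by (auto simp: chen_simps elim: rev_finite_subset)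
  have act: "word_act G (pword p) dinf = Some p" if p: "p \<in> ?T" for p
    using word_act_walk[of "bsource G p" "walk_to p" dinf] walk_to[OF p]
    by (simp add: pword_def path_word_def word_act_append bsource_dinf)
  have "free_act G (lift_elt f) (delta dinf) = f"
  proof
    fix p'
    have "free_act G (lift_elt f) (delta dinf) p' =
        (\<Sum>u\<in>pword ` {p \<in> ?T. f p \<noteq> 0}. lift_elt f u * of_bool (word_act G u dinf = Some p'))"
      unfolding free_act_delta by (rule basis_act_superset[OF finite_imageI[OF f'(1)] lift_elt_support])
    also have "\<dots> = (\<Sum>p\<in>{p \<in> ?T. f p \<noteq> 0}. if p = p' then f p else 0)"
      by (subst sum.reindex[OF inj_on_subset[OF inj_pword]]) (auto simp: lift_elt_pword act intro!: sum.cong)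
    also have "\<dots> = f p'" using f' by (auto simp: sum.delta')
    finally show "free_act G (lift_elt f) (delta dinf) p' = f p'" .
  qed
  then show "cl (lift_elt f) \<odot>\<^bsub>CM dinf\<^esub> delta dinf = f"
    using chen_smult_cls[OF lift_elt_closed[OF f] delta_closed[OF dinf_class]] by simp
qed

lemma wcl_delta:
  assumes "set u \<subseteq> lpa_gens G" "p \<in> tail_class G q"
  shows "wcl u \<odot>\<^bsub>CM q\<^esub> delta p = (case word_act G u p of None \<Rightarrow> (\<lambda>_. 0) | Some p' \<Rightarrow> delta p')"
  unfolding chen_smult_cls[OF FA_word_closed[OF assms(1)] delta_closed[OF assms(2)]]
  unfolding fun_eq_iff free_act_delta basis_act_word_elt by (auto simp: delta_def split: option.split)

lemma V_delta: "p \<in> tail_class G q \<Longrightarrow> bsource G p = v\<^sub>0 \<Longrightarrow> V v\<^sub>0 \<odot>\<^bsub>CM q\<^esub> delta p = delta p"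
  using wcl_delta[of "[Vertex v\<^sub>0]" p q] d_walk(3) by (simp add: lpa_gens_iff)

lemma D_delta: "p \<in> tail_class G q \<Longrightarrow> bsource G p = v\<^sub>0 \<Longrightarrow> D \<odot>\<^bsub>CM q\<^esub> delta p = delta (bappend d p)"
  using wcl_delta[OF walk_gens[OF d_walk(1)], of p q] word_act_walk[of v\<^sub>0 d p] d_walk(1) by simp

lemma s_act:
  assumes "f \<in> carrier (CM q)" "V v\<^sub>0 \<odot>\<^bsub>CM q\<^esub> f = f"
  shows "s \<odot>\<^bsub>CM q\<^esub> f = (\<lambda>p. (D \<odot>\<^bsub>CM q\<^esub> f) p - f p)"
proof -
  interpret left_module LA "CM q" by (rule left_module_chen)
  have "(\<lambda>p. - f p) \<in> carrier (CM q)" using assms(1) by (simp add: chen_simps)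
  then have "\<ominus>\<^bsub>CM q\<^esub> f = (\<lambda>p. - f p)"
    using assms(1) by (intro M.minus_equality) (simp_all add: chen_simps)
  then show ?thesis
    unfolding smult_diff_left[OF D_closed V_closed assms(1)] assms(2)
    by (simp add: M.minus_eq chen_simps(3))
qed

theorem cyclic_resolution_dinf:
  "cyclic_resolution LA (CM dinf) (CM q) (delta dinf) (V v\<^sub>0) s"
proof (intro cyclic_resolution.intro cyclic_resolution_axioms.intro hom_algebra_chen)
  note \<delta> = delta_closed[OF dinf_class]
  show "delta dinf \<in> carrier (CM dinf)" by (rule \<delta>)
  show "V v\<^sub>0 \<in> carrier LA" "s \<in> carrier LA" by (rule V_closed s_closed)+
  show "\<exists>X \<in> carrier LA. X \<odot>\<^bsub>CM dinf\<^esub> delta dinf = f" if "f \<in> carrier (CM dinf)" for f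
    by (rule generated_by_dinf[OF that])
  show "V v\<^sub>0 \<otimes>\<^bsub>LA\<^esub> V v\<^sub>0 = V v\<^sub>0" "s \<otimes>\<^bsub>LA\<^esub> V v\<^sub>0 = s" "V v\<^sub>0 \<otimes>\<^bsub>LA\<^esub> s = s" by (rule VV sV Vs)+
  show V: "V v\<^sub>0 \<odot>\<^bsub>CM dinf\<^esub> delta dinf = delta dinf" by (rule V_delta[OF dinf_class bsource_dinf])
  show "s \<odot>\<^bsub>CM dinf\<^esub> delta dinf = \<zero>\<^bsub>CM dinf\<^esub>"
    unfolding s_act[OF \<delta> V] D_delta[OF dinf_class bsource_dinf] bappend_d_dinf by (simp add: chen_simps)
  show "\<exists>c \<in> carrier LA. a = c \<otimes>\<^bsub>LA\<^esub> s"
    if "a \<in> carrier LA" "a \<otimes>\<^bsub>LA\<^esub> V v\<^sub>0 = a" "a \<odot>\<^bsub>CM dinf\<^esub> delta dinf = \<zero>\<^bsub>CM dinf\<^esub>" for a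
    by (rule annihilator_dinf[OF that])
  show "a = \<zero>\<^bsub>LA\<^esub>" if a: "a \<in> carrier LA" "a \<otimes>\<^bsub>LA\<^esub> V v\<^sub>0 = a" "a \<otimes>\<^bsub>LA\<^esub> s = \<zero>\<^bsub>LA\<^esub>" for a
  proof (rule mult_word_fixed_imp_zero[OF a(1) walk_gens[OF d_walk(1)]])
    have "word_degree (map Edge \<alpha>) = int (length \<alpha>)" for \<alpha> :: "'e list"
      by (induction \<alpha>) (simp_all add: word_degree_def)
    then show "0 < word_degree (map Edge d)" using d_walk(2) by simp
    \<comment> \<open>Since av = a, vanishing of as says that a is fixed by right multiplication by
      d, a word of positive degree.\<close>
    have "a \<otimes>\<^bsub>LA\<^esub> s = a \<otimes>\<^bsub>LA\<^esub> D \<ominus>\<^bsub>LA\<^esub> a"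
      using a(1,2) D_closed V_closed by (simp add: LA.minus_eq LA.r_distr LA.r_minus)
    then have "a \<otimes>\<^bsub>LA\<^esub> D \<ominus>\<^bsub>LA\<^esub> a = \<zero>\<^bsub>LA\<^esub>" using a(3) by simp
    then show "a \<otimes>\<^bsub>LA\<^esub> D = a" using a(1) D_closed by simp
  qed
qed

end

section \<open>Coinvariants of the periodic path\<close>

context leavitt_cycle
begin

section \<open>Chains under prepending d\<close>

lemma d_power_eq: "(bappend d ^^ n) p = bappend (concat (replicate n d)) p"
  by (induction n) (simp_all add: bappend_Nil bappend_append)

lemma d_power_closedD: "(bappend d ^^ n) p \<in> bpaths G \<Longrightarrow> p \<in> bpaths G"
  unfolding d_power_eq by (rule bappend_closedD)

text \<open>One copy of d has to precede p, hence \<open>Suc n\<close>: the range of its last edge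
  then forces the source of p.\<close>

lemma d_power_source: "(bappend d ^^ Suc n) p \<in> bpaths G \<Longrightarrow> bsource G p = v\<^sub>0"
  using d_power_closedD[of n "bappend d p"] bappend_walk_source[OF _ d_walk(1,2)]
  by (simp add: funpow_swap1)

definition based :: "('v, 'e) bpath \<Rightarrow> ('v, 'e) bpath set" where
  "based q = {p \<in> tail_class G q. bsource G p = v\<^sub>0}"

lemma based_bappend: "p \<in> based q \<Longrightarrow> bappend d p \<in> based q"
  using bappend_walk_closed[of p v\<^sub>0 d] bsource_bappend_walk[of v\<^sub>0 d p] d_walk(1)
  by (auto simp: based_def tail_class_def tail_equiv_bappend)

text \<open>A copy of d has at least one edge. A finite path therefore cannot start with more copies
  than its length, and i + 1 copies determine the edge at position i of an infinite path.\<close>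

lemma infinitely_divisible:
  assumes "\<And>n. \<exists>p'. p = (bappend d ^^ n) p'"
  shows "p = dinf"
proof (cases p)
  case (SinkPath \<alpha> w)
  obtain p' where p': "p = (bappend d ^^ Suc (length \<alpha>)) p'" using assms by blast
  then obtain \<beta> w' where "p' = SinkPath \<beta> w'" unfolding d_power_eq SinkPath by (cases p') auto
  then have "\<alpha> = concat (replicate (Suc (length \<alpha>)) d) @ \<beta>" using p' unfolding d_power_eq SinkPath by simp
  then have "length \<alpha> = length (concat (replicate (Suc (length \<alpha>)) d)) + length \<beta>"
    by (metis length_append)
  also have "length (concat (replicate (Suc (length \<alpha>)) d)) = Suc (length \<alpha>) * length d"
    by (simp add: length_concat sum_list_replicate)
  finally show ?thesis using d_walk(2) by (cases "length d") auto
next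
  case (InfPath t)
  have "t !! i = Stream.cycle d !! i" for i
  proof -
    let ?\<alpha> = "concat (replicate (Suc i) d)"
    have "length ?\<alpha> = Suc i * length d" by (simp add: length_concat sum_list_replicate)
    then have i: "i < length ?\<alpha>" using d_walk(2) by (cases "length d") auto
    obtain p' where p': "p = bappend ?\<alpha> p'" using assms[of "Suc i"] unfolding d_power_eq by blast
    then obtain t' where "t = ?\<alpha> @- t'" unfolding InfPath by (cases p') auto
    then have "t !! i = ?\<alpha> ! i" using i by (simp only: shift_snth_less)
    moreover have "(bappend d ^^ n) dinf = dinf" for n by (induction n) (simp_all add: bappend_d_dinf)
    then have "bappend ?\<alpha> dinf = dinf" by (simp only: d_power_eq)
    then have "Stream.cycle d = ?\<alpha> @- Stream.cycle d" by (simp add: dinf_def)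
    then have "Stream.cycle d !! i = ?\<alpha> ! i" using i by (metis shift_snth_less)
    ultimately show ?thesis by simp
  qed
  then have "t = Stream.cycle d" by (metis stream_smap_nats ext)
  then show ?thesis by (simp add: InfPath dinf_def)
qed

text \<open>One starting point for each chain in the class of q. The path \<open>dinf\<close> is
  divisible by d but is fixed by prepending d, so it forms a chain of its own.\<close>

definition index :: "('v, 'e) bpath \<Rightarrow> ('v, 'e) bpath set" where
  "index q = nondivisible_paths G d q \<union> ({dinf} \<inter> tail_class G q)"

lemma index_based: "index q \<subseteq> based q"
  by (auto simp: index_def based_def nondivisible_paths_def tail_class_def v\<^sub>0_def[symmetric] bsource_dinf)

lemma root_exists:
  assumes p: "p \<in> based q"
  shows "\<exists>j \<in> index q. \<exists>n. p = (bappend d ^^ n) j"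
proof (cases "\<forall>n. \<exists>p'. p = (bappend d ^^ n) p'")
  case True
  then have "p = dinf" using infinitely_divisible by blast
  then have "p \<in> index q" using p by (simp add: index_def based_def)
  then show ?thesis by (intro bexI[of _ p] exI[of _ 0]) simp_all
next
  case False
  \<comment> \<open>The first number of copies that cannot be removed. It is positive, as removing
    none is always possible, so N - 1 copies can be removed and the remainder is not divisible by
    d.\<close>
  define N where "N = (LEAST n. \<nexists>p'. p = (bappend d ^^ n) p')"
  from False have "\<exists>n. \<nexists>p'. p = (bappend d ^^ n) p'" by blast
  then have N: "\<nexists>p'. p = (bappend d ^^ N) p'" unfolding N_def by (rule LeastI_ex)
  then have "N \<noteq> 0" by (metis funpow_0)
  then obtain n where n: "N = Suc n" by (cases N) auto
  then obtain j where j: "p = (bappend d ^^ n) j" using not_less_Least[of n "\<lambda>n. \<nexists>p'. p = (bappend d ^^ n) p'"] unfolding N_def by auto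
  have pb: "p \<in> bpaths G" "tail_equiv p q" "bsource G p = v\<^sub>0" using p by (auto simp: based_def tail_class_def)
  \<comment> \<open>If nothing was removed, this is the source of p; otherwise j starts where a copy
    of d ends.\<close>
  have "bsource G j = v\<^sub>0"
  proof (cases n)
    case 0
    then show ?thesis using j pb by simp
  next
    case (Suc m)
    then show ?thesis using d_power_source[of m j] j pb by simp
  qed
  moreover have "tail_equiv j q" using pb(2) unfolding j d_power_eq tail_equiv_bappend .
  moreover have "j \<in> bpaths G" using d_power_closedD[of n j] j pb by simp
  moreover have "\<not> divisible G d j"
  proof
    assume "divisible G d j"
    then obtain j' where "j = bappend d j'" by (auto simp: divisible_def)
    then have "p = (bappend d ^^ N) j'" by (simp add: j n funpow_swap1)
    then show False using N by blast
  qed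
  ultimately have "j \<in> index q" by (simp add: index_def nondivisible_paths_def v\<^sub>0_def)
  then show ?thesis using j by blast
qed

lemma d_power_inject: "(bappend d ^^ n) p = (bappend d ^^ n) p' \<longleftrightarrow> p = p'"
  unfolding d_power_eq by (rule bappend_inject)

text \<open>After cancelling common copies of d, one starting point is a power of d times the other.
  A positive power makes it divisible, so it is \<open>dinf\<close>, and cancelling once more shows
  that the other one is \<open>dinf\<close> too.\<close>

lemma root_unique:
  assumes i: "i \<in> index q" and j: "j \<in> index q" and eq: "(bappend d ^^ m) i = (bappend d ^^ n) j"
  shows "i = j"
proof -
  have *: "i = j" if i: "i \<in> index q" and j: "j \<in> index q" and eq: "i = (bappend d ^^ k) j" for i j k
  proof (cases k)
    case 0
    then show ?thesis using eq by simp
  next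
    case (Suc l)
    have "(bappend d ^^ l) j \<in> bpaths G"
      using i index_based eq bappend_closedD[of d] by (auto simp: Suc based_def tail_class_def)
    then have "divisible G d i" using eq by (auto simp: Suc divisible_def)
    then have "i = dinf" using i by (auto simp: index_def nondivisible_paths_def)
    moreover have "(bappend d ^^ k) dinf = dinf" by (induction k) (simp_all add: bappend_d_dinf)
    ultimately show ?thesis using eq d_power_inject by metis
  qed
  show ?thesis
  proof (cases "m \<le> n")
    case True
    then have "(bappend d ^^ m) i = (bappend d ^^ m) ((bappend d ^^ (n - m)) j)"
      using eq by (simp flip: funpow_add comp_apply[of "bappend d ^^ _" "bappend d ^^ _"])
    then show ?thesis unfolding d_power_inject by (rule *[OF i j])
  next
    case False
    then have "(bappend d ^^ n) j = (bappend d ^^ n) ((bappend d ^^ (m - n)) i)"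
      using eq by (simp flip: funpow_add comp_apply[of "bappend d ^^ _" "bappend d ^^ _"])
    then show ?thesis unfolding d_power_inject by (rule *[OF j i, symmetric])
  qed
qed

definition root :: "('v, 'e) bpath \<Rightarrow> ('v, 'e) bpath \<Rightarrow> ('v, 'e) bpath" where
  "root q p = (SOME j. j \<in> index q \<and> (\<exists>n. p = (bappend d ^^ n) j))"

lemma root:
  assumes "p \<in> based q"
  shows "root q p \<in> index q" "\<exists>n. p = (bappend d ^^ n) (root q p)"
proof -
  have "\<exists>j. j \<in> index q \<and> (\<exists>n. p = (bappend d ^^ n) j)" using root_exists[OF assms] by blast
  from someI_ex[OF this] show "root q p \<in> index q" "\<exists>n. p = (bappend d ^^ n) (root q p)"
    unfolding root_def by blast+
qed

lemma root_index:
  assumes j: "j \<in> index q" shows "root q j = j"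
proof -
  have b: "j \<in> based q" using j index_based by blast
  obtain n where "j = (bappend d ^^ n) (root q j)" using root(2)[OF b] by blast
  then show ?thesis using root_unique[OF root(1)[OF b] j, of n 0] by simp
qed

lemma root_bappend:
  assumes p: "p \<in> based q" shows "root q (bappend d p) = root q p"
proof -
  obtain m n where "bappend d p = (bappend d ^^ m) (root q (bappend d p))" "p = (bappend d ^^ n) (root q p)"
    using root(2)[OF p] root(2)[OF based_bappend[OF p]] by blast
  then have "(bappend d ^^ m) (root q (bappend d p)) = (bappend d ^^ Suc n) (root q p)" by simp
  then show ?thesis by (rule root_unique[OF root(1)[OF based_bappend[OF p]] root(1)[OF p]])
qed

text \<open>The coordinate belonging to the chain from j: the sum of the coefficients of f along it.
  The choice in \<open>root\<close> is meaningful only on \<open>based q\<close>, which contains the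
  supports of all functions in \<open>corner q\<close>.\<close>

definition coinv :: "('v, 'e) bpath \<Rightarrow> (('v, 'e) bpath \<Rightarrow> 'k) \<Rightarrow> ('v, 'e) bpath \<Rightarrow> 'k" where
  "coinv q f j = (\<Sum>p | f p \<noteq> 0. f p * of_bool (root q p = j))"

lemma coinv_superset:
  assumes "finite P" "{p. f p \<noteq> 0} \<subseteq> P"
  shows "coinv q f j = (\<Sum>p\<in>P. f p * of_bool (root q p = j))"
  unfolding coinv_def using assms by (intro sum.mono_neutral_left) auto

lemma coinv_lincomb:
  assumes "finite {p. f p \<noteq> 0}" "finite {p. g p \<noteq> 0}"
  shows "coinv q (\<lambda>p. k * f p + g p) j = k * coinv q f j + coinv q g j"
proof -
  let ?P = "{p. f p \<noteq> 0} \<union> {p. g p \<noteq> 0}"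
  have *: "coinv q h j = (\<Sum>p\<in>?P. h p * of_bool (root q p = j))" if "{p. h p \<noteq> 0} \<subseteq> ?P" for h
    using assms by (intro coinv_superset that) simp
  have "{p. k * f p + g p \<noteq> 0} \<subseteq> ?P" "{p. f p \<noteq> 0} \<subseteq> ?P" "{p. g p \<noteq> 0} \<subseteq> ?P" by auto
  note this[THEN *]
  then show ?thesis by (simp only: sum.distrib sum_distrib_left distrib_right mult.assoc)
qed

lemma coinv_delta: "coinv q (delta p) j = of_bool (root q p = j)"
  by (subst coinv_superset[of "{p}"]) (auto simp: delta_def)

section \<open>The corner vT and the action of d - v on it\<close>

definition corner :: "('v, 'e) bpath \<Rightarrow> (('v, 'e) bpath \<Rightarrow> 'k) set" where
  "corner q = {f. finite {p. f p \<noteq> 0} \<and> {p. f p \<noteq> 0} \<subseteq> based q}"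

lemma cornerD: "f \<in> corner q \<Longrightarrow> finite {p. f p \<noteq> 0}" "f \<in> corner q \<Longrightarrow> f p \<noteq> 0 \<Longrightarrow> p \<in> based q"
  by (auto simp: corner_def)

lemma corner_lincomb:
  assumes f: "f \<in> corner q" and g: "g \<in> corner q"
  shows "(\<lambda>p. k * f p + g p) \<in> corner q"
proof -
  have "{p. k * f p + g p \<noteq> 0} \<subseteq> {p. f p \<noteq> 0} \<union> {p. g p \<noteq> 0}" by auto
  then show ?thesis using cornerD[OF f] cornerD[OF g] by (auto simp: corner_def elim: finite_subset)
qed

text \<open>The vertex v acts by erasing the coefficients of all paths that start elsewhere.\<close>

lemma corner_eq: "corner q = {f \<in> carrier (CM q). V v\<^sub>0 \<odot>\<^bsub>CM q\<^esub> f = f}"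
proof -
  have "V v\<^sub>0 \<odot>\<^bsub>CM q\<^esub> f = (\<lambda>p. if bsource G p = v\<^sub>0 then f p else 0)" if f: "f \<in> carrier (CM q)" for f
  proof
    fix p
    have fin: "finite {p. f p \<noteq> 0}" using f by (simp add: chen_simps)
    have c: "word_elt [Vertex v\<^sub>0] \<in> carrier FA" using d_walk(3) by (intro FA_word_closed) (simp add: lpa_gens_iff)
    have "free_act G (word_elt [Vertex v\<^sub>0]) f p =
        (\<Sum>p'|f p' \<noteq> 0. if p' = p then (if bsource G p = v\<^sub>0 then f p else 0) else 0)"
      unfolding free_act_superset[OF fin order.refl] basis_act_word_elt by (rule sum.cong) auto
    also have "\<dots> = (if bsource G p = v\<^sub>0 then f p else 0)" using fin by auto
    finally show "(V v\<^sub>0 \<odot>\<^bsub>CM q\<^esub> f) p = (if bsource G p = v\<^sub>0 then f p else 0)"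
      unfolding chen_smult_cls[OF c f] .
  qed
  moreover have "f \<in> carrier (CM q)" if "f \<in> corner q" for f
    using that by (auto simp: corner_def based_def chen_simps)
  ultimately show ?thesis
    by (auto simp: corner_def based_def chen_simps fun_eq_iff) metis+
qed

lemma corner_chen: "f \<in> corner q \<Longrightarrow> f \<in> carrier (CM q)"
  by (simp add: corner_eq)

lemma delta_corner: "p \<in> based q \<Longrightarrow> delta p \<in> corner q"
  by (simp add: corner_def delta_def)

text \<open>Prepending d is injective, so coefficients are moved but never merged.\<close>

lemma D_act:
  assumes f: "f \<in> corner q"
  shows "{p. (D \<odot>\<^bsub>CM q\<^esub> f) p \<noteq> 0} \<subseteq> bappend d ` {p. f p \<noteq> 0}"
    "(D \<odot>\<^bsub>CM q\<^esub> f) (bappend d p) = f p"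
proof -
  note fin = cornerD(1)[OF f]
  have *: "(D \<odot>\<^bsub>CM q\<^esub> f) p = (\<Sum>p'|f p' \<noteq> 0. f p' * of_bool (bappend d p' = p))" for p
  proof -
    have "word_act G (map Edge d) p' = Some (bappend d p')" if "f p' \<noteq> 0" for p'
      using cornerD(2)[OF f that] d_walk(1) by (intro word_act_walk) (simp add: based_def)
    then show ?thesis
      unfolding chen_smult_cls[OF FA_word_closed[OF walk_gens[OF d_walk(1)]] corner_chen[OF f]]
        free_act_superset[OF fin order.refl] basis_act_word_elt
      by (intro sum.cong) auto
  qed
  show "{p. (D \<odot>\<^bsub>CM q\<^esub> f) p \<noteq> 0} \<subseteq> bappend d ` {p. f p \<noteq> 0}"
  proof
    fix p assume "p \<in> {p. (D \<odot>\<^bsub>CM q\<^esub> f) p \<noteq> 0}"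
    then have "(\<Sum>p'|f p' \<noteq> 0. f p' * of_bool (bappend d p' = p)) \<noteq> 0" by (simp add: *)
    then obtain p' where "f p' \<noteq> 0" "f p' * of_bool (bappend d p' = p) \<noteq> 0"
      by (rule sum.not_neutral_contains_not_neutral) blast
    then show "p \<in> bappend d ` {p. f p \<noteq> 0}" by (auto split: if_splits)
  qed
  have "(D \<odot>\<^bsub>CM q\<^esub> f) (bappend d p) = (\<Sum>p'|f p' \<noteq> 0. if p' = p then f p else 0)"
    unfolding * bappend_inject by (rule sum.cong) auto
  then show "(D \<odot>\<^bsub>CM q\<^esub> f) (bappend d p) = f p" using fin by simp
qed

text \<open>Prepending d keeps every path in its chain, so the sums along chains do not
  change.\<close>

lemma coinv_D:
  assumes f: "f \<in> corner q"
  shows "coinv q (D \<odot>\<^bsub>CM q\<^esub> f) j = coinv q f j"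
proof -
  have inj: "inj_on (bappend d) {p. f p \<noteq> 0}" by (rule inj_onI) (simp add: bappend_inject)
  have "coinv q (D \<odot>\<^bsub>CM q\<^esub> f) j =
      (\<Sum>p\<in>bappend d ` {p. f p \<noteq> 0}. (D \<odot>\<^bsub>CM q\<^esub> f) p * of_bool (root q p = j))"
    by (rule coinv_superset[OF finite_imageI[OF cornerD(1)[OF f]] D_act(1)[OF f]])
  also have "\<dots> = (\<Sum>p | f p \<noteq> 0. f p * of_bool (root q (bappend d p) = j))"
    by (simp add: sum.reindex[OF inj] D_act(2)[OF f])
  also have "\<dots> = coinv q f j"
    unfolding coinv_def using root_bappend cornerD(2)[OF f] by (intro sum.cong) auto
  finally show ?thesis .
qed

lemma s_corner:
  assumes f: "f \<in> corner q"
  shows "s \<odot>\<^bsub>CM q\<^esub> f = (\<lambda>p. - 1 * f p + (D \<odot>\<^bsub>CM q\<^esub> f) p)"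
  using s_act[of f q] f by (simp add: corner_eq)

lemma coinv_s:
  assumes f: "f \<in> corner q"
  shows "coinv q (s \<odot>\<^bsub>CM q\<^esub> f) j = 0"
proof -
  have "finite {p. (D \<odot>\<^bsub>CM q\<^esub> f) p \<noteq> 0}"
    by (rule finite_subset[OF D_act(1)[OF f] finite_imageI[OF cornerD(1)[OF f]]])
  then show ?thesis
    unfolding s_corner[OF f] using coinv_lincomb[OF cornerD(1)[OF f], of _ q "- 1" j] coinv_D[OF f, of j] by simp
qed

lemma s_lincomb:
  assumes f: "f \<in> corner q" and g: "g \<in> corner q"
  shows "s \<odot>\<^bsub>CM q\<^esub> (\<lambda>p. k * f p + g p) = (\<lambda>p. k * (s \<odot>\<^bsub>CM q\<^esub> f) p + (s \<odot>\<^bsub>CM q\<^esub> g) p)"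
proof -
  interpret H: hom_algebra LA "CM q" "CM q" by (rule hom_algebra_chen)
  note fg = corner_chen[OF f] corner_chen[OF g]
  have k: "(k \<odot>\<^bsub>LA\<^esub> \<one>\<^bsub>LA\<^esub>) \<odot>\<^bsub>CM q\<^esub> f \<in> carrier (CM q)"
    by (rule H.P.smult_closed[OF H.scalar_closed fg(1)])
  have "(\<lambda>p. k * f p + g p) = (k \<odot>\<^bsub>LA\<^esub> \<one>\<^bsub>LA\<^esub>) \<odot>\<^bsub>CM q\<^esub> f \<oplus>\<^bsub>CM q\<^esub> g"
    unfolding scalar_act[OF fg(1)] by (simp add: chen_simps(3))
  then have "s \<odot>\<^bsub>CM q\<^esub> (\<lambda>p. k * f p + g p) =
      (k \<odot>\<^bsub>LA\<^esub> \<one>\<^bsub>LA\<^esub>) \<odot>\<^bsub>CM q\<^esub> (s \<odot>\<^bsub>CM q\<^esub> f) \<oplus>\<^bsub>CM q\<^esub> s \<odot>\<^bsub>CM q\<^esub> g"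
    using H.P.smult_r_distr[OF s_closed k fg(2)] H.sc_commute[OF s_closed fg(1), of k] by simp
  also have "\<dots> = (\<lambda>p. k * (s \<odot>\<^bsub>CM q\<^esub> f) p + (s \<odot>\<^bsub>CM q\<^esub> g) p)"
    unfolding scalar_act[OF H.P.smult_closed[OF s_closed fg(1)]] by (simp add: chen_simps(3))
  finally show ?thesis .
qed

lemma zero_corner: "(\<lambda>_. 0) \<in> corner q"
  by (simp add: corner_def)

text \<open>With k = -1 the two terms on the right of \<open>s_lincomb\<close> cancel.\<close>

lemma s_zero: "s \<odot>\<^bsub>CM q\<^esub> (\<lambda>_. 0) = (\<lambda>_. 0)"
  using s_lincomb[OF zero_corner zero_corner, of q "- 1"] by simp

text \<open>Telescoping: the difference between \<open>d\<^sup>n j\<close> and j is d - v applied to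
  the sum of \<open>j, dj, \<dots>, d\<^sup>n\<^sup>-\<^sup>1 j\<close>.\<close>

lemma delta_power_decomposition:
  assumes j: "j \<in> based q"
  shows "\<exists>f \<in> corner q. \<forall>p. delta ((bappend d ^^ n) j) p = (s \<odot>\<^bsub>CM q\<^esub> f) p + delta j p"
proof (induction n)
  case 0
  then show ?case using zero_corner s_zero by (intro bexI[of _ "\<lambda>_. 0"]) simp_all
next
  case (Suc n)
  let ?p = "(bappend d ^^ n) j"
  obtain f where f: "f \<in> corner q" "\<And>p. delta ?p p = (s \<odot>\<^bsub>CM q\<^esub> f) p + delta j p" using Suc by blast
  have p: "?p \<in> based q" using j by (induction n) (simp_all add: based_bappend)
  have "D \<odot>\<^bsub>CM q\<^esub> delta ?p = delta (bappend d ?p)" using p by (intro D_delta) (simp_all add: based_def)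
  then have sp: "s \<odot>\<^bsub>CM q\<^esub> delta ?p = (\<lambda>x. - delta ?p x + delta (bappend d ?p) x)"
    using s_corner[OF delta_corner[OF p]] by simp
  show ?case
  proof (intro bexI allI)
    show "(\<lambda>x. 1 * delta ?p x + f x) \<in> corner q" by (rule corner_lincomb[OF delta_corner[OF p] f(1)])
    show "delta ((bappend d ^^ Suc n) j) x = (s \<odot>\<^bsub>CM q\<^esub> (\<lambda>x. 1 * delta ?p x + f x)) x + delta j x" for x
      unfolding s_lincomb[OF delta_corner[OF p] f(1)] sp using f(2)[of x] by simp
  qed
qed

text \<open>Modulo s(vT) every path in the support may be replaced by the root of its chain. What
  remains is the function \<open>coinv q f\<close>, so an f with all coordinates zero lies in
  s(vT).\<close>

lemma coinv_decomposition:
  assumes "f \<in> corner q"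
  shows "\<exists>g \<in> corner q. \<forall>p. f p = (s \<odot>\<^bsub>CM q\<^esub> g) p + coinv q f p"
proof -
  have "finite P \<Longrightarrow> {p. f p \<noteq> 0} \<subseteq> P \<Longrightarrow> P \<subseteq> based q \<Longrightarrow>
      \<exists>g \<in> corner q. \<forall>p. f p = (s \<odot>\<^bsub>CM q\<^esub> g) p + coinv q f p" for P and f :: "('v, 'e) bpath \<Rightarrow> 'k"
  proof (induction P arbitrary: f rule: finite_induct)
    case empty
    then have "f = (\<lambda>_. 0)" by auto
    then show ?case using zero_corner s_zero by (intro bexI[of _ "\<lambda>_. 0"]) (simp_all add: coinv_def)
  next
    case (insert p P)
    \<comment> \<open>Removing the term at p leaves a function supported on P; the removed term is
      reduced to the root of p separately.\<close>
    define f' where "f' = f(p := 0)"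
    have f'_supp: "{x. f' x \<noteq> 0} \<subseteq> P" using insert.prems(1) by (auto simp: f'_def)
    then obtain g' where g': "g' \<in> corner q" "\<And>x. f' x = (s \<odot>\<^bsub>CM q\<^esub> g') x + coinv q f' x"
      using insert.IH[of f'] insert.prems(2) by blast
    have p: "p \<in> based q" using insert.prems(2) by simp
    obtain n where n: "p = (bappend d ^^ n) (root q p)" using root(2)[OF p] by blast
    obtain h where h: "h \<in> corner q" "\<And>x. delta p x = (s \<odot>\<^bsub>CM q\<^esub> h) x + delta (root q p) x"
      using delta_power_decomposition[of "root q p" q n] root(1)[OF p] index_based n by auto
    have f_eq: "f = (\<lambda>x. f p * delta p x + f' x)" by (auto simp: f'_def delta_def)
    have "coinv q f x = f p * coinv q (delta p) x + coinv q f' x" for x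
      by (subst f_eq, rule coinv_lincomb)
        (use finite_subset[OF f'_supp insert.hyps(1)] in \<open>auto simp: delta_def\<close>)
    then have c: "coinv q f x = f p * delta (root q p) x + coinv q f' x" for x
      by (auto simp: coinv_delta) (auto simp: delta_def)
    show ?case
    proof (intro bexI allI)
      show "(\<lambda>x. f p * h x + g' x) \<in> corner q" by (rule corner_lincomb[OF h(1) g'(1)])
      show "f x = (s \<odot>\<^bsub>CM q\<^esub> (\<lambda>x. f p * h x + g' x)) x + coinv q f x" for x
        unfolding s_lincomb[OF h(1) g'(1)] c
        using fun_cong[OF f_eq, of x] h(2)[of x] g'(2)[of x] by (simp add: algebra_simps)
    qed
  qed
  then show ?thesis using cornerD[OF assms] by blast
qed

lemma coinv_outside:
  assumes f: "f \<in> corner q" and j: "j \<notin> index q"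
  shows "coinv q f j = 0"
  unfolding coinv_def using root(1) cornerD(2)[OF f] j by (intro sum.neutral) auto

text \<open>The coordinates are the chain sums, and the basis vectors of the starting points are
  dual to them since each starting point is its own root.\<close>

theorem has_dimension_Ext1_dinf: "has_dimension (Ext1 LA (CM dinf) (CM q)) |index q|"
proof -
  interpret cyclic_resolution LA "CM dinf" "CM q" "delta dinf" "V v\<^sub>0" s by (rule cyclic_resolution_dinf)
  show ?thesis
  proof (rule has_dimension_Ext1I[where \<Lambda> = "coinv q"]; unfold corner_eq[symmetric])
    fix x j assume x: "x \<in> corner q" and j: "j \<in> index q"
    note fx = cornerD(1)[OF x]
    show "coinv q ((k \<odot>\<^bsub>LA\<^esub> \<one>\<^bsub>LA\<^esub>) \<odot>\<^bsub>CM q\<^esub> x) j = k * coinv q x j" for k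
      unfolding scalar_act[OF corner_chen[OF x]]
      using coinv_lincomb[OF fx cornerD(1)[OF zero_corner], of q k j] by (simp add: coinv_def)
    fix y assume y: "y \<in> corner q"
    show "coinv q (x \<oplus>\<^bsub>CM q\<^esub> y) j = coinv q x j + coinv q y j"
      using coinv_lincomb[OF fx cornerD(1)[OF y], of q 1 j] by (simp add: chen_simps(3))
  next
    fix x assume x: "x \<in> corner q"
    have "{j \<in> index q. coinv q x j \<noteq> 0} \<subseteq> root q ` {p. x p \<noteq> 0}"
    proof
      fix j assume "j \<in> {j \<in> index q. coinv q x j \<noteq> 0}"
      then have "(\<Sum>p | x p \<noteq> 0. x p * of_bool (root q p = j)) \<noteq> 0" by (simp add: coinv_def)
      then obtain p where "x p \<noteq> 0" "x p * of_bool (root q p = j) \<noteq> 0"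
        by (rule sum.not_neutral_contains_not_neutral) blast
      then show "j \<in> root q ` {p. x p \<noteq> 0}" by (auto split: if_splits)
    qed
    then show "finite {j \<in> index q. coinv q x j \<noteq> 0}"
      using cornerD(1)[OF x] by (auto elim: finite_subset)
    show "(\<exists>n\<in>corner q. x = s \<odot>\<^bsub>CM q\<^esub> n) \<longleftrightarrow> (\<forall>j\<in>index q. coinv q x j = 0)"
    proof
      assume "\<exists>n\<in>corner q. x = s \<odot>\<^bsub>CM q\<^esub> n"
      then show "\<forall>j\<in>index q. coinv q x j = 0" using coinv_s by blast
    next
      assume "\<forall>j\<in>index q. coinv q x j = 0"
      then have "coinv q x j = 0" for j using coinv_outside[OF x] by blast
      then show "\<exists>n\<in>corner q. x = s \<odot>\<^bsub>CM q\<^esub> n" using coinv_decomposition[OF x] by (auto simp: fun_eq_iff)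
    qed
  next
    fix j assume j: "j \<in> index q"
    then show "\<exists>x\<in>corner q. \<forall>i\<in>index q. coinv q x i = of_bool (i = j)"
      using delta_corner index_based by (intro bexI[of _ "delta j"]) (auto simp: coinv_delta root_index)
  qed
qed

end

section \<open>The two dimension formulas\<close>

lemma has_dimension_ordIso: "has_dimension V r \<Longrightarrow> r =o r' \<Longrightarrow> has_dimension V r'"
  unfolding has_dimension_def using ordIso_transitive by blast

theorem proposition3p13:
  fixes K :: "'k::field itself"
    and E :: "('v, 'e) pre_digraph"
    and d :: "'e list"
    and q :: "('v, 'e) bpath"
  assumes "fin_digraph E"
    and "simple_closed_path E d"
    and "q \<in> bpaths E"
  shows "(chen_module K E q \<noteq> chen_module K E (InfPath (cycle d)) \<longrightarrow>
            has_dimension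
              (Ext1 (lpa K E) (chen_module K E (InfPath (cycle d))) (chen_module K E q))
              |nondivisible_paths E d q| ) \<and>
         has_dimension
           (Ext1 (lpa K E) (chen_module K E (InfPath (cycle d))) (chen_module K E (InfPath (cycle d))))
           ( |nondivisible_paths E d (InfPath (cycle d))| +c cone)"
proof -
  interpret leavitt_cycle E K d
    using assms by (intro leavitt_cycle.intro leavitt.intro leavitt_cycle_axioms.intro)
  have dinf: "InfPath (Stream.cycle d) = dinf" by (simp add: dinf_def)
  \<comment> \<open>Since \<open>dinf\<close> is divisible by d, it is not already counted, and its
    chain contributes a genuine extra dimension.\<close>
  have disjoint: "nondivisible_paths E d dinf \<inter> {dinf} = {}"
  proof -
    have "divisible E d dinf"
      unfolding divisible_def by (rule bexI[of _ dinf]) (simp_all only: bappend_d_dinf dinf_closed)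
    then show ?thesis by (auto simp: nondivisible_paths_def)
  qed
  have 1: "index q = nondivisible_paths E d q" if ne: "chen_module K E q \<noteq> chen_module K E dinf"
  proof -
    \<comment> \<open>The Chen module depends on q only through its tail class, so different modules
      force \<open>dinf\<close> out of the class of q.\<close>
    have "dinf \<notin> tail_class E q"
    proof
      assume "dinf \<in> tail_class E q"
      then have "tail_equiv dinf q" by (simp add: tail_class_def)
      then have "tail_class E q = tail_class E dinf"
        unfolding tail_class_def using tail_equiv_trans tail_equiv_sym by blast
      then show False using ne by (simp add: chen_module_def)
    qed
    then show ?thesis by (simp add: index_def)
  qed
  \<comment> \<open>The extra point of the cardinal sum is sent to \<open>dinf\<close>.\<close>
  have "bij_betw (case_sum id (\<lambda>_. dinf)) (nondivisible_paths E d dinf <+> {()}) (index dinf)"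
    using disjoint dinf_class by (auto simp: bij_betw_def inj_on_def index_def Plus_def image_Un image_image)
  then have "|nondivisible_paths E d dinf <+> {()}| =o |index dinf|" using card_of_ordIso by blast
  then have 2: "|index dinf| =o |nondivisible_paths E d dinf| +c cone"
    unfolding cone_def using Plus_csum ordIso_symmetric ordIso_transitive by blast
  show ?thesis
    unfolding dinf using has_dimension_Ext1_dinf[of q] 1 has_dimension_ordIso[OF has_dimension_Ext1_dinf 2] by auto
qed

end
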